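(* For every prime $l$, the classical modular polynomial $\Phi_l$ satisfies $$h(\Phi_l)\le 6l\log l + 16l + 14\sqrt{l}\log l .$$
   Context: Let $j:\mathbb{H}\to\mathbb{C}$ be the elliptic modular $j$-function on the upper half-plane. For a prime $l$, the classical modular polynomial $\Phi_l(X,Y)\in\mathbb{Z}[X,Y]$ is the minimal polynomial of $j(lz)$ over $\mathbb{C}(j)$; it is symmetric of degree $l+1$ in each variable and satisfies $\Phi_l(X,j(z))=(X-j(lz))\prod_{b=0}^{l-1}(X-j((z+b)/l))$. For a nonzero polynomial $P$ with complex coefficients, $h(P)=\log\max|c|$, where $c$ ranges over the coefficients of $P$; $\log$ is the natural logarithm. *)

theory Defs
  imports "HOL-Analysis.Analysis" "HOL-Computational_Algebra.Computational_Algebra"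
    "HOL-Computational_Algebra.Field_as_Ring"
begin

definition upper_half_plane :: "complex set" where
  "upper_half_plane = {z. Im z > 0}"

text \<open>The lattice sums below converge absolutely for \<open>k \<ge> 3\<close> and \<open>Im z > 0\<close>.\<close>

definition eisenstein_G :: "nat \<Rightarrow> complex \<Rightarrow> complex" where
  "eisenstein_G k z =
     (\<Sum>\<^sub>\<infinity>(m, n)\<in>UNIV - {(0::int, 0::int)}. 1 / (of_int m * z + of_int n) ^ k)"

definition weierstrass_g2 :: "complex \<Rightarrow> complex" where
  "weierstrass_g2 z = 60 * eisenstein_G 4 z"

definition weierstrass_g3 :: "complex \<Rightarrow> complex" where
  "weierstrass_g3 z = 140 * eisenstein_G 6 z"

text \<open>Normalised so that \<open>j(\<i>) = 1728\<close>, i.e. \<open>j = 1/q + 744 + \<dots>\<close>.\<close>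

definition modular_j :: "complex \<Rightarrow> complex" where
  "modular_j z =
     1728 * weierstrass_g2 z ^ 3 / (weierstrass_g2 z ^ 3 - 27 * weierstrass_g3 z ^ 2)"

text \<open>
  As \<open>j\<close> is non-constant, the field \<open>\<complex>(j)\<close> of meromorphic functions is the field \<open>\<complex>(Y)\<close> of
  rational functions, here \<^typ>\<open>complex poly fract\<close>, with \<open>r\<close> standing for the meromorphic
  function \<open>r(j(z))\<close>. Its value at a pole is a junk value (\<open>x / 0 = 0\<close>), which is why identities
  between such functions are only required outside a discrete subset of the upper half-plane.
\<close>

definition ratfun_at_j :: "complex poly fract \<Rightarrow> complex \<Rightarrow> complex" where
  "ratfun_at_j r z =
     poly (fst (quot_of_fract r)) (modular_j z) / poly (snd (quot_of_fract r)) (modular_j z)"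

definition annihilates_over_Cj :: "(complex \<Rightarrow> complex) \<Rightarrow> complex poly fract poly \<Rightarrow> bool" where
  "annihilates_over_Cj f Q \<longleftrightarrow>
     (\<forall>\<^sub>\<approx>z\<in>upper_half_plane. (\<Sum>i\<le>degree Q. ratfun_at_j (coeff Q i) z * f z ^ i) = 0)"

definition minimal_poly_over_Cj :: "(complex \<Rightarrow> complex) \<Rightarrow> complex poly fract poly \<Rightarrow> bool" where
  "minimal_poly_over_Cj f Q \<longleftrightarrow>
     lead_coeff Q = 1 \<and> annihilates_over_Cj f Q \<and>
     (\<forall>R. R \<noteq> 0 \<and> annihilates_over_Cj f R \<longrightarrow> degree Q \<le> degree R)"

text \<open>
  Bivariate polynomials \<open>P(X, Y)\<close> are polynomials in \<open>X\<close> (outer) with coefficients in \<open>\<complex>[Y]\<close>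
  (inner); \<open>modular_polynomial l\<close> is the element of \<open>\<complex>[Y][X]\<close> whose image in \<open>\<complex>(Y)[X] = \<complex>(j)[X]\<close>
  is the minimal polynomial of \<open>j(l z)\<close>. Its coefficients are in fact integers.
\<close>

definition modular_polynomial :: "nat \<Rightarrow> complex poly poly" where
  "modular_polynomial l =
     (THE P. minimal_poly_over_Cj (\<lambda>z. modular_j (of_nat l * z)) (map_poly to_fract P))"

text \<open>The maximum includes the vanishing coefficients, which is harmless for \<open>P \<noteq> 0\<close> and makes
  the range run over all pairs of exponents; it is a finite set.\<close>

definition poly2_height :: "complex poly poly \<Rightarrow> real" where
  "poly2_height P = ln (Max (range (\<lambda>(i, k). cmod (coeff (coeff P i) k))))"

end

(*
  The coefficients of Phi_l are bounded by Cauchy's estimate on |Y| = 1, that is by the product of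
  1 + |j(w)| over the l + 1 points w = l z, (z + b) / l, where z lies in the fundamental domain and
  |j(z)| = 1.  Write 1 + |j| = G / D with the SL_2(Z)-invariant functions
  G = Im^6 (|E4|^3 + |Delta|) and D = Im^6 |Delta|.  The product of Delta over the points w is
  Delta(z)^(l+1) up to a unit, so the denominators contribute exactly
  6 (l - 1) log l - (l + 1) log D(z).  On the fundamental domain G is at most 1.24 max(2, Im)^6, so
  what remains is to bound the sum of log^+ (Im w' / 2) over the reductions w' of the points w.  A
  point with a high reduction corresponds to a short vector of the lattice Z + Z z, and different
  points give different vectors up to sign, so the sum is at most a sum of log^+ (l y / (2 |v|^2))
  over lattice vectors v, with y = Im z.  Comparison with the integral gives pi l / 4 + O(sqrt l).

  Phi_l exists and has degree l + 1 in X because a holomorphic modular function with at most a pole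
  at the cusp is a polynomial in j (induction on the order of the pole and the maximum modulus
  principle) and because the l + 1 functions j(w) are distinct and conjugate over C(j).  The
  q-expansions of E4 and E6 come from differentiating the reflection formula of the digamma function.
*)
theory Submission
  imports Defs "HOL-Complex_Analysis.Complex_Analysis"
begin

section \<open>Eisenstein series\<close>

text \<open>The coefficient 16 leaves little room, and this fixes the constants. Each of the l + 1
  points pays 6.65 for \<open>- ln (Delta_invariant z)\<close>, 0.24 for log 1.24, 6 log 2 for the
  threshold 2 and, on average, 6 pi / 4 for the lattice sum, together less than 15.8. With a
  threshold h in place of 2 the last two items would be 6 (log h + pi / (2 h)), which is least at h
  = pi / 2, so 2 is close to optimal. The point l z alone adds at most 6 log l, which is just the
  gap between 6 (l - 1) log l and 6 l log l. The O(sqrt l) part fits under 14 sqrt l log l once log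
  l >= 1; l = 2 is treated separately. Non-vanishing of Delta comes from the numerical estimate
  |Delta - q| <= 36 |q|^2 on the fundamental domain, and the maximum principle is set up for
  functions whose modulus is invariant. Primality of l makes inversion permute the l + 1 points,
  since residues prime to l have negative inverses, and makes a short vector determine the index b
  that it comes from.\<close>

lemma lattice_norm_lower_bound:
  assumes "Im z > 0"
  obtains d where "d > 0"
    "\<And>m n :: int. d * sqrt (of_int m ^ 2 + of_int n ^ 2) \<le> cmod (of_int m * z + of_int n)"
proof -
  define y where "y = Im z"
  define K where "K = sqrt (1 / y ^ 2 + (1 + cmod z / y) ^ 2)"
  have y: "y > 0" using assms by (simp add: y_def)
  have K: "K > 0" unfolding K_def using y by (simp add: add_pos_nonneg)
  have "sqrt (of_int m ^ 2 + of_int n ^ 2) \<le> K * cmod (of_int m * z + of_int n)" for m n :: int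
  proof -
    define v where "v = cmod (of_int m * z + of_int n)"
    \<comment> \<open>The imaginary part bounds \<open>m\<close> alone; \<open>n\<close> is then
      recovered from \<open>v\<close> and \<open>m\<close> by the triangle inequality. This yields
      the two summands under the root in \<open>K\<close>.\<close>
    have "\<bar>of_int m\<bar> * y \<le> v"
      using abs_Im_le_cmod[of "of_int m * z + of_int n"] y by (simp add: v_def y_def abs_mult)
    hence m: "\<bar>real_of_int m\<bar> \<le> v / y" using y by (simp add: field_simps)
    have "\<bar>real_of_int n\<bar> = cmod ((of_int m * z + of_int n) - of_int m * z)" by simp
    also have "\<dots> \<le> v + \<bar>of_int m\<bar> * cmod z"
      unfolding v_def by (metis norm_triangle_ineq4 norm_mult norm_of_int)
    also have "\<dots> \<le> v + (v / y) * cmod z" using m by (intro add_left_mono mult_right_mono) auto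
    also have "\<dots> = v * (1 + cmod z / y)" by (simp add: field_simps)
    finally have n: "\<bar>real_of_int n\<bar> \<le> v * (1 + cmod z / y)" .
    have "real_of_int m ^ 2 + real_of_int n ^ 2 \<le> (v / y) ^ 2 + (v * (1 + cmod z / y)) ^ 2"
      using m n by (intro add_mono) (metis abs_ge_zero power_mono power2_abs)+
    also have "\<dots> = (1 / y ^ 2 + (1 + cmod z / y) ^ 2) * v ^ 2"
      by (simp only: power_mult_distrib power_divide) (simp add: distrib_right)
    finally have "sqrt (real_of_int m ^ 2 + real_of_int n ^ 2) \<le> sqrt \<dots>"
      by (rule real_sqrt_le_mono)
    also have "\<dots> = K * v" by (simp add: real_sqrt_mult K_def v_def)
    finally show ?thesis unfolding v_def .
  qed
  thus ?thesis using K by (intro that[of "1 / K"]) (auto simp: field_simps)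
qed

lemma inverse_one_plus_square_summable_on_int:
  "(\<lambda>n::int. 1 / (1 + real_of_int n ^ 2)) summable_on UNIV"
proof -
  have nat: "(\<lambda>n::nat. 1 / (1 + real n ^ 2)) summable_on UNIV"
  proof (rule summable_nonneg_imp_summable_on)
    have "summable (\<lambda>n. inverse (real n ^ 2))" by (rule inverse_power_summable) simp
    hence "summable (\<lambda>n. inverse (real (Suc n) ^ 2))" by (subst summable_Suc_iff)
    moreover have "norm (1 / (1 + real (Suc n) ^ 2)) \<le> inverse (real (Suc n) ^ 2)" for n
    proof -
      have "norm (1 / (1 + real (Suc n) ^ 2)) = inverse (1 + real (Suc n) ^ 2)"
        by (simp only: norm_divide norm_one real_norm_def inverse_eq_divide)
           (simp add: add_nonneg_nonneg)
      also have "\<dots> \<le> inverse (real (Suc n) ^ 2)" by (intro le_imp_inverse_le) auto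
      finally show ?thesis .
    qed
    ultimately have "summable (\<lambda>n. 1 / (1 + real (Suc n) ^ 2))"
      by (rule summable_comparison_test'[where N = 0])
    thus "summable (\<lambda>n. 1 / (1 + real n ^ 2))"
      by (subst (asm) summable_Suc_iff[of "\<lambda>n. 1 / (1 + real n ^ 2)"])
  qed auto
  have 1: "(\<lambda>n::int. 1 / (1 + real_of_int n ^ 2)) summable_on range int"
    by (subst summable_on_reindex) (use nat in \<open>auto simp: o_def\<close>)
  have 2: "(\<lambda>n::int. 1 / (1 + real_of_int n ^ 2)) summable_on range (\<lambda>n. - int n)"
    by (subst summable_on_reindex) (use nat in \<open>auto simp: o_def inj_on_def\<close>)
  have "range int \<union> range (\<lambda>n. - int n) = UNIV"
    by (auto simp: image_iff) (metis int_cases2)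
  thus ?thesis
    using summable_on_union[OF 1 summable_on_subset_banach[OF 2, of "range (\<lambda>n. - int n) - range int"]]
    by (simp add: Un_Diff_cancel)
qed

text \<open>The majorant is a product of two convergent one-variable series: with N = m^2 + n^2 >= 1
  one has (1 + m^2) (1 + n^2) <= 3 N^2, while an exponent of at least 4 makes the denominator at
  least \<open>d ^ k * N ^ 2\<close>.\<close>

lemma lattice_abs_summable:
  assumes "Im z > 0" "k \<ge> 4"
  shows "(\<lambda>p. norm (case p of (m, n) \<Rightarrow> 1 / (of_int m * z + of_int n) ^ k)) summable_on
           (UNIV - {(0::int, 0::int)})"
proof -
  obtain d where d: "d > 0"
    "\<And>m n :: int. d * sqrt (of_int m ^ 2 + of_int n ^ 2) \<le> cmod (of_int m * z + of_int n)"
    using lattice_norm_lower_bound[OF assms(1)] by blast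
  define g where "g = (\<lambda>n::int. 1 / (1 + real_of_int n ^ 2))"
  have "(\<lambda>p. norm (case p of (m, n) \<Rightarrow> g m * g n)) summable_on (UNIV \<times> UNIV)"
  proof (subst Infinite_Sum.abs_summable_on_Sigma_iff, intro conjI ballI)
    have g: "(\<lambda>n. norm (g n)) summable_on UNIV"
      using inverse_one_plus_square_summable_on_int by (simp add: g_def)
    show "(\<lambda>y. norm (case (m, y) of (m, n) \<Rightarrow> g m * g n)) summable_on UNIV" for m
      using summable_on_cmult_right[OF g, of "norm (g m)"] by (simp add: norm_mult abs_mult)
    show "(\<lambda>x. norm (\<Sum>\<^sub>\<infinity>y. norm (case (x, y) of (m, n) \<Rightarrow> g m * g n))) summable_on UNIV"
      using summable_on_cmult_left[OF g, of "infsum (\<lambda>n. norm (g n)) UNIV"]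
      by (simp add: norm_mult abs_mult infsum_cmult_right' abs_of_nonneg infsum_nonneg)
  qed
  hence s: "(\<lambda>p. 3 / d ^ k * norm ((\<lambda>(m, n). g m * g n) p)) summable_on (UNIV - {(0, 0)})"
    by (intro summable_on_cmult_right) (auto intro: summable_on_subset_banach)
  show ?thesis
  proof (rule Infinite_Sum.abs_summable_on_comparison_test'[OF s])
    fix p :: "int \<times> int" assume p: "p \<in> UNIV - {(0, 0)}"
    obtain m n where [simp]: "p = (m, n)" by force
    define N where "N = real_of_int m ^ 2 + real_of_int n ^ 2"
    have "m ^ 2 + n ^ 2 > 0" using p by (simp add: sum_power2_gt_zero_iff)
    hence "m ^ 2 + n ^ 2 \<ge> 1" by simp
    hence "real_of_int (m ^ 2 + n ^ 2) \<ge> 1" by (subst of_int_1_le_iff)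
    hence N: "N \<ge> 1" by (simp add: N_def)
    have mn: "real_of_int m ^ 2 * real_of_int n ^ 2 \<le> N ^ 2"
      by (simp add: N_def power2_sum)
    have N2: "N \<le> N ^ 2" using N by (simp add: power2_eq_square)
    have "(1 + real_of_int m ^ 2) * (1 + real_of_int n ^ 2)
            = 1 + N + real_of_int m ^ 2 * real_of_int n ^ 2" by (simp add: N_def algebra_simps)
    also have "\<dots> \<le> 3 * N ^ 2" using mn N2 N by linarith
    finally have A: "(1 + real_of_int m ^ 2) * (1 + real_of_int n ^ 2) \<le> 3 * N ^ 2" .
    have "sqrt N ^ 4 = (sqrt N ^ 2) ^ 2" by (simp flip: power_mult)
    hence "d ^ k * N ^ 2 = d ^ k * sqrt N ^ 4" using N by simp
    also have "\<dots> \<le> d ^ k * sqrt N ^ k" using assms N d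
      by (intro mult_left_mono power_increasing) auto
    also have "\<dots> = (d * sqrt N) ^ k" by (simp add: power_mult_distrib)
    also have "\<dots> \<le> cmod (of_int m * z + of_int n) ^ k"
      using d N by (intro power_mono) (auto simp: N_def)
    finally have B: "d ^ k * N ^ 2 \<le> cmod (of_int m * z + of_int n) ^ k" .
    have "norm (1 / (of_int m * z + of_int n) ^ k) = 1 / cmod (of_int m * z + of_int n) ^ k"
      by (simp add: norm_divide norm_power)
    also have "\<dots> \<le> 1 / (d ^ k * N ^ 2)" using B d N by (intro divide_left_mono) (auto intro!: mult_pos_pos order.strict_trans2[OF _ B])
    also have "\<dots> = 3 / d ^ k * (1 / (3 * N ^ 2))" by simp
    also have "\<dots> \<le> 3 / d ^ k * (1 / ((1 + real_of_int m ^ 2) * (1 + real_of_int n ^ 2)))"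
      using A d N by (intro mult_left_mono divide_left_mono) (auto intro!: mult_pos_pos add_pos_nonneg)
    also have "\<dots> = 3 / d ^ k * norm (g m * g n)"
      by (simp add: g_def abs_mult)
    finally show "norm (case p of (m, n) \<Rightarrow> 1 / (of_int m * z + of_int n) ^ k)
            \<le> 3 / d ^ k * norm (case p of (m, n) \<Rightarrow> g m * g n)" by simp
  qed
qed

lemma denominator_nonzero:
  fixes c d :: int
  assumes "Im z > 0" "(c, d) \<noteq> (0, 0)"
  shows "of_int c * z + of_int d \<noteq> 0"
proof
  assume *: "of_int c * z + of_int d = 0"
  hence "Im (of_int c * z + of_int d) = 0" by simp
  hence "c = 0" using assms by simp
  thus False using * assms by simp
qed

abbreviation moebius :: "int \<Rightarrow> int \<Rightarrow> int \<Rightarrow> int \<Rightarrow> complex \<Rightarrow> complex" where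
  "moebius a b c d z \<equiv> (of_int a * z + of_int b) / (of_int c * z + of_int d)"

text \<open>The matrix permutes the nonzero lattice vectors, and each denominator picks up the same
  power of \<open>w\<close>. Reindexing and pulling a constant out of \<open>infsum\<close> are
  unconditional here, so the identity holds for every \<open>k\<close>.\<close>

lemma eisenstein_G_transform:
  fixes a b c d :: int
  assumes z: "Im z > 0" and det: "a * d - b * c = 1"
  shows "eisenstein_G k (moebius a b c d z)
           = (of_int c * z + of_int d) ^ k * eisenstein_G k z"
proof -
  define w where "w = of_int c * z + of_int d"
  have "(c, d) \<noteq> (0, 0)" using det by auto
  hence w: "w \<noteq> 0" unfolding w_def using denominator_nonzero[OF z] by blast
  have "(m * a + n * c) * d - (m * b + n * d) * c = m * (a * d - b * c)"
       "(m * b + n * d) * a - (m * a + n * c) * b = n * (a * d - b * c)"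
       "(m * d - n * c) * a + (n * a - m * b) * c = m * (a * d - b * c)"
       "(m * d - n * c) * b + (n * a - m * b) * d = n * (a * d - b * c)" for m n
    by (auto simp: algebra_simps)
  hence inv1: "(m * a + n * c) * d - (m * b + n * d) * c = m" "(m * b + n * d) * a - (m * a + n * c) * b = n"
    and inv2: "(m * d - n * c) * a + (n * a - m * b) * c = m" "(m * d - n * c) * b + (n * a - m * b) * d = n"
    for m n by (simp_all add: det)
  have "eisenstein_G k ((of_int a * z + of_int b) / w)
     = (\<Sum>\<^sub>\<infinity>(m, n)\<in>UNIV - {(0::int, 0::int)}. w ^ k * (1 / (of_int m * z + of_int n) ^ k))"
    unfolding eisenstein_G_def
  proof (rule infsum_reindex_bij_witness[where
        j = "\<lambda>(m, n). (m * a + n * c, m * b + n * d)" and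
        i = "\<lambda>(m, n). (m * d - n * c, n * a - m * b)"], goal_cases)
    case (1 p)
    obtain m n where p: "p = (m, n)" by force
    show ?case using inv1[of m n] by (simp add: p)
  next
    case (2 p)
    obtain m n where p: "p = (m, n)" by force
    show ?case using inv1[of m n] 2 by (auto simp: p)
  next
    case (3 p)
    obtain m n where p: "p = (m, n)" by force
    show ?case using inv2[of m n] by (simp add: p)
  next
    case (4 p)
    obtain m n where p: "p = (m, n)" by force
    show ?case using inv2[of m n] 4 by (auto simp: p)
  next
    case (5 p)
    obtain m n where p: "p = (m, n)" by force
    have "of_int m * ((of_int a * z + of_int b) / w) + of_int n
            = (of_int (m * a + n * c) * z + of_int (m * b + n * d)) / w"
    proof -
      have "of_int (m * a + n * c) * z + of_int (m * b + n * d)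
              = of_int m * (of_int a * z + of_int b) + of_int n * w"
        by (simp add: w_def algebra_simps)
      thus ?thesis using w by (simp add: add_divide_distrib[of _ "of_int n * w"])
    qed
    thus ?case by (simp add: p power_divide)
  qed
  also have "\<dots> = w ^ k * eisenstein_G k z"
    unfolding eisenstein_G_def by (subst infsum_cmult_right' [symmetric]) (simp add: case_prod_unfold)
  finally show ?thesis unfolding w_def .
qed

section \<open>Partial fractions of the cotangent and its derivatives\<close>

text \<open>Off the integers Gamma(z) Gamma(1 - z) sin(pi z) is the constant pi, so its derivative
  vanishes; dividing by the nonzero Gamma factors leaves the claim.\<close>

lemma Digamma_reflection:
  fixes z :: complex
  assumes "z \<notin> \<int>"
  shows "Digamma (1 - z) - Digamma z = of_real pi * cot (of_real pi * z)"
proof -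
  have 1: "1 - z \<notin> \<int>" using assms Ints_diff[of 1 "1-z"] by auto
  have n: "z \<notin> \<int>\<^sub>\<le>\<^sub>0" "1 - z \<notin> \<int>\<^sub>\<le>\<^sub>0" using assms 1 by auto
  have s: "sin (of_real pi * z) \<noteq> 0" using assms by (subst sin_eq_0) auto
  have op: "open (UNIV - \<int> :: complex set)" by (auto simp: open_Diff)
  have "((\<lambda>z. Gamma z * Gamma (1 - z) * sin (of_real pi * z)) has_field_derivative
          Gamma z * Gamma (1 - z) * ((Digamma z - Digamma (1 - z)) * sin (of_real pi * z)
            + of_real pi * cos (of_real pi * z))) (at z)"
    using n by (auto intro!: derivative_eq_intros simp: algebra_simps)
  moreover have "((\<lambda>z. Gamma z * Gamma (1 - z) * sin (of_real pi * z)) has_field_derivative 0) (at z)"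
  proof (rule has_field_derivative_transform_within_open[OF _ op])
    show "((\<lambda>_. of_real pi) has_field_derivative 0) (at z)" by simp
    fix x :: complex assume "x \<in> UNIV - \<int>"
    hence "sin (of_real pi * x) \<noteq> 0" by (subst sin_eq_0) auto
    thus "of_real pi = Gamma x * Gamma (1 - x) * sin (of_real pi * x)"
      by (subst Gamma_reflection_complex) simp
  qed (use assms in auto)
  ultimately have "Gamma z * Gamma (1 - z) * ((Digamma z - Digamma (1 - z)) * sin (of_real pi * z)
            + of_real pi * cos (of_real pi * z)) = 0" by (rule DERIV_unique)
  hence "(Digamma z - Digamma (1 - z)) * sin (of_real pi * z) + of_real pi * cos (of_real pi * z) = 0"
    using n by (simp add: Gamma_eq_zero_iff)
  thus ?thesis using s by (simp add: cot_def field_simps)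
qed

text \<open>The n-th derivative of pi cot(pi z), written through polygamma values; the sign comes
  from differentiating in 1 - z.\<close>

definition Polygamma_refl :: "nat \<Rightarrow> complex \<Rightarrow> complex" where
  "Polygamma_refl n z = (-1) ^ n * Polygamma n (1 - z) - Polygamma n z"

lemma has_field_derivative_Polygamma_refl:
  assumes "z \<notin> \<int>"
  shows "(Polygamma_refl n has_field_derivative Polygamma_refl (Suc n) z) (at z)"
proof -
  have 1: "1 - z \<notin> \<int>" using assms Ints_diff[of 1 "1-z"] by auto
  have n: "z \<notin> \<int>\<^sub>\<le>\<^sub>0" "1 - z \<notin> \<int>\<^sub>\<le>\<^sub>0" using assms 1 by auto
  have "((\<lambda>z. (-1) ^ n * Polygamma n (1 - z) - Polygamma n z) has_field_derivative
          Polygamma_refl (Suc n) z) (at z)"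
    using n by (auto intro!: derivative_eq_intros DERIV_chain2[of "Polygamma n"] simp: Polygamma_refl_def)
  thus ?thesis by (simp add: Polygamma_refl_def[abs_def])
qed

lemma has_field_derivative_cot_pi:
  fixes z :: complex
  assumes "z \<notin> \<int>"
  shows "((\<lambda>z. cot (of_real pi * z)) has_field_derivative
           - of_real pi * (1 + cot (of_real pi * z) ^ 2)) (at z)"
proof -
  have s: "sin (of_real pi * z) \<noteq> 0" using assms by (subst sin_eq_0) auto
  have "((\<lambda>z. cot (of_real pi * z)) has_field_derivative
           - inverse (sin (of_real pi * z) ^ 2) * of_real pi) (at z)"
    using s by (intro DERIV_chain2[OF DERIV_cot]) (auto intro!: derivative_eq_intros)
  also have "inverse (sin (of_real pi * z) ^ 2) = 1 + cot (of_real pi * z) ^ 2"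
    using s sin_cos_squared_add[of "of_real pi * z"] by (simp add: cot_def field_simps)
  finally show ?thesis by (simp only: mult_minus_left mult_minus_right mult.commute)
qed

text \<open>Since cot' = -(1 + cot^2), differentiation turns f(t) with t = cot(pi z) into -pi (1 +
  t^2) f'(t), so the derivatives of pi cot(pi z) stay polynomials in t. Passing
  \<open>m = Suc n\<close> as an equation lets \<open>m\<close> be a numeral.\<close>

lemma Polygamma_refl_step:
  assumes f: "\<And>z. z \<notin> \<int> \<Longrightarrow> Polygamma_refl n z = f (cot (of_real pi * z))"
    and f': "\<And>t. (f has_field_derivative f' t) (at t)"
    and g: "\<And>t. g t = f' t * (- of_real pi * (1 + t ^ 2))"
    and z: "z \<notin> \<int>" and m: "m = Suc n"
  shows "Polygamma_refl m z = g (cot (of_real pi * z))"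
  unfolding m
proof (rule DERIV_unique)
  show "(Polygamma_refl n has_field_derivative Polygamma_refl (Suc n) z) (at z)"
    by (rule has_field_derivative_Polygamma_refl[OF z])
  have op: "open (UNIV - \<int> :: complex set)" by (auto simp: open_Diff)
  show "(Polygamma_refl n has_field_derivative g (cot (of_real pi * z))) (at z)"
    unfolding g
    by (rule has_field_derivative_transform_within_open[OF
          DERIV_chain2[OF f' has_field_derivative_cot_pi[OF z]] op])
       (use f z in auto)
qed

lemma Polygamma_refl_closed:
  assumes "z \<notin> \<int>"
  defines "t \<equiv> cot (of_real pi * z)"
  shows "Polygamma_refl 3 z = - 2 * of_real pi ^ 4 * (1 + t ^ 2) * (1 + 3 * t ^ 2)"
    and "Polygamma_refl 5 z = - 8 * of_real pi ^ 6 * (1 + t ^ 2) * (2 + 15 * t ^ 2 + 15 * t ^ 4)"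
proof -
  let ?p = "of_real pi :: complex"
  have 0: "Polygamma_refl 0 z = ?p * cot (?p * z)" if "z \<notin> \<int>" for z
    using Digamma_reflection[OF that] by (simp add: Polygamma_refl_def)
  have 1: "Polygamma_refl 1 z = (\<lambda>t. - (?p ^ 2) * (1 + t ^ 2)) (cot (?p * z))" if "z \<notin> \<int>" for z
  proof (rule Polygamma_refl_step[where n = 0 and f = "\<lambda>t. ?p * t" and f' = "\<lambda>t. ?p", OF _ _ _ that])
    show "((\<lambda>t. ?p * t) has_field_derivative ?p) (at t)" for t
      by (rule derivative_eq_intros refl)+ (simp add: algebra_simps)
    show "- (?p ^ 2) * (1 + t ^ 2) = ?p * (- ?p * (1 + t ^ 2))" for t
      by (simp add: eval_nat_numeral algebra_simps)
  qed (use 0 in auto)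
  have 2: "Polygamma_refl 2 z = (\<lambda>t. 2 * ?p ^ 3 * (t + t ^ 3)) (cot (?p * z))" if "z \<notin> \<int>" for z
  proof (rule Polygamma_refl_step[where n = 1 and f = "\<lambda>t. - (?p ^ 2) * (1 + t ^ 2)" and f' = "\<lambda>t. - (?p ^ 2) * (2 * t)", OF _ _ _ that])
    show "((\<lambda>t. - (?p ^ 2) * (1 + t ^ 2)) has_field_derivative - (?p ^ 2) * (2 * t)) (at t)" for t
      by (rule derivative_eq_intros refl)+ (simp add: algebra_simps)
    show "2 * ?p ^ 3 * (t + t ^ 3) = - (?p ^ 2) * (2 * t) * (- ?p * (1 + t ^ 2))" for t
      by (simp add: eval_nat_numeral algebra_simps)
  qed (use 1 in auto)
  have 3: "Polygamma_refl 3 z = (\<lambda>t. - 2 * ?p ^ 4 * (1 + 4 * t ^ 2 + 3 * t ^ 4)) (cot (?p * z))" if "z \<notin> \<int>" for z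
  proof (rule Polygamma_refl_step[where n = 2 and f = "\<lambda>t. 2 * ?p ^ 3 * (t + t ^ 3)" and f' = "\<lambda>t. 2 * ?p ^ 3 * (1 + 3 * t ^ 2)", OF _ _ _ that])
    show "((\<lambda>t. 2 * ?p ^ 3 * (t + t ^ 3)) has_field_derivative 2 * ?p ^ 3 * (1 + 3 * t ^ 2)) (at t)" for t
      by (rule derivative_eq_intros refl)+ (simp add: algebra_simps)
    show "- 2 * ?p ^ 4 * (1 + 4 * t ^ 2 + 3 * t ^ 4) = 2 * ?p ^ 3 * (1 + 3 * t ^ 2) * (- ?p * (1 + t ^ 2))" for t
      by (simp add: eval_nat_numeral algebra_simps)
  qed (use 2 in auto)
  have 4: "Polygamma_refl 4 z = (\<lambda>t. 2 * ?p ^ 5 * (8 * t + 20 * t ^ 3 + 12 * t ^ 5)) (cot (?p * z))" if "z \<notin> \<int>" for z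
  proof (rule Polygamma_refl_step[where n = 3 and f = "\<lambda>t. - 2 * ?p ^ 4 * (1 + 4 * t ^ 2 + 3 * t ^ 4)" and f' = "\<lambda>t. - 2 * ?p ^ 4 * (8 * t + 12 * t ^ 3)", OF _ _ _ that])
    show "((\<lambda>t. - 2 * ?p ^ 4 * (1 + 4 * t ^ 2 + 3 * t ^ 4)) has_field_derivative - 2 * ?p ^ 4 * (8 * t + 12 * t ^ 3)) (at t)" for t
      by (rule derivative_eq_intros refl)+ (simp add: algebra_simps)
    show "2 * ?p ^ 5 * (8 * t + 20 * t ^ 3 + 12 * t ^ 5) = - 2 * ?p ^ 4 * (8 * t + 12 * t ^ 3) * (- ?p * (1 + t ^ 2))" for t
      by (simp add: eval_nat_numeral algebra_simps)
  qed (use 3 in auto)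
  have 5: "Polygamma_refl 5 z = (\<lambda>t. - 2 * ?p ^ 6 * (1 + t ^ 2) * (8 + 60 * t ^ 2 + 60 * t ^ 4)) (cot (?p * z))" if "z \<notin> \<int>" for z
  proof (rule Polygamma_refl_step[where n = 4 and f = "\<lambda>t. 2 * ?p ^ 5 * (8 * t + 20 * t ^ 3 + 12 * t ^ 5)" and f' = "\<lambda>t. 2 * ?p ^ 5 * (8 + 60 * t ^ 2 + 60 * t ^ 4)", OF _ _ _ that])
    show "((\<lambda>t. 2 * ?p ^ 5 * (8 * t + 20 * t ^ 3 + 12 * t ^ 5)) has_field_derivative 2 * ?p ^ 5 * (8 + 60 * t ^ 2 + 60 * t ^ 4)) (at t)" for t
      by (rule derivative_eq_intros refl)+ (simp add: algebra_simps)
    show "- 2 * ?p ^ 6 * (1 + t ^ 2) * (8 + 60 * t ^ 2 + 60 * t ^ 4) = 2 * ?p ^ 5 * (8 + 60 * t ^ 2 + 60 * t ^ 4) * (- ?p * (1 + t ^ 2))" for t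
      by (simp add: eval_nat_numeral algebra_simps)
  qed (use 4 in auto)
  show "Polygamma_refl 3 z = - 2 * of_real pi ^ 4 * (1 + t ^ 2) * (1 + 3 * t ^ 2)"
    using 3[OF assms(1)] by (simp add: t_def eval_nat_numeral algebra_simps)
  show "Polygamma_refl 5 z = - 8 * of_real pi ^ 6 * (1 + t ^ 2) * (2 + 15 * t ^ 2 + 15 * t ^ 4)"
    using 5[OF assms(1)] by (simp add: t_def algebra_simps)
qed

lemma norm_summable_inverse_shift_power:
  fixes z :: complex
  assumes "k \<ge> 2"
  shows "summable (\<lambda>n. norm (1 / (z + of_nat n) ^ k))"
proof -
  obtain N where N: "real N > 2 * norm z + 1" using reals_Archimedean2 by blast
  have "summable (\<lambda>n. inverse (real n ^ k))" by (rule inverse_power_summable) (use assms in simp)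
  hence s: "summable (\<lambda>n. 2 ^ k * inverse (real n ^ k))" by (rule summable_mult)
  show ?thesis
  proof (rule summable_comparison_test'[OF s, where N = N])
    fix n assume n: "n \<ge> N"
    have "real n \<le> cmod (z + of_nat n) + cmod z"
      using norm_triangle_ineq4[of "z + of_nat n" z] by simp
    hence *: "real n / 2 \<le> cmod (z + of_nat n)" using N n by simp
    have pos: "real n > 0" using N n norm_ge_zero[of z] by linarith
    have "norm (norm (1 / (z + of_nat n) ^ k)) = 1 / cmod (z + of_nat n) ^ k"
      by (simp add: norm_divide norm_power)
    also have "\<dots> \<le> 1 / (real n / 2) ^ k" using * pos
      by (intro divide_left_mono power_mono mult_pos_pos zero_less_power) (auto intro: less_le_trans[OF _ *])
    also have "\<dots> = 2 ^ k * inverse (real n ^ k)" by (simp add: field_simps)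
    finally show "norm (norm (1 / (z + of_nat n) ^ k)) \<le> 2 ^ k * inverse (real n ^ k)" .
  qed
qed

text \<open>The non-negative integers give the series of \<open>Polygamma k z\<close>; the
  substitution n -> -n - 1 turns the negative ones into that of \<open>Polygamma k (1 - z)\<close>.
  At an integer \<open>z\<close> both sides drop the singular term as 1 / 0 = 0, and z = 0 is used
  below for the zeta values.\<close>

lemma int_shift_has_sum_Polygamma:
  fixes z :: complex
  assumes k: "k \<ge> 1"
  shows "((\<lambda>n::int. 1 / (z + of_int n) ^ Suc k) has_sum
     ((-1) ^ Suc k * (Polygamma k z - (-1) ^ k * Polygamma k (1 - z)) / fact k)) UNIV"
proof -
  have P: "((\<lambda>n::nat. 1 / (w + of_nat n) ^ Suc k) has_sum ((-1) ^ Suc k * Polygamma k w / fact k)) UNIV"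
    for w :: complex
  proof (rule norm_summable_imp_has_sum)
    show s: "summable (\<lambda>n. norm (1 / (w + of_nat n) ^ Suc k))"
      using k by (intro norm_summable_inverse_shift_power) auto
    have "(\<lambda>n. 1 / (w + of_nat n) ^ Suc k) sums suminf (\<lambda>n. 1 / (w + of_nat n) ^ Suc k)"
      by (rule summable_sums[OF summable_norm_cancel[OF s]])
    also have "suminf (\<lambda>n. 1 / (w + of_nat n) ^ Suc k) = (-1) ^ Suc k * Polygamma k w / fact k"
    proof -
      have "(-1) ^ Suc k * ((-1) ^ Suc k * fact k * x) / fact k = x" for x :: complex
      proof -
        have "(-1) ^ Suc k * (-1) ^ Suc k = (1 :: complex)" by (simp flip: power_mult_distrib)
        thus ?thesis by (metis (no_types, lifting) fact_nonzero mult.assoc mult.left_commute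
              mult.right_neutral nonzero_mult_div_cancel_left)
      qed
      thus ?thesis using k by (simp only: Polygamma_def inverse_eq_divide) simp
    qed
    finally show "(\<lambda>n. 1 / (w + of_nat n) ^ Suc k) sums ((-1) ^ Suc k * Polygamma k w / fact k)" .
  qed
  have A: "((\<lambda>n::int. 1 / (z + of_int n) ^ Suc k) has_sum ((-1) ^ Suc k * Polygamma k z / fact k)) {0..}"
    using P[of z] by (subst (asm) has_sum_reindex_bij_witness[where j = int and i = nat and T = "{0..}" and h = "\<lambda>n::int. 1 / (z + of_int n) ^ Suc k"]) auto
  have "((\<lambda>n::nat. (-1) ^ Suc k * (1 / ((1 - z) + of_nat n) ^ Suc k)) has_sum
           (-1) ^ Suc k * ((-1) ^ Suc k * Polygamma k (1 - z) / fact k)) UNIV"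
    by (intro has_sum_cmult_right P)
  also have "?this \<longleftrightarrow> ((\<lambda>n::int. 1 / (z + of_int n) ^ Suc k) has_sum (Polygamma k (1 - z) / fact k)) {..<0}"
  proof (rule has_sum_reindex_bij_witness[where j = "\<lambda>n. - int n - 1" and i = "\<lambda>n. nat (- n - 1)"], goal_cases)
    case (5 n)
    have "z + of_int (- int n - 1) = - (1 - z + of_nat n)" by simp
    hence "(z + of_int (- int n - 1)) ^ Suc k = (-1) ^ Suc k * (1 - z + of_nat n) ^ Suc k"
      by (metis power_minus)
    thus ?case by (cases "even k") auto
  qed (auto simp flip: power_mult_distrib)
  finally have B: "((\<lambda>n::int. 1 / (z + of_int n) ^ Suc k) has_sum (Polygamma k (1 - z) / fact k)) {..<0}" .
  have U: "{0..} \<union> {..<0} = (UNIV :: int set)" by auto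
  have e: "(-1) ^ Suc k * Polygamma k z / fact k + Polygamma k (1 - z) / fact k
      = (-1) ^ Suc k * (Polygamma k z - (-1) ^ k * Polygamma k (1 - z)) / fact k"
    by (simp add: field_simps)
  have "{0..} \<inter> {..<0} = ({} :: int set)" by auto
  from has_sum_Un_disjoint[OF A B this] show ?thesis unfolding U e .
qed

lemma int_shift_has_sum:
  fixes z :: complex
  assumes "z \<notin> \<int>"
  defines "t \<equiv> cot (of_real pi * z)"
  shows "((\<lambda>n::int. 1 / (z + of_int n) ^ 4) has_sum
            (of_real pi ^ 4 / 3 * (1 + t ^ 2) * (1 + 3 * t ^ 2))) UNIV"
    and "((\<lambda>n::int. 1 / (z + of_int n) ^ 6) has_sum
            (of_real pi ^ 6 / 15 * (1 + t ^ 2) * (2 + 15 * t ^ 2 + 15 * t ^ 4))) UNIV"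
proof -
  have "((-1) ^ Suc 3 * (Polygamma 3 z - (-1) ^ 3 * Polygamma 3 (1 - z)) / fact 3)
          = - Polygamma_refl 3 z / 6"
    by (simp add: Polygamma_refl_def fact_numeral)
  also have "\<dots> = of_real pi ^ 4 / 3 * (1 + t ^ 2) * (1 + 3 * t ^ 2)"
    using Polygamma_refl_closed(1)[OF assms(1)] by (simp add: t_def)
  finally have e: "(-1) ^ Suc 3 * (Polygamma 3 z - (-1) ^ 3 * Polygamma 3 (1 - z)) / fact 3 = \<dots>" .
  show "((\<lambda>n::int. 1 / (z + of_int n) ^ 4) has_sum
            (of_real pi ^ 4 / 3 * (1 + t ^ 2) * (1 + 3 * t ^ 2))) UNIV"
    using int_shift_has_sum_Polygamma[of 3 z] unfolding e by simp
  have "((-1) ^ Suc 5 * (Polygamma 5 z - (-1) ^ 5 * Polygamma 5 (1 - z)) / fact 5)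
          = - Polygamma_refl 5 z / 120"
    by (simp add: Polygamma_refl_def fact_numeral)
  also have "\<dots> = of_real pi ^ 6 / 15 * (1 + t ^ 2) * (2 + 15 * t ^ 2 + 15 * t ^ 4)"
    using Polygamma_refl_closed(2)[OF assms(1)] by (simp add: t_def)
  finally have e: "(-1) ^ Suc 5 * (Polygamma 5 z - (-1) ^ 5 * Polygamma 5 (1 - z)) / fact 5 = \<dots>" .
  show "((\<lambda>n::int. 1 / (z + of_int n) ^ 6) has_sum
            (of_real pi ^ 6 / 15 * (1 + t ^ 2) * (2 + 15 * t ^ 2 + 15 * t ^ 4))) UNIV"
    using int_shift_has_sum_Polygamma[of 5 z] unfolding e by simp
qed

section \<open>Lambert series on the unit disc\<close>

text \<open>If x g(x) = sum a_n x^n over n >= 1, this is the power series whose n-th coefficient is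
  the sum of a_d over the divisors d of n. The factor x is split off so that a bound on
  \<open>g\<close> alone bounds the terms geometrically.\<close>

definition lambert_sum :: "(complex \<Rightarrow> complex) \<Rightarrow> complex \<Rightarrow> complex" where
  "lambert_sum g q = (\<Sum>m. q ^ Suc m * g (q ^ Suc m))"

lemma norm_power_Suc_le:
  fixes q :: complex
  assumes "norm q \<le> r" "r < 1"
  shows "norm (q ^ Suc m) \<le> r"
proof -
  have "norm q ^ m \<le> 1" using assms by (intro power_le_one) auto
  hence "norm q * norm q ^ m \<le> norm q" by (intro mult_right_le_one_le) auto
  thus ?thesis using assms by (simp add: norm_mult norm_power)
qed

lemma lambert_sum_term_bound:
  fixes q :: complex and g :: "complex \<Rightarrow> complex"
  assumes "\<And>x. norm x \<le> r \<Longrightarrow> norm (g x) \<le> K" "norm q \<le> r" "r < 1"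
  shows "norm (q ^ Suc m * g (q ^ Suc m)) \<le> K * norm q ^ Suc m"
  using mult_left_mono[OF assms(1)[OF norm_power_Suc_le[OF assms(2,3), of m]], of "norm q ^ Suc m"]
  by (simp add: norm_mult norm_power mult.commute)

lemma continuous_bounded_on_disc:
  fixes g :: "complex \<Rightarrow> complex"
  assumes "continuous_on (ball 0 1) g" "r < 1"
  obtains K where "K \<ge> 0" "\<And>x. norm x \<le> r \<Longrightarrow> norm (g x) \<le> K"
proof -
  have "compact (g ` cball 0 r)"
    using assms by (intro compact_continuous_image continuous_on_subset[OF assms(1)]) auto
  then obtain K where "\<And>y. y \<in> g ` cball 0 r \<Longrightarrow> norm y \<le> K"
    using compact_imp_bounded bounded_iff by metis
  thus ?thesis by (intro that[of "max K 0"]) (auto intro: max.coboundedI1)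
qed

lemma lambert_sum_summable:
  fixes q :: complex and g :: "complex \<Rightarrow> complex"
  assumes "continuous_on (ball 0 1) g" "norm q < 1"
  shows "summable (\<lambda>m. norm (q ^ Suc m * g (q ^ Suc m)))"
proof -
  obtain K where K: "\<And>x. norm x \<le> norm q \<Longrightarrow> norm (g x) \<le> K"
    using continuous_bounded_on_disc[OF assms] by blast
  have s: "summable (\<lambda>m. K * norm q ^ Suc m)"
    using assms(2) by (intro summable_mult summable_ignore_initial_segment[of _ 1, simplified])
       (auto intro: summable_geometric)
  show ?thesis
    by (rule summable_comparison_test'[OF s, where N = 0])
       (use lambert_sum_term_bound[where r = "norm q", OF K order.refl assms(2)] in \<open>simp del: power_Suc\<close>)
qed

text \<open>On a small ball around x, inside the disc of radius r = (1 + |x|) / 2, the terms are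
  dominated by a geometric series in r; the sum is then differentiable at x.\<close>

lemma lambert_sum_holomorphic:
  assumes g: "g holomorphic_on ball 0 1"
  shows "lambert_sum g holomorphic_on ball 0 1"
proof -
  define f where "f = (\<lambda>m q. q ^ Suc m * g (q ^ Suc m))"
  define f' where "f' = (\<lambda>m. deriv (f m))"
  have pw: "q ^ Suc m \<in> ball 0 1" if "q \<in> ball 0 1" for q :: complex and m
    using norm_power_Suc_le[of q "norm q" m] that by (auto simp del: power_Suc)
  have hf: "f m holomorphic_on ball 0 1" for m
    unfolding f_def
    by (intro holomorphic_intros holomorphic_on_compose_gen[OF _ g, unfolded o_def])
       (use pw in \<open>auto intro!: holomorphic_intros simp del: power_Suc\<close>)
  have "\<exists>F F'. \<forall>x\<in>ball 0 1. (\<lambda>n. f n x) sums F x \<and> (\<lambda>n. f' n x) sums F' x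
           \<and> (F has_field_derivative F' x) (at x)"
  proof (rule series_and_derivative_comparison_local)
    show "(f n has_field_derivative f' n x) (at x)" if "x \<in> ball 0 1" for n x
      unfolding f'_def using holomorphic_derivI[OF hf _ that] by simp
    fix x :: complex assume x: "x \<in> ball 0 1"
    define r where "r = (1 + norm x) / 2"
    have r: "norm x < r" "r < 1" "r \<ge> 0" using x by (auto simp: r_def add_nonneg_nonneg)
    obtain K where K: "K \<ge> 0" "\<And>x. norm x \<le> r \<Longrightarrow> norm (g x) \<le> K"
      using continuous_bounded_on_disc[OF holomorphic_on_imp_continuous_on[OF g] r(2)] by blast
    show "\<exists>d h. 0 < d \<and> summable h \<and> (\<forall>\<^sub>F n in sequentially. \<forall>y\<in>ball x d \<inter> ball 0 1. cmod (f n y) \<le> h n)"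
    proof (rule exI[of _ "r - norm x"], rule exI[of _ "\<lambda>m. K * r ^ Suc m"], intro conjI always_eventually allI ballI)
      show "summable (\<lambda>m. K * r ^ Suc m)"
        using r by (intro summable_mult summable_ignore_initial_segment[of _ 1, simplified])
           (auto intro: summable_geometric)
      fix n y assume "y \<in> ball x (r - norm x) \<inter> ball 0 1"
      hence y: "norm y \<le> r" using norm_triangle_ineq[of x "y - x"] by (auto simp: dist_norm norm_minus_commute)
      have "cmod (f n y) \<le> K * norm y ^ Suc n"
        unfolding f_def by (rule lambert_sum_term_bound[OF K(2) y r(2)])
      also have "\<dots> \<le> K * r ^ Suc n" using K y by (intro mult_left_mono power_mono) auto
      finally show "cmod (f n y) \<le> K * r ^ Suc n" .
    qed (use r in auto)
  qed auto
  then obtain F F' where F: "\<And>x. x \<in> ball 0 1 \<Longrightarrow> (\<lambda>n. f n x) sums F x"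
     "\<And>x. x \<in> ball 0 1 \<Longrightarrow> (F has_field_derivative F' x) (at x)" by blast
  have "F holomorphic_on ball 0 1"
    using F(2) by (meson holomorphic_on_open open_ball)
  moreover have "F x = lambert_sum g x" if "x \<in> ball 0 1" for x
    using sums_unique[OF F(1)[OF that]] by (simp add: lambert_sum_def f_def)
  ultimately show ?thesis by (metis (no_types, lifting) holomorphic_transform)
qed

lemma lambert_sum_split:
  fixes q :: complex and g :: "complex \<Rightarrow> complex"
  assumes "continuous_on (ball 0 1) g" "norm q < 1"
  shows "lambert_sum g q = (\<Sum>m<N. q ^ Suc m * g (q ^ Suc m)) + (\<Sum>m. q ^ Suc (m + N) * g (q ^ Suc (m + N)))"
  unfolding lambert_sum_def
  using suminf_split_initial_segment[OF summable_norm_cancel[OF lambert_sum_summable[OF assms]], of N]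
  by simp

lemma lambert_tail_bound:
  fixes q :: complex and g :: "complex \<Rightarrow> complex"
  assumes "continuous_on (ball 0 1) g" "norm q \<le> r" "r < 1" "\<And>x. norm x \<le> r \<Longrightarrow> norm (g x) \<le> K"
  shows "norm (\<Sum>m. q ^ Suc (m + N) * g (q ^ Suc (m + N))) \<le> K * norm q ^ Suc N / (1 - norm q)"
proof -
  have q: "norm q < 1" using assms by simp
  have gs: "(\<lambda>m. K * norm q ^ Suc N * norm q ^ m) sums (K * norm q ^ Suc N * (1 / (1 - norm q)))"
    using q by (intro sums_mult geometric_sums) auto
  have "norm (\<Sum>m. q ^ Suc (m + N) * g (q ^ Suc (m + N))) \<le> (\<Sum>m. K * norm q ^ Suc N * norm q ^ m)"
  proof (rule norm_suminf_le)
    fix m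
    have "norm (q ^ Suc (m + N) * g (q ^ Suc (m + N))) \<le> K * norm q ^ Suc (m + N)"
      by (rule lambert_sum_term_bound[OF assms(4,2,3)])
    also have "\<dots> = K * norm q ^ Suc N * norm q ^ m" by (simp add: power_add mult_ac)
    finally show "norm (q ^ Suc (m + N) * g (q ^ Suc (m + N))) \<le> K * norm q ^ Suc N * norm q ^ m" .
  qed (use gs in \<open>auto simp: sums_iff\<close>)
  also have "\<dots> = K * norm q ^ Suc N / (1 - norm q)" using gs by (simp add: sums_iff)
  finally show ?thesis .
qed

definition nome :: "complex \<Rightarrow> complex" where "nome z = exp (2 * of_real pi * \<i> * z)"

lemma norm_nome: "norm (nome z) = exp (- 2 * pi * Im z)"
  by (simp add: nome_def norm_exp_eq_Re)

lemma norm_nome_less_1: "Im z > 0 \<Longrightarrow> norm (nome z) < 1"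
  by (simp add: norm_nome)

text \<open>With E = exp(i pi w) and q = E^2 one has cot(pi w) = i (q + 1) / (q - 1). The square is
  recorded because the closed forms contain even powers of the cotangent.\<close>

lemma cot_power2_nome:
  assumes "Im w > 0"
  defines "q \<equiv> nome w"
  shows "cot (of_real pi * w) ^ 2 = - ((1 + q) ^ 2 / (1 - q) ^ 2)"
proof -
  define E where "E = exp (\<i> * (of_real pi * w))"
  have q: "q = E ^ 2" by (simp add: E_def q_def nome_def exp_double [symmetric] mult_ac)
  have E: "E \<noteq> 0" by (simp add: E_def)
  have c: "cos (of_real pi * w) = (E + 1 / E) / 2" and s: "sin (of_real pi * w) = (E - 1 / E) / (2 * \<i>)"
    by (simp_all add: cos_exp_eq sin_exp_eq E_def exp_minus inverse_eq_divide)
  have "cot (of_real pi * w) = ((E + 1 / E) * E * \<i>) / ((E - 1 / E) * E)"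
  proof -
    have "(a / 2) / (b / (2 * \<i>)) = (a * E * \<i>) / (b * E)" for a b
      using E by (simp add: mult_ac)
    thus ?thesis by (simp only: cot_def c s)
  qed
  also have "\<dots> = (q + 1) * \<i> / (q - 1)"
    using E by (simp add: ring_distribs q power2_eq_square)
  also have "\<dots> ^ 2 = - ((q + 1) ^ 2 / (q - 1) ^ 2)" by (simp add: power_divide power_mult_distrib)
  finally show ?thesis by (simp add: add.commute power2_commute)
qed

text \<open>\<open>x * lambert3 x\<close> and \<open>x * lambert5 x\<close> are the sums of n^3 x^n
  and n^5 x^n over n >= 1; the numerators are Eulerian polynomials.\<close>

definition lambert3 :: "complex \<Rightarrow> complex" where
  "lambert3 x = (1 + 4 * x + x ^ 2) / (1 - x) ^ 4"

definition lambert5 :: "complex \<Rightarrow> complex" where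
  "lambert5 x = (1 + 26 * x + 66 * x ^ 2 + 26 * x ^ 3 + x ^ 4) / (1 - x) ^ 6"

lemma Ints_not_upper: "Im z > 0 \<Longrightarrow> z \<notin> \<int>"
  by (auto elim: Ints_cases)

text \<open>Lipschitz's formula in weights 4 and 6, obtained by putting t^2 = -((1 + q) / (1 - q))^2
  into the cotangent closed forms. Working with u = 1 - q makes all denominators powers of
  u.\<close>

lemma int_shift_has_sum_nome:
  assumes "Im w > 0"
  defines "q \<equiv> nome w"
  shows "((\<lambda>n::int. 1 / (w + of_int n) ^ 4) has_sum (8 * of_real pi ^ 4 / 3 * (q * lambert3 q))) UNIV"
    and "((\<lambda>n::int. 1 / (w + of_int n) ^ 6) has_sum (- 8 * of_real pi ^ 6 / 15 * (q * lambert5 q))) UNIV"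
proof -
  define u where "u = 1 - q"
  have "norm q < 1" unfolding q_def using assms(1) by (rule norm_nome_less_1)
  hence u: "u \<noteq> 0" by (auto simp: u_def)
  have qu: "q = 1 - u" by (simp add: u_def)
  define t where "t = cot (of_real pi * w)"
  have t2: "t ^ 2 = - ((2 - u) ^ 2 / u ^ 2)"
    using cot_power2_nome[OF assms(1)] by (simp add: t_def flip: q_def) (simp add: qu)
  have t4: "t ^ 4 = (2 - u) ^ 4 / u ^ 4"
  proof -
    have "t ^ 4 = (t ^ 2) ^ 2" by (simp flip: power_mult)
    also have "\<dots> = (2 - u) ^ 4 / u ^ 4" unfolding t2 by (simp add: power_divide flip: power_mult)
    finally show ?thesis .
  qed
  have a: "1 + t ^ 2 = - 4 * q / u ^ 2"
    using u unfolding t2 qu by (simp add: field_simps) (simp add: power2_eq_square algebra_simps)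
  have b: "1 + 3 * t ^ 2 = - 2 * (1 + 4 * q + q ^ 2) / u ^ 2"
    using u unfolding t2 qu by (simp add: field_simps) (simp add: power2_eq_square algebra_simps)
  have c: "2 + 15 * t ^ 2 + 15 * t ^ 4 = 2 * (1 + 26 * q + 66 * q ^ 2 + 26 * q ^ 3 + q ^ 4) / u ^ 4"
  proof -
    have "2 + 15 * t ^ 2 + 15 * t ^ 4 = (2 * u ^ 4 - 15 * (2 - u) ^ 2 * u ^ 2 + 15 * (2 - u) ^ 4) / u ^ 4"
    proof -
      have x: "t ^ 2 * u ^ 4 = - ((2 - u) ^ 2 * u ^ 2)"
      proof -
        have u4: "u ^ 4 = u ^ 2 * u ^ 2" by (simp flip: power_add)
        have "- (a / v) * (v * v) = - (a * v)" if "v \<noteq> 0" for a v :: complex using that by simp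
        thus ?thesis unfolding t2 u4 by this (use u in simp)
      qed
      have y: "t ^ 4 * u ^ 4 = (2 - u) ^ 4" unfolding t4 using u by simp
      have "(2 + 15 * t ^ 2 + 15 * t ^ 4) * u ^ 4 = 2 * u ^ 4 + 15 * (t ^ 2 * u ^ 4) + 15 * (t ^ 4 * u ^ 4)"
        by (simp add: algebra_simps)
      thus ?thesis using u unfolding x y by (simp add: nonzero_eq_divide_eq)
    qed
    also have "2 * u ^ 4 - 15 * (2 - u) ^ 2 * u ^ 2 + 15 * (2 - u) ^ 4
           = 2 * (1 + 26 * q + 66 * q ^ 2 + 26 * q ^ 3 + q ^ 4)"
      unfolding qu by (simp add: eval_nat_numeral algebra_simps)
    finally show ?thesis .
  qed
  have "of_real pi ^ 4 / 3 * (1 + t ^ 2) * (1 + 3 * t ^ 2) = 8 * of_real pi ^ 4 / 3 * (q * lambert3 q)"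
  proof -
    have u4: "u ^ 4 = u ^ 2 * u ^ 2" by (simp flip: power_add)
    have "P / 3 * (- 4 * q / v) * (- 2 * x / v) = 8 * P / 3 * (q * (x / (v * v)))" for P v x :: complex
      by (simp add: mult_ac)
    thus ?thesis unfolding a b lambert3_def u_def [symmetric] u4 .
  qed
  with int_shift_has_sum(1)[OF Ints_not_upper[OF assms(1)]]
  show "((\<lambda>n::int. 1 / (w + of_int n) ^ 4) has_sum (8 * of_real pi ^ 4 / 3 * (q * lambert3 q))) UNIV"
    by (simp only: t_def)
  have "of_real pi ^ 6 / 15 * (1 + t ^ 2) * (2 + 15 * t ^ 2 + 15 * t ^ 4)
           = - 8 * of_real pi ^ 6 / 15 * (q * lambert5 q)"
  proof -
    have u6: "u ^ 6 = u ^ 2 * u ^ 4" by (simp flip: power_add)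
    have "P / 15 * (- 4 * q / v) * (2 * x / w) = - 8 * P / 15 * (q * (x / (v * w)))" for P v w x :: complex
      by (simp add: mult_ac)
    thus ?thesis unfolding a c lambert5_def u_def [symmetric] u6 .
  qed
  with int_shift_has_sum(2)[OF Ints_not_upper[OF assms(1)]]
  show "((\<lambda>n::int. 1 / (w + of_int n) ^ 6) has_sum (- 8 * of_real pi ^ 6 / 15 * (q * lambert5 q))) UNIV"
    by (simp only: t_def)
qed

text \<open>Evaluating the closed form at \<open>z = 1/2\<close> gives the sum over odd integers; here and below the
  summand at \<open>n = 0\<close> is the junk value \<open>1 / 0 = 0\<close>.\<close>

lemma int_zeta_has_sum:
  shows "((\<lambda>n::int. 1 / (of_int n :: complex) ^ 4) has_sum (of_real pi ^ 4 / 45)) UNIV"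
    and "((\<lambda>n::int. 1 / (of_int n :: complex) ^ 6) has_sum (2 * of_real pi ^ 6 / 945)) UNIV"
proof -
  have gen: "((\<lambda>n::int. 1 / (of_int n :: complex) ^ Suc k) has_sum (S / (2 ^ Suc k - 1))) UNIV"
    if k: "k \<ge> 1" and S: "((\<lambda>n::int. 1 / (1 / 2 + of_int n :: complex) ^ Suc k) has_sum S) UNIV" for k S
  proof -
    define Z where "Z = (-1) ^ Suc k * (Polygamma k 0 - (-1) ^ k * Polygamma k (1 - 0)) / (fact k :: complex)"
    have Z: "((\<lambda>n::int. 1 / (of_int n :: complex) ^ Suc k) has_sum Z) UNIV"
      using int_shift_has_sum_Polygamma[OF k, of 0] by (simp only: Z_def add_0_left)
    have "((\<lambda>n::int. 1 / 2 ^ Suc k * (1 / (of_int n :: complex) ^ Suc k)) has_sum (1 / 2 ^ Suc k * Z)) UNIV"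
      by (intro has_sum_cmult_right Z)
    also have "?this \<longleftrightarrow> ((\<lambda>n::int. 1 / (of_int n :: complex) ^ Suc k) has_sum (1 / 2 ^ Suc k * Z)) {n. even n}"
      by (rule has_sum_reindex_bij_witness[where j = "\<lambda>n. 2 * n" and i = "\<lambda>n. n div 2"])
         (auto simp: power_mult_distrib)
    finally have ev: "((\<lambda>n::int. 1 / (of_int n :: complex) ^ Suc k) has_sum (1 / 2 ^ Suc k * Z)) {n. even n}" .
    have "((\<lambda>n::int. 1 / 2 ^ Suc k * (1 / (1 / 2 + of_int n :: complex) ^ Suc k)) has_sum (1 / 2 ^ Suc k * S)) UNIV"
      by (intro has_sum_cmult_right S)
    also have "?this \<longleftrightarrow> ((\<lambda>n::int. 1 / (of_int n :: complex) ^ Suc k) has_sum (1 / 2 ^ Suc k * S)) {n. odd n}"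
    proof (rule has_sum_reindex_bij_witness[where j = "\<lambda>n. 2 * n + 1" and i = "\<lambda>n. n div 2"], goal_cases)
      case (5 n)
      have "of_int (2 * n + 1) = 2 * (1 / 2 + of_int n :: complex)" by (simp add: algebra_simps)
      thus ?case by (simp only: power_mult_distrib) simp
    qed auto
    finally have od: "((\<lambda>n::int. 1 / (of_int n :: complex) ^ Suc k) has_sum (1 / 2 ^ Suc k * S)) {n. odd n}" .
    have U: "{n::int. even n} \<union> {n. odd n} = UNIV" "{n::int. even n} \<inter> {n. odd n} = {}" by auto
    \<comment> \<open>Splitting by parity, the even integers reproduce Z / 2^(k+1), and the odd ones
      are the half-integer sum S / 2^(k+1). The resulting linear equation is solved for Z.\<close>
    have "1 / 2 ^ Suc k * Z + 1 / 2 ^ Suc k * S = Z"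
      using has_sum_unique[OF has_sum_Un_disjoint[OF ev od U(2), unfolded U(1)] Z] .
    moreover have "(2 :: complex) ^ Suc k - 1 \<noteq> 0"
    proof -
      have "(2 :: real) ^ Suc k > 1" by (rule one_less_power) auto
      hence "norm ((2 :: complex) ^ Suc k) \<noteq> norm (1 :: complex)" by (simp only: norm_power) simp
      thus ?thesis by (metis eq_iff_diff_eq_0)
    qed
    moreover have "Z = S / (p - 1)" if "1 / p * Z + 1 / p * S = Z" "p - 1 \<noteq> 0" "p \<noteq> 0" for p
      using that by (simp add: field_simps)
    ultimately have "Z = S / (2 ^ Suc k - 1)" by simp
    with Z show ?thesis by simp
  qed
  have h: "(1 / 2 :: complex) \<notin> \<int>" using fraction_not_in_Ints[where 'a = complex, of 2 1] by simp
  have cot: "cot (of_real pi * (1 / 2) :: complex) = 0"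
    using cos_of_real[of "pi / 2", where 'a = complex] by (simp add: cot_def)
  have s4: "((\<lambda>n::int. 1 / (1 / 2 + of_int n :: complex) ^ Suc 3) has_sum (of_real pi ^ 4 / 3)) UNIV"
    using int_shift_has_sum(1)[OF h] unfolding cot by simp
  have s6: "((\<lambda>n::int. 1 / (1 / 2 + of_int n :: complex) ^ Suc 5) has_sum (2 * of_real pi ^ 6 / 15)) UNIV"
    using int_shift_has_sum(2)[OF h] unfolding cot by (simp add: mult.commute)
  show "((\<lambda>n::int. 1 / (of_int n :: complex) ^ 4) has_sum (of_real pi ^ 4 / 45)) UNIV"
    using gen[OF _ s4] by simp
  show "((\<lambda>n::int. 1 / (of_int n :: complex) ^ 6) has_sum (2 * of_real pi ^ 6 / 945)) UNIV"
    using gen[OF _ s6] by simp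
qed

section \<open>q-expansions of the Eisenstein series\<close>

text \<open>Summation by rows: m = 0 gives \<open>Z\<close>, and m and -m have the same row sum
  because \<open>k\<close> is even. The origin can be added since its summand is 1 / 0 = 0.\<close>

lemma eisenstein_G_expansion:
  assumes z: "Im z > 0" and k: "k \<ge> 4" "even k"
    and Z: "((\<lambda>n::int. 1 / (of_int n :: complex) ^ k) has_sum Z) UNIV"
    and S: "\<And>w. Im w > 0 \<Longrightarrow> ((\<lambda>n::int. 1 / (w + of_int n) ^ k) has_sum S w) UNIV"
  shows "eisenstein_G k z = Z + 2 * (\<Sum>m. S (of_nat (Suc m) * z))"
proof -
  define f where "f = (\<lambda>(m, n). 1 / (of_int m * z + of_int n) ^ k)"
  define b where "b = (\<lambda>m::int. if m = 0 then Z else S (of_int \<bar>m\<bar> * z))"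
  have "(\<lambda>p. norm (f p)) summable_on (UNIV - {(0, 0)})"
    unfolding f_def using lattice_abs_summable[OF z k(1)] by simp
  hence "f summable_on (UNIV - {(0, 0)})" by (rule Infinite_Sum.abs_summable_summable)
  hence "(f has_sum eisenstein_G k z) (UNIV - {(0, 0)})"
    unfolding eisenstein_G_def f_def by (rule has_sum_infsum)
  also have "?this \<longleftrightarrow> (f has_sum eisenstein_G k z) (UNIV \<times> UNIV)"
    by (rule has_sum_cong_neutral) (use k in \<open>auto simp: f_def\<close>)
  finally have f: "(f has_sum eisenstein_G k z) (UNIV \<times> UNIV)" .
  have "((\<lambda>n. f (m, n)) has_sum b m) UNIV" for m
  proof -
    consider "m = 0" | "m > 0" | "m < 0" by linarith
    thus ?thesis
    proof cases
      case 1 thus ?thesis using Z by (simp add: f_def b_def)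
    next
      case 2 thus ?thesis using S[of "of_int m * z"] z by (simp add: f_def b_def)
    next
      case 3
      have "((\<lambda>n. 1 / (of_int \<bar>m\<bar> * z + of_int n) ^ k) has_sum b m) UNIV"
        using S[of "of_int \<bar>m\<bar> * z"] 3 z by (simp add: b_def mult_neg_pos)
      also have "?this \<longleftrightarrow> ((\<lambda>n. f (m, n)) has_sum b m) UNIV"
      proof (rule has_sum_reindex_bij_witness[where j = uminus and i = uminus], goal_cases)
        case (5 n)
        have "of_int m * z + of_int (- n) = - (of_int \<bar>m\<bar> * z + of_int n)" using 3 by simp
        thus ?case using k(2) unfolding f_def by (simp only: prod.case power_minus_even)
      qed auto
      finally show ?thesis .
    qed
  qed
  hence B: "(b has_sum eisenstein_G k z) UNIV" using has_sum_SigmaD[OF f] by simp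
  hence "b summable_on {1..}" by (meson has_sum_imp_summable subset_UNIV summable_on_subset_banach)
  then obtain P where P: "(b has_sum P) {1..}" by (auto simp: summable_on_def)
  have "(b has_sum P) {1..} \<longleftrightarrow> (b has_sum P) {..-1}"
    by (rule has_sum_reindex_bij_witness[where j = uminus and i = uminus]) (auto simp: b_def)
  hence N: "(b has_sum P) {..-1}" using P by simp
  have 0: "(b has_sum Z) {0}" by (simp add: b_def has_sum_finite_iff)
  have U: "({1..} \<union> {..-1}) \<union> {0} = (UNIV :: int set)" by auto
  have "(b has_sum (P + P + Z)) (({1..} \<union> {..-1}) \<union> {0})"
    by (intro has_sum_Un_disjoint P N 0) auto
  hence G: "eisenstein_G k z = P + P + Z" using has_sum_unique[OF B] by (simp only: U)
  have "(b has_sum P) {1..} \<longleftrightarrow> ((\<lambda>m::nat. b (int m + 1)) has_sum P) UNIV"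
    by (rule has_sum_reindex_bij_witness[where i = "\<lambda>m. int m + 1" and j = "\<lambda>n. nat (n - 1)"]) auto
  hence "(\<lambda>m::nat. b (int m + 1)) sums P" using P by (simp add: has_sum_imp_sums)
  also have "(\<lambda>m::nat. b (int m + 1)) = (\<lambda>m. S (of_nat (Suc m) * z))"
    by (auto simp: b_def add.commute)
  finally have "P = (\<Sum>m. S (of_nat (Suc m) * z))" by (simp add: sums_iff)
  thus ?thesis unfolding G by simp
qed

lemma disc_one_minus_nonzero: "x \<in> ball 0 1 \<Longrightarrow> 1 - x \<noteq> (0 :: complex)"
  by auto

lemma lambert3_holomorphic: "lambert3 holomorphic_on ball 0 1"
  and lambert5_holomorphic: "lambert5 holomorphic_on ball 0 1"
  unfolding lambert3_def[abs_def] lambert5_def[abs_def]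
  by (intro holomorphic_intros; use disc_one_minus_nonzero in auto)+

text \<open>The normalised Eisenstein series as functions on the unit disc, so that the cusp becomes
  the point 0. The factors 240 = 2 (8 / 3) 45 and 504 = 2 (8 / 15) (945 / 2) are the Lipschitz
  constants, doubled and divided by the zeta values.\<close>

definition E4_q :: "complex \<Rightarrow> complex" where "E4_q q = 1 + 240 * lambert_sum lambert3 q"
definition E6_q :: "complex \<Rightarrow> complex" where "E6_q q = 1 - 504 * lambert_sum lambert5 q"
definition Delta_q :: "complex \<Rightarrow> complex" where "Delta_q q = (E4_q q ^ 3 - E6_q q ^ 2) / 1728"

lemma nome_power: "nome (of_nat n * z) = nome z ^ n"
  by (simp add: nome_def mult_ac flip: exp_of_nat_mult)

lemma eisenstein_G_nome:
  assumes "Im z > 0"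
  shows "eisenstein_G 4 z = of_real pi ^ 4 / 45 * E4_q (nome z)"
    and "eisenstein_G 6 z = 2 * of_real pi ^ 6 / 945 * E6_q (nome z)"
proof -
  have s3: "summable (\<lambda>m. nome z ^ Suc m * lambert3 (nome z ^ Suc m))"
    by (intro summable_norm_cancel[OF lambert_sum_summable] holomorphic_on_imp_continuous_on
          lambert3_holomorphic norm_nome_less_1 assms)
  have s5: "summable (\<lambda>m. nome z ^ Suc m * lambert5 (nome z ^ Suc m))"
    by (intro summable_norm_cancel[OF lambert_sum_summable] holomorphic_on_imp_continuous_on
          lambert5_holomorphic norm_nome_less_1 assms)
  have "eisenstein_G 4 z = of_real pi ^ 4 / 45 + 2 * (\<Sum>m. 8 * of_real pi ^ 4 / 3 *
           (nome (of_nat (Suc m) * z) * lambert3 (nome (of_nat (Suc m) * z))))"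
    by (rule eisenstein_G_expansion[OF assms])
       (use int_zeta_has_sum int_shift_has_sum_nome in auto)
  also have "\<dots> = of_real pi ^ 4 / 45 * E4_q (nome z)"
    unfolding nome_power suminf_mult[OF s3] by (simp add: E4_q_def lambert_sum_def algebra_simps)
  finally show "eisenstein_G 4 z = of_real pi ^ 4 / 45 * E4_q (nome z)" .
  have "eisenstein_G 6 z = 2 * of_real pi ^ 6 / 945 + 2 * (\<Sum>m. - 8 * of_real pi ^ 6 / 15 *
           (nome (of_nat (Suc m) * z) * lambert5 (nome (of_nat (Suc m) * z))))"
    by (rule eisenstein_G_expansion[OF assms])
       (use int_zeta_has_sum int_shift_has_sum_nome in auto)
  also have "\<dots> = 2 * of_real pi ^ 6 / 945 * E6_q (nome z)"
    unfolding nome_power suminf_mult[OF s5] by (simp add: E6_q_def lambert_sum_def algebra_simps)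
  finally show "eisenstein_G 6 z = 2 * of_real pi ^ 6 / 945 * E6_q (nome z)" .
qed

lemma E4_q_holomorphic: "E4_q holomorphic_on ball 0 1"
  and E6_q_holomorphic: "E6_q holomorphic_on ball 0 1"
  unfolding E4_q_def[abs_def] E6_q_def[abs_def]
  by (intro holomorphic_intros lambert_sum_holomorphic lambert3_holomorphic lambert5_holomorphic)+

lemma Delta_q_holomorphic: "Delta_q holomorphic_on ball 0 1"
  unfolding Delta_q_def[abs_def]
  by (intro holomorphic_intros E4_q_holomorphic E6_q_holomorphic) auto

section \<open>The modular invariant\<close>

definition E4 :: "complex \<Rightarrow> complex" where "E4 z = E4_q (nome z)"
definition Delta :: "complex \<Rightarrow> complex" where "Delta z = Delta_q (nome z)"

text \<open>The normalisation is \<open>Delta = q - 24 q\<^sup>2 + \<dots>\<close>. The value is right even where \<open>Delta z = 0\<close>,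
  both sides being the junk value then.\<close>

lemma modular_j_eq:
  assumes "Im z > 0"
  shows "modular_j z = E4 z ^ 3 / Delta z"
proof -
  define c where "c = 64 * of_real pi ^ 12 / (27 :: complex)"
  have g2: "weierstrass_g2 z ^ 3 = c * E4 z ^ 3"
    unfolding weierstrass_g2_def eisenstein_G_nome[OF assms] E4_def
    by (simp add: power_mult_distrib power_divide c_def flip: power_mult)
  have g3: "27 * weierstrass_g3 z ^ 2 = c * E6_q (nome z) ^ 2"
    unfolding weierstrass_g3_def eisenstein_G_nome[OF assms]
    by (simp add: power_mult_distrib power_divide c_def flip: power_mult)
  have "weierstrass_g2 z ^ 3 - 27 * weierstrass_g3 z ^ 2 = c * 1728 * Delta z"
    unfolding g2 g3 by (simp add: Delta_def Delta_q_def E4_def algebra_simps)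
  moreover have "c \<noteq> 0" by (simp add: c_def)
  ultimately show ?thesis unfolding modular_j_def g2 by simp
qed

lemma modular_transform:
  fixes a b c d :: int
  assumes z: "Im z > 0" and det: "a * d - b * c = 1"
  shows "E4 (moebius a b c d z) = (of_int c * z + of_int d) ^ 4 * E4 z"
    and "Delta (moebius a b c d z) = (of_int c * z + of_int d) ^ 12 * Delta z"
    and "Im (moebius a b c d z) = Im z / cmod (of_int c * z + of_int d) ^ 2"
proof -
  define w where "w = of_int c * z + of_int d"
  define v where "v = (of_int a * z + of_int b) / w"
  have "(c, d) \<noteq> (0, 0)" using det by auto
  hence w: "w \<noteq> 0" unfolding w_def using denominator_nonzero[OF z] by blast
  have "Im v = Im ((of_int a * z + of_int b) * cnj w) / cmod w ^ 2"
    unfolding v_def by (simp add: complex_div_cnj[of _ w])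
  also have "Im ((of_int a * z + of_int b) * cnj w) = of_int (a * d - b * c) * Im z"
    by (simp add: w_def algebra_simps)
  finally have im: "Im v = Im z / cmod w ^ 2" by (simp add: det)
  hence v: "Im v > 0" using z w by simp
  have 4: "E4 v = w ^ 4 * E4 z"
    using eisenstein_G_transform[OF z det, of 4]
    unfolding w_def[symmetric] v_def[symmetric] eisenstein_G_nome[OF z] eisenstein_G_nome[OF v] E4_def
    by simp
  have 6: "E6_q (nome v) = w ^ 6 * E6_q (nome z)"
    using eisenstein_G_transform[OF z det, of 6]
    unfolding w_def[symmetric] v_def[symmetric] eisenstein_G_nome[OF z] eisenstein_G_nome[OF v]
    by simp
  have D: "Delta v = w ^ 12 * Delta z"
    using 4 6 by (simp add: Delta_def Delta_q_def E4_def power_mult_distrib algebra_simps flip: power_mult)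
  show "E4 (moebius a b c d z) = (of_int c * z + of_int d) ^ 4 * E4 z"
    "Delta (moebius a b c d z) = (of_int c * z + of_int d) ^ 12 * Delta z"
    "Im (moebius a b c d z) = Im z / cmod (of_int c * z + of_int d) ^ 2"
    using 4 D im unfolding v_def w_def by auto
qed

section \<open>Numerical bounds near the cusp\<close>

text \<open>The radius 1/229 bounds |q| on the fundamental domain, where |q| <= exp(-pi sqrt 3),
  about 1/231. The linear coefficients are 8 = 2^3 and 32 = 2^5.\<close>

lemma lambert_coefficient_bounds:
  assumes x: "norm x \<le> 1 / 229"
  shows "norm (lambert3 x) \<le> 26 / 25" "norm (lambert5 x) \<le> 23 / 20"
    and "norm (lambert3 x - 1) \<le> 9 * norm x" "norm (lambert5 x - 1) \<le> 34 * norm x"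
    and "norm (lambert3 x - 1 - 8 * x) \<le> 28 * norm x ^ 2" "norm (lambert5 x - 1 - 32 * x) \<le> 252 * norm x ^ 2"
proof -
  \<comment> \<open>Numerators of the quadratic remainders over (1 - x)^4 and (1 - x)^6; their
    constant terms are 3^3 and 3^5.\<close>
  let ?P3 = "27 + (- 44 * x + (31 * x ^ 2 + - 8 * x ^ 3))"
  let ?P5 = "243 + (- 434 * x + (626 * x ^ 2 + (- 474 * x ^ 3 + (191 * x ^ 4 + - 32 * x ^ 5))))"
  define r where "r = norm x"
  have r: "0 \<le> r" "r \<le> 1 / 229" using x by (auto simp: r_def)
  have p: "r ^ k \<le> (1 / 229) ^ k" for k using r by (intro power_mono) auto
  have nx: "norm (1 - x) \<ge> 228 / 229" using norm_triangle_ineq2[of 1 x] r by (simp add: r_def)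
  hence x1: "1 - x \<noteq> 0" by auto
  have d4: "norm ((1 - x) ^ 4) \<ge> 98 / 100" and d6: "norm ((1 - x) ^ 6) \<ge> 974 / 1000"
    using power_mono[OF nx, of 4] power_mono[OF nx, of 6] by (simp_all add: norm_power power_divide)
  have le: "norm (a / b) \<le> c" if "norm a \<le> c * e" "norm b \<ge> e" "e > 0" for a b :: complex and c e
  proof -
    have "0 \<le> c" using that by (smt (verit) norm_ge_zero zero_le_mult_iff)
    hence "norm a \<le> c * norm b" using that by (meson mult_left_mono order_trans)
    moreover have "norm b > 0" using that by linarith
    ultimately show ?thesis by (simp add: norm_divide pos_divide_le_eq)
  qed
  have n: "norm (numeral k * x ^ j) = numeral k * r ^ j" "norm (x ^ j) = r ^ j"
     "norm (numeral k * x) = numeral k * r" for k j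
    by (auto simp: norm_mult norm_power r_def)
  show "norm (lambert3 x) \<le> 26 / 25"
    unfolding lambert3_def
  proof (rule le[OF _ d4])
    have "norm (1 + 4 * x + x ^ 2) \<le> 1 + 4 * r + r ^ 2"
      by (intro norm_triangle_mono) (simp_all add: norm_mult norm_power r_def)
    also have "\<dots> \<le> 26 / 25 * (98 / 100)" using r p[of 2] by (simp add: power_divide)
    finally show "norm (1 + 4 * x + x ^ 2) \<le> 26 / 25 * (98 / 100)" .
  qed auto
  show "norm (lambert5 x) \<le> 23 / 20"
    unfolding lambert5_def
  proof (rule le[OF _ d6])
    have "norm (1 + 26 * x + 66 * x ^ 2 + 26 * x ^ 3 + x ^ 4) \<le> 1 + 26 * r + 66 * r ^ 2 + 26 * r ^ 3 + r ^ 4"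
      by (intro norm_triangle_mono) (simp_all add: norm_mult norm_power r_def)
    also have "\<dots> \<le> 23 / 20 * (974 / 1000)" using r p[of 2] p[of 3] p[of 4] by (simp add: power_divide)
    finally show "norm (1 + 26 * x + 66 * x ^ 2 + 26 * x ^ 3 + x ^ 4) \<le> 23 / 20 * (974 / 1000)" .
  qed auto
  have "lambert3 x - 1 - 8 * x = x ^ 2 * ?P3 / (1 - x) ^ 4"
    using x1 by (simp add: lambert3_def field_simps) (simp add: eval_nat_numeral algebra_simps)
  also have "norm \<dots> \<le> 28 * r ^ 2"
  proof (rule le[OF _ d4])
    have "norm ?P3 \<le> 27 + (44 * r + (31 * r ^ 2 + 8 * r ^ 3))"
      by (intro norm_triangle_mono) (simp_all add: n norm_mult norm_power r_def)
    also have "\<dots> \<le> 28 * (98 / 100)" using r p[of 2] p[of 3] by (simp add: power_divide)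
    finally have "norm ?P3 * r ^ 2 \<le> 28 * (98 / 100) * r ^ 2"
      by (intro mult_right_mono) auto
    thus "norm (x ^ 2 * ?P3) \<le> 28 * r ^ 2 * (98 / 100)"
      by (simp add: norm_mult n mult_ac)
  qed auto
  finally show 3: "norm (lambert3 x - 1 - 8 * x) \<le> 28 * norm x ^ 2" by (simp add: r_def)
  have "lambert5 x - 1 - 32 * x = x ^ 2 * ?P5 / (1 - x) ^ 6"
    using x1 by (simp add: lambert5_def field_simps) (simp add: eval_nat_numeral algebra_simps)
  also have "norm \<dots> \<le> 252 * r ^ 2"
  proof (rule le[OF _ d6])
    have "norm ?P5
            \<le> 243 + (434 * r + (626 * r ^ 2 + (474 * r ^ 3 + (191 * r ^ 4 + 32 * r ^ 5))))"
      by (intro norm_triangle_mono) (simp_all add: n norm_mult norm_power r_def)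
    also have "\<dots> \<le> 252 * (974 / 1000)" using r p[of 2] p[of 3] p[of 4] p[of 5] by (simp add: power_divide)
    finally have "norm ?P5 * r ^ 2 \<le> 252 * (974 / 1000) * r ^ 2"
      by (intro mult_right_mono) auto
    thus "norm (x ^ 2 * ?P5) \<le> 252 * r ^ 2 * (974 / 1000)"
      by (simp add: norm_mult n mult_ac)
  qed auto
  finally show 5: "norm (lambert5 x - 1 - 32 * x) \<le> 252 * norm x ^ 2" by (simp add: r_def)
  have r2: "r ^ 2 \<le> r / 229" using mult_left_mono[OF r(2,1)] by (simp add: power2_eq_square)
  have "norm (lambert3 x - 1 - 8 * x + 8 * x) \<le> 28 * r ^ 2 + 8 * r"
    using 3 by (intro norm_triangle_mono) (auto simp: n r_def)
  thus "norm (lambert3 x - 1) \<le> 9 * norm x" using r2 r by (simp add: r_def [symmetric])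
  have "norm (lambert5 x - 1 - 32 * x + 32 * x) \<le> 252 * r ^ 2 + 32 * r"
    using 5 by (intro norm_triangle_mono) (auto simp: n r_def)
  thus "norm (lambert5 x - 1) \<le> 34 * norm x" using r2 r by (simp add: r_def [symmetric])
qed

text \<open>Only two terms reach order q^2: q g(q) contributes c and q^2 g(q^2) contributes 1. The
  error constants come from the remainder of g(q), from g(q^2) - 1 with one factor |q| traded for
  1/229, and from the geometric tail, where 1 / (1 - |q|) <= 229/228.\<close>

lemma lambert_sum_second_order:
  fixes g :: "complex \<Rightarrow> complex"
  assumes g: "continuous_on (ball 0 1) g" and q: "norm q \<le> 1 / 229"
    and K: "\<And>x. norm x \<le> 1 / 229 \<Longrightarrow> norm (g x) \<le> K"
    and L: "\<And>x. norm x \<le> 1 / 229 \<Longrightarrow> norm (g x - 1) \<le> L * norm x"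
    and M: "\<And>x. norm x \<le> 1 / 229 \<Longrightarrow> norm (g x - 1 - of_nat c * x) \<le> M * norm x ^ 2"
  shows "norm (lambert_sum g q) \<le> K * (229 / 228) * norm q"
    and "norm (lambert_sum g q - q - of_nat (c + 1) * q ^ 2) \<le> (M + L / 229 + K * (229 / 228)) * norm q ^ 3"
proof -
  define r where "r = norm q"
  have r: "0 \<le> r" "r \<le> 1 / 229" using q by (auto simp: r_def)
  have q1: "norm q < 1" using q by simp
  have K0: "K \<ge> 0" using order_trans[OF norm_ge_zero K[of 0]] by simp
  have L0: "L \<ge> 0" using order_trans[OF norm_ge_zero L[of "1/229"]] by (simp add: norm_divide)
  have tail: "norm (\<Sum>m. q ^ Suc (m + N) * g (q ^ Suc (m + N))) \<le> K * (229 / 228) * r ^ Suc N" for N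
  proof -
    have "norm (\<Sum>m. q ^ Suc (m + N) * g (q ^ Suc (m + N))) \<le> K * r ^ Suc N / (1 - r)"
      unfolding r_def by (rule lambert_tail_bound[OF g q _ K]) auto
    also have "\<dots> \<le> K * r ^ Suc N / (228 / 229)"
      using r K0 by (intro divide_left_mono mult_nonneg_nonneg) auto
    finally show ?thesis by simp
  qed
  show "norm (lambert_sum g q) \<le> K * (229 / 228) * norm q"
    using tail[of 0] lambert_sum_split[OF g q1, of 0] by (simp add: r_def)
  define T where "T = (\<Sum>m. q ^ Suc (m + 2) * g (q ^ Suc (m + 2)))"
  have T: "norm T \<le> K * (229 / 228) * r ^ 3" using tail[of 2] by (simp add: T_def eval_nat_numeral)
  have "lambert_sum g q = q * g q + q ^ 2 * g (q ^ 2) + T"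
    using lambert_sum_split[OF g q1, of 2] by (simp add: T_def eval_nat_numeral)
  hence "lambert_sum g q - q - of_nat (c + 1) * q ^ 2
      = q * (g q - 1 - of_nat c * q) + q ^ 2 * (g (q ^ 2) - 1) + T"
    by (simp add: algebra_simps power2_eq_square)
  also have "norm \<dots> \<le> M * r ^ 3 + L / 229 * r ^ 3 + K * (229 / 228) * r ^ 3"
  proof (intro norm_triangle_mono T)
    show "norm (q * (g q - 1 - of_nat c * q)) \<le> M * r ^ 3"
      using mult_left_mono[OF M[OF q], of r] r by (simp add: norm_mult r_def eval_nat_numeral mult_ac)
    have r4: "r ^ 4 \<le> r ^ 3 * (1 / 229)" using mult_left_mono[OF r(2), of "r ^ 3"] r by (simp add: eval_nat_numeral)
    have "norm (q ^ 2) \<le> 1 / 229"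
      using norm_power_Suc_le[OF q, of 1] by (simp add: power2_eq_square)
    hence "norm (q ^ 2 * (g (q ^ 2) - 1)) \<le> r ^ 2 * (L * r ^ 2)"
      using mult_left_mono[OF L[of "q ^ 2"], of "r ^ 2"] by (simp add: norm_mult norm_power r_def)
    also have "\<dots> = L * r ^ 4" by (simp add: eval_nat_numeral)
    also have "\<dots> \<le> L * (r ^ 3 * (1 / 229))" by (intro mult_left_mono r4 L0)
    finally show "norm (q ^ 2 * (g (q ^ 2) - 1)) \<le> L / 229 * r ^ 3" by simp
  qed
  finally show "norm (lambert_sum g q - q - of_nat (c + 1) * q ^ 2) \<le> (M + L / 229 + K * (229 / 228)) * norm q ^ 3"
    by (simp add: r_def algebra_simps)
qed

lemma lambert_sum_bounds:
  assumes q: "norm q \<le> 1 / 229"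
  shows "norm (lambert_sum lambert3 q) \<le> 21 / 20 * norm q"
    and "norm (lambert_sum lambert3 q - q - 9 * q ^ 2) \<le> 30 * norm q ^ 3"
    and "norm (lambert_sum lambert5 q - q - 33 * q ^ 2) \<le> 254 * norm q ^ 3"
proof -
  have "norm (lambert_sum lambert3 q) \<le> 26 / 25 * (229 / 228) * norm q"
    using lambert_coefficient_bounds
    by (intro lambert_sum_second_order(1)[OF _ q, where L = 9 and M = 28 and c = 8] holomorphic_on_imp_continuous_on lambert3_holomorphic) auto
  also have "\<dots> \<le> 21 / 20 * norm q" by (intro mult_right_mono) auto
  finally show "norm (lambert_sum lambert3 q) \<le> 21 / 20 * norm q" .
  have "norm (lambert_sum lambert3 q - q - of_nat (8 + 1) * q ^ 2) \<le> (28 + 9 / 229 + 26 / 25 * (229 / 228)) * norm q ^ 3"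
    using lambert_coefficient_bounds
    by (intro lambert_sum_second_order(2)[OF _ q] holomorphic_on_imp_continuous_on lambert3_holomorphic) auto
  also have "\<dots> \<le> 30 * norm q ^ 3" by (intro mult_right_mono) auto
  finally show "norm (lambert_sum lambert3 q - q - 9 * q ^ 2) \<le> 30 * norm q ^ 3" by simp
  have "norm (lambert_sum lambert5 q - q - of_nat (32 + 1) * q ^ 2) \<le> (252 + 34 / 229 + 23 / 20 * (229 / 228)) * norm q ^ 3"
    using lambert_coefficient_bounds
    by (intro lambert_sum_second_order(2)[OF _ q] holomorphic_on_imp_continuous_on lambert5_holomorphic) auto
  also have "\<dots> \<le> 254 * norm q ^ 3" by (intro mult_right_mono) auto
  finally show "norm (lambert_sum lambert5 q - q - 33 * q ^ 2) \<le> 254 * norm q ^ 3" by simp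
qed

text \<open>The expansion is q - 24 q^2 + ...; the constant 36 leaves room for all higher terms when
  |q| <= 1/229.\<close>

lemma Delta_q_bound:
  assumes q: "norm q \<le> 1 / 229"
  shows "norm (Delta_q q - q) \<le> 36 * norm q ^ 2"
proof (cases "q = 0")
  case True
  thus ?thesis by (simp add: Delta_q_def E4_q_def E6_q_def lambert_sum_def)
next
  case False
  define r where "r = norm q"
  have r: "0 < r" "r \<le> 1 / 229" using q False by (auto simp: r_def)
  have r2: "r ^ 2 \<le> r / 229" using mult_left_mono[OF r(2), of r] r(1) by (simp add: power2_eq_square)
  have r3: "r ^ 3 \<le> r / 229 ^ 2"
  proof -
    have "r * r ^ 2 \<le> r * (1 / 229) ^ 2" using r by (intro mult_left_mono power_mono) auto
    thus ?thesis by (simp add: eval_nat_numeral)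
  qed
  define \<alpha> where "\<alpha> = (lambert_sum lambert3 q - q - 9 * q ^ 2) / q"
  define \<beta> where "\<beta> = (lambert_sum lambert5 q - q - 33 * q ^ 2) / q"
  have \<alpha>: "norm \<alpha> \<le> 30 * r ^ 2"
    using lambert_sum_bounds(2)[OF q] r by (simp add: \<alpha>_def norm_divide r_def[symmetric] pos_divide_le_eq eval_nat_numeral mult_ac)
  have \<beta>: "norm \<beta> \<le> 254 * r ^ 2"
    using lambert_sum_bounds(3)[OF q] r by (simp add: \<beta>_def norm_divide r_def[symmetric] pos_divide_le_eq eval_nat_numeral mult_ac)
  define a where "a = 1 + 9 * q + \<alpha>"
  define b where "b = 1 + 33 * q + \<beta>"
  have A: "lambert_sum lambert3 q = q * a" and B: "lambert_sum lambert5 q = q * b"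
    using False by (simp_all add: a_def b_def \<alpha>_def \<beta>_def field_simps power2_eq_square)
  define a2 where "a2 = 81 * q ^ 2 + 2 * (\<alpha> * (1 + 9 * q)) + \<alpha> ^ 2"
  define b2 where "b2 = 1089 * q ^ 2 + 2 * (\<beta> * (1 + 33 * q)) + \<beta> ^ 2"
  define a3 where "a3 = (9 * q + \<alpha>) * (1 + a + a ^ 2)"
  have \<alpha>1: "norm \<alpha> \<le> 1 / 100" and \<beta>1: "norm \<beta> \<le> 1 / 100"
    using \<alpha> \<beta> r r2 by linarith+
  have a2: "norm a2 \<le> 150 * r ^ 2"
  proof -
    have "norm a2 \<le> 81 * r ^ 2 + 2 * (30 * r ^ 2 * (1 + 9 * r)) + 30 * r ^ 2 * (1 / 100)"
      unfolding a2_def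
    proof (intro norm_triangle_mono)
      show "norm (81 * q ^ 2) \<le> 81 * r ^ 2" by (simp add: norm_mult norm_power r_def)
      have "norm (1 + 9 * q) \<le> 1 + 9 * r" by (intro norm_triangle_mono) (auto simp: norm_mult r_def)
      hence "norm \<alpha> * norm (1 + 9 * q) \<le> 30 * r ^ 2 * (1 + 9 * r)" using \<alpha> by (intro mult_mono) auto
      thus "norm (2 * (\<alpha> * (1 + 9 * q))) \<le> 2 * (30 * r ^ 2 * (1 + 9 * r))" by (simp add: norm_mult)
      have "norm \<alpha> * norm \<alpha> \<le> 30 * r ^ 2 * (1 / 100)" using \<alpha> \<alpha>1 by (intro mult_mono) auto
      thus "norm (\<alpha> ^ 2) \<le> 30 * r ^ 2 * (1 / 100)" by (simp add: norm_mult power2_eq_square)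
    qed
    also have "\<dots> = (81 + 60 * (1 + 9 * r) + 3 / 10) * r ^ 2" by (simp add: algebra_simps)
    also have "\<dots> \<le> 150 * r ^ 2" using r by (intro mult_right_mono) auto
    finally show ?thesis .
  qed
  have b2: "norm b2 \<le> 1700 * r ^ 2"
  proof -
    have "norm b2 \<le> 1089 * r ^ 2 + 2 * (254 * r ^ 2 * (1 + 33 * r)) + 254 * r ^ 2 * (1 / 100)"
      unfolding b2_def
    proof (intro norm_triangle_mono)
      show "norm (1089 * q ^ 2) \<le> 1089 * r ^ 2" by (simp add: norm_mult norm_power r_def)
      have "norm (1 + 33 * q) \<le> 1 + 33 * r" by (intro norm_triangle_mono) (auto simp: norm_mult r_def)
      hence "norm \<beta> * norm (1 + 33 * q) \<le> 254 * r ^ 2 * (1 + 33 * r)" using \<beta> by (intro mult_mono) auto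
      thus "norm (2 * (\<beta> * (1 + 33 * q))) \<le> 2 * (254 * r ^ 2 * (1 + 33 * r))" by (simp add: norm_mult)
      have "norm \<beta> * norm \<beta> \<le> 254 * r ^ 2 * (1 / 100)" using \<beta> \<beta>1 by (intro mult_mono) auto
      thus "norm (\<beta> ^ 2) \<le> 254 * r ^ 2 * (1 / 100)" by (simp add: norm_mult power2_eq_square)
    qed
    also have "\<dots> = (1089 + 508 * (1 + 33 * r) + 254 / 100) * r ^ 2" by (simp add: algebra_simps)
    also have "\<dots> \<le> 1700 * r ^ 2" using r by (intro mult_right_mono) auto
    finally show ?thesis .
  qed
  have a3: "norm a3 \<le> 31 * r"
  proof -
    have s: "norm (9 * q + \<alpha>) \<le> 9 * r + 30 * r ^ 2"
      using \<alpha> by (intro norm_triangle_mono) (auto simp: norm_mult r_def)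
    have na: "norm a \<le> 21 / 20"
      using norm_triangle_mono[of 1 1 "9 * q + \<alpha>", OF _ s] r r2 by (simp add: a_def add.assoc)
    have "norm (a ^ 2) \<le> (21 / 20) ^ 2" using na by (simp only: norm_power) (intro power_mono, auto)
    hence "norm (1 + a + a ^ 2) \<le> 1 + 21 / 20 + (21 / 20) ^ 2"
      using na by (intro norm_triangle_mono) auto
    hence "norm a3 \<le> (9 * r + 30 * r ^ 2) * (1 + 21 / 20 + (21 / 20) ^ 2)"
      unfolding a3_def norm_mult using s r by (intro mult_mono) auto
    also have "\<dots> \<le> 31 * r" using r2 r by (simp add: power2_eq_square)
    finally show ?thesis .
  qed
  \<comment> \<open>This is (E4^3 - E6^2) / 1728 expanded, minus q, over q. The numbers 5/12, 7/12,
    100, 147 and 8000 are 720, 1008, 3 * 240^2, 504^2 and 240^3 over 1728. Collecting terms, -24 = 9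
    * 5/12 + 33 * 7/12 + 100 - 147 and 98 = 18 * 100 - 66 * 147 + 8000.\<close>
  define S where "S = - 24 * q + (5 / 12 * \<alpha> + (7 / 12 * \<beta> + (98 * q ^ 2 +
            (100 * (q * a2) + (- 147 * (q * b2) + 8000 * (q ^ 2 * a3))))))"
  have D: "Delta_q q - q = q * S"
  proof -
    have "a ^ 2 = 1 + 18 * q + a2" "b ^ 2 = 1 + 66 * q + b2" "a ^ 3 = 1 + a3"
      by (simp_all add: a_def b_def a2_def b2_def a3_def eval_nat_numeral algebra_simps)
    note e = this
    have "Delta_q q = (720 * (q * a) + 1008 * (q * b)) / 1728 + 100 * q ^ 2 * a ^ 2 + 8000 * q ^ 3 * a ^ 3 - 147 * q ^ 2 * b ^ 2"
      unfolding Delta_q_def E4_q_def E6_q_def A B by (simp add: eval_nat_numeral algebra_simps add_divide_distrib diff_divide_distrib)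
    also have "\<dots> = q + q * S"
      unfolding e S_def by (simp add: a_def b_def eval_nat_numeral algebra_simps add_divide_distrib)
    finally show ?thesis by simp
  qed
  have "norm S \<le> 24 * r + (5 / 12 * (30 * r ^ 2) + (7 / 12 * (254 * r ^ 2) + (98 * r ^ 2 +
            (100 * (r * (150 * r ^ 2)) + (147 * (r * (1700 * r ^ 2)) + 8000 * (r ^ 2 * (31 * r)))))))"
    unfolding S_def
  proof (intro norm_triangle_mono)
    show "norm (100 * (q * a2)) \<le> 100 * (r * (150 * r ^ 2))"
      using mult_left_mono[OF a2, of r] r by (simp add: norm_mult r_def)
    show "norm (- 147 * (q * b2)) \<le> 147 * (r * (1700 * r ^ 2))"
      using mult_left_mono[OF b2, of r] r by (simp add: norm_mult r_def)
    show "norm (8000 * (q ^ 2 * a3)) \<le> 8000 * (r ^ 2 * (31 * r))"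
      using mult_left_mono[OF a3, of "r ^ 2"] r by (simp add: norm_mult norm_power r_def)
  qed (use r \<alpha> \<beta> in \<open>auto simp: norm_mult norm_power norm_divide r_def\<close>)
  also have "\<dots> = 24 * r + (5 / 12 * 30 + 7 / 12 * 254 + 98) * r ^ 2 + (15000 + 249900 + 248000) * r ^ 3"
    by (simp add: eval_nat_numeral algebra_simps)
  also have "\<dots> \<le> 36 * r" using r r2 r3 by (simp add: field_simps)
  finally have "norm S \<le> 36 * r" .
  hence "r * norm S \<le> r * (36 * r)" using r by (intro mult_left_mono) auto
  thus ?thesis unfolding D norm_mult by (simp add: r_def power2_eq_square)
qed

lemma exp_1_bounds: "exp (1::real) \<ge> 27182 / 10000" "exp (1::real) \<le> 27183 / 10000"
  using e_approx_32 unfolding abs_le_iff by simp_all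

text \<open>The exponents are lower bounds for 2 pi y at y = 0.866, y = 1.3 and y = 0.95: the bottom
  of the fundamental domain and the two heights at which later estimates are split.\<close>

lemma exp_bounds:
  shows "exp (- (544 / 100) :: real) \<le> 1 / 229"
    and "exp (- (816 / 100) :: real) \<le> 1 / 3400"
    and "exp (- (596 / 100) :: real) \<le> 1 / 350"
proof -
  have inv: "exp (- x) \<le> 1 / c" if "exp x \<ge> c" "c > 0" for x c :: real
    using that by (simp add: exp_minus inverse_eq_divide frac_le)
  have e: "exp (real n + t) \<ge> (27182 / 10000) ^ n * (1 + t + t ^ 2 / 2)" if "t \<ge> 0" for n t
  proof -
    have "exp (real n + t) = exp 1 ^ n * exp t" by (simp add: exp_add exp_of_nat_mult flip: exp_of_nat_mult)
    also have "\<dots> \<ge> (27182 / 10000) ^ n * (1 + t + t ^ 2 / 2)"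
      using exp_1_bounds(1) exp_lower_Taylor_quadratic[OF that] that
      by (intro mult_mono power_mono) auto
    finally show ?thesis .
  qed
  \<comment> \<open>The first bound is tight: the quadratic Taylor polynomial at 0.44 falls short of
    it, so it is taken at 0.22 and squared.\<close>
  have "exp (22 / 100 :: real) \<ge> 12442 / 10000"
    using exp_lower_Taylor_quadratic[of "22/100 :: real"] by (simp add: power2_eq_square)
  hence "exp (22 / 100 :: real) ^ 2 \<ge> (12442 / 10000) ^ 2" by (intro power_mono) auto
  hence "exp (44 / 100 :: real) \<ge> 1548 / 1000" by (simp add: power2_eq_square flip: exp_add)
  moreover have "exp (1 :: real) ^ 5 \<ge> (27182 / 10000) ^ 5" using exp_1_bounds by (intro power_mono) auto
  ultimately have "exp 1 ^ 5 * exp (44 / 100 :: real) \<ge> (27182 / 10000) ^ 5 * (1548 / 1000)"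
    by (intro mult_mono) auto
  also have "exp 1 ^ 5 * exp (44 / 100 :: real) = exp (544 / 100)" by (simp flip: exp_add exp_of_nat_mult)
  finally show "exp (- (544 / 100) :: real) \<le> 1 / 229" by (intro inv) (auto simp: power_divide)
  show "exp (- (816 / 100) :: real) \<le> 1 / 3400"
    using e[of "16/100" 8] by (intro inv) (auto simp: power_divide)
  show "exp (- (596 / 100) :: real) \<le> 1 / 350"
    using e[of "96/100" 5] by (intro inv) (auto simp: power_divide)
qed

lemma E4_q_minus_1_bound:
  assumes "norm q \<le> 1 / 229"
  shows "norm (E4_q q - 1) \<le> 252 * norm q"
  using lambert_sum_bounds(1)[OF assms] by (simp add: E4_q_def norm_mult)

text \<open>Here 193 = 229 - 36 and 265 = 229 + 36. The lower bound is what later excludes zeros of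
  Delta.\<close>

lemma norm_Delta_q_bounds:
  assumes q: "norm q \<le> 1 / 229"
  shows "norm (Delta_q q) \<ge> 193 / 229 * norm q" "norm (Delta_q q) \<le> 265 / 229 * norm q"
proof -
  have "norm (Delta_q q - q) \<le> 36 * (norm q * norm q)"
    using Delta_q_bound[OF q] by (simp add: power2_eq_square)
  also have "\<dots> \<le> 36 * (norm q * (1 / 229))" using q by (intro mult_left_mono) auto
  finally have b: "norm (Delta_q q - q) \<le> 36 / 229 * norm q" by simp
  show "norm (Delta_q q) \<ge> 193 / 229 * norm q"
    using b norm_triangle_ineq2[of q "q - Delta_q q"] by (simp add: norm_minus_commute)
  show "norm (Delta_q q) \<le> 265 / 229 * norm q"
    using b norm_triangle_ineq2[of "Delta_q q" q] by simp
qed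

section \<open>Reduction to the fundamental domain\<close>

definition fundamental_domain :: "complex set" where
  "fundamental_domain = {z. Im z > 0 \<and> \<bar>Re z\<bar> \<le> 1 / 2 \<and> cmod z \<ge> 1}"

lemma Im_fundamental_domain:
  assumes "z \<in> fundamental_domain"
  shows "Im z \<ge> sqrt 3 / 2" "Im z > 866 / 1000"
proof -
  have "\<bar>Re z\<bar> ^ 2 \<le> (1 / 2) ^ 2" using assms by (intro power_mono) (auto simp: fundamental_domain_def)
  moreover have "1 ^ 2 \<le> cmod z ^ 2" using assms by (intro power_mono) (auto simp: fundamental_domain_def)
  ultimately have "Im z ^ 2 \<ge> 3 / 4" using cmod_power2[of z] by (simp add: power_divide)
  hence "sqrt (3 / 4) \<le> Im z" using assms by (intro real_le_lsqrt) (auto simp: fundamental_domain_def)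
  thus 1: "Im z \<ge> sqrt 3 / 2" by (simp add: real_sqrt_divide)
  have "sqrt 3 > (1732 / 1000 :: real)" by (rule real_less_rsqrt) (simp add: power2_eq_square)
  thus "Im z > 866 / 1000" using 1 by linarith
qed

lemma norm_nome_fundamental_domain:
  assumes "z \<in> fundamental_domain"
  shows "norm (nome z) \<le> 1 / 229"
proof -
  have "2 * (31415 / 10000) * (866 / 1000) \<le> 2 * pi * Im z"
    using Im_fundamental_domain(2)[OF assms] pi_approx(1) by (intro mult_mono) auto
  hence "exp (- 2 * pi * Im z) \<le> exp (- (544 / 100))" by simp
  from order_trans[OF this exp_bounds(1)] show ?thesis by (simp only: norm_nome)
qed

text \<open>Among the bottom rows (c, d) reachable while \<open>P\<close> is preserved, one with
  minimal |c z + d|, hence maximal imaginary part, is chosen. Carrying \<open>P\<close> makes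
  stability under translation and inversion enough: the constant predicate gives plain reduction,
  and \<open>P w\<close> saying f w = f z transports values of a function with these two
  symmetries.\<close>

lemma modular_reduction:
  fixes P :: "complex \<Rightarrow> bool"
  assumes z: "Im z > 0" and P: "P z"
    and T: "\<And>w n. Im w > 0 \<Longrightarrow> P w \<Longrightarrow> P (w + of_int n)"
    and S: "\<And>w. Im w > 0 \<Longrightarrow> P w \<Longrightarrow> P (- 1 / w)"
  obtains a b c d :: int where "a * d - b * c = 1"
    "moebius a b c d z \<in> fundamental_domain"
    "P (moebius a b c d z)"
proof -
  define N where "N = (\<lambda>(c::int, d::int). cmod (of_int c * z + of_int d))"
  define Q where "Q = (\<lambda>a b c d :: int. a * d - b * c = 1 \<and> P (moebius a b c d z))"
  \<comment> \<open>The bound \<open>N p \<le> 1\<close> makes this set finite by the lattice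
    estimate, and the identity matrix puts (0, 1) into it.\<close>
  define V where "V = {p. N p \<le> 1 \<and> (\<exists>a b. Q a b (fst p) (snd p))}"
  obtain \<delta> where \<delta>: "\<delta> > 0"
    "\<And>m n :: int. \<delta> * sqrt (of_int m ^ 2 + of_int n ^ 2) \<le> cmod (of_int m * z + of_int n)"
    using lattice_norm_lower_bound[OF z] by blast
  have "finite V"
  proof (rule finite_subset)
    define B where "B = \<lceil>1 / \<delta>\<rceil>"
    show "V \<subseteq> {-B..B} \<times> {-B..B}"
    proof
      fix p assume "p \<in> V"
      obtain m n where [simp]: "p = (m, n)" by force
      have "\<delta> * sqrt (of_int m ^ 2 + of_int n ^ 2) \<le> 1"
        using \<open>p \<in> V\<close> \<delta>(2)[of m n] by (simp add: V_def N_def)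
      hence s: "sqrt (of_int m ^ 2 + of_int n ^ 2) \<le> 1 / \<delta>" using \<delta>(1) by (simp add: field_simps)
      have "\<bar>real_of_int m\<bar> \<le> 1 / \<delta>" "\<bar>real_of_int n\<bar> \<le> 1 / \<delta>"
        using order_trans[OF real_sqrt_sum_squares_ge1 s] order_trans[OF real_sqrt_sum_squares_ge2 s]
          order_trans[OF _ s] by (auto simp: real_le_rsqrt)
      hence "\<bar>m\<bar> \<le> B" "\<bar>n\<bar> \<le> B" unfolding B_def by linarith+
      thus "p \<in> {-B..B} \<times> {-B..B}" by auto
    qed
  qed auto
  moreover have "(0, 1) \<in> V" using P by (auto simp: V_def N_def Q_def intro!: exI[of _ 1] exI[of _ 0])
  ultimately have "Min (N ` V) \<in> N ` V" by (intro Min_in) auto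
  then obtain p where p: "p \<in> V" "N p = Min (N ` V)" by force
  obtain c d where cd [simp]: "p = (c, d)" by force
  obtain a b where ab: "Q a b c d" using p(1) by (auto simp: V_def)
  have min: "N p \<le> N p'" if "p' \<in> V" for p' using p \<open>finite V\<close> that by simp
  define v where "v = of_int c * z + of_int d"
  have "(c, d) \<noteq> (0, 0)" using ab by (auto simp: Q_def)
  hence v: "v \<noteq> 0" unfolding v_def using denominator_nonzero[OF z] by blast
  define n where "n = - round (Re ((of_int a * z + of_int b) / v))"
  define a' where "a' = a + n * c"
  define b' where "b' = b + n * d"
  define w where "w = (of_int a' * z + of_int b') / v"
  have det: "a' * d - b' * c = 1" using ab by (simp add: Q_def a'_def b'_def algebra_simps)
  have w: "w = (of_int a * z + of_int b) / v + of_int n"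
  proof -
    have "of_int a' * z + of_int b' = (of_int a * z + of_int b) + of_int n * v"
      by (simp add: a'_def b'_def v_def algebra_simps)
    thus ?thesis unfolding w_def using v by (simp add: add_divide_distrib)
  qed
  have Im0: "Im ((of_int a * z + of_int b) / v) > 0"
    using modular_transform(3)[OF z, of a d b c] ab z v by (simp add: Q_def flip: v_def)
  hence Imw: "Im w > 0" by (simp add: w)
  have Pw: "P w" unfolding w using T[OF Im0] ab by (simp add: Q_def flip: v_def)
  have Re: "\<bar>Re w\<bar> \<le> 1 / 2"
    using of_int_round_abs_le[of "Re ((of_int a * z + of_int b) / v)"] by (simp add: w n_def abs_minus_commute)
  \<comment> \<open>Otherwise -1 / w would have the bottom row (a', b') of norm |w| |c z + d|,
    against minimality.\<close>
  have "cmod w \<ge> 1"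
  proof (rule ccontr)
    assume *: "\<not> cmod w \<ge> 1"
    have "- 1 / w = (of_int (- c) * z + of_int (- d)) / (of_int a' * z + of_int b')"
      by (simp add: w_def v_def)
    hence "Q (- c) (- d) a' b'" using S[OF Imw Pw] det by (simp add: Q_def algebra_simps)
    moreover have "N (a', b') = cmod w * N (c, d)" using v by (simp add: N_def w_def norm_divide flip: v_def)
    moreover have "N (c, d) > 0" using v by (simp add: N_def flip: v_def)
    moreover have "N (c, d) \<le> 1" using p(1) by (simp add: V_def)
    ultimately have "(a', b') \<in> V" "N (a', b') < N (c, d)" using *
      by (auto simp: V_def intro!: mult_le_one)
    thus False using min by force
  qed
  with Imw Re have "w \<in> fundamental_domain" by (simp add: fundamental_domain_def)
  thus ?thesis using that[OF det] Pw by (simp add: w_def v_def)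
qed

lemma upper_half_plane_open_connected: "open {z. Im z > 0}" "connected {z. Im z > 0}"
proof -
  show "open {z. Im z > 0}" by (rule open_halfspace_Im_gt)
  have "{z. Im z > 0} = {z. \<i> \<bullet> z > 0}" by (simp add: inner_complex_def)
  thus "connected {z. Im z > 0}" using convex_connected[OF convex_halfspace_gt[of 0 \<i>]] by simp
qed

lemma periodic_of_int:
  fixes f :: "complex \<Rightarrow> 'a"
  assumes T: "\<And>z. Im z > 0 \<Longrightarrow> f (z + 1) = f z" and z: "Im z > 0"
  shows "f (z + of_int n) = f z"
proof (induction n rule: int_induct[where k = 0])
  case (step1 i)
  thus ?case using T[of "z + of_int i"] z by (simp add: add.assoc)
next
  case (step2 i)
  thus ?case using T[of "z + of_int (i - 1)"] z by simp
qed simp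

lemma modular_reduction_fun:
  fixes f :: "complex \<Rightarrow> 'a"
  assumes z: "Im z > 0" and T: "\<And>z. Im z > 0 \<Longrightarrow> f (z + 1) = f z"
    and S: "\<And>z. Im z > 0 \<Longrightarrow> f (- 1 / z) = f z"
  obtains w where "w \<in> fundamental_domain" "f w = f z"
proof (rule modular_reduction[OF z, of "\<lambda>w. f w = f z"])
  show "f (w + of_int n) = f z" if "Im w > 0" "f w = f z" for w n
    using periodic_of_int[of f, OF T that(1)] that(2) by simp
qed (use S that in auto)

text \<open>A modular function attains its maximum modulus in the interior unless its supremum is
  approached at the cusp.\<close>

lemma modular_max_modulus:
  fixes f :: "complex \<Rightarrow> complex"
  assumes hol: "f holomorphic_on {z. Im z > 0}"
    and T: "\<And>z. Im z > 0 \<Longrightarrow> cmod (f (z + 1)) = cmod (f z)"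
    and S: "\<And>z. Im z > 0 \<Longrightarrow> cmod (f (- 1 / z)) = cmod (f z)"
    and cusp: "\<And>\<epsilon>. \<epsilon> > 0 \<Longrightarrow> \<exists>Y. \<forall>z. Im z > 0 \<and> Im z \<ge> Y \<longrightarrow> cmod (f z) \<le> C + \<epsilon>"
    and z: "Im z > 0"
  shows "cmod (f z) \<le> C"
proof (rule ccontr)
  assume "\<not> cmod (f z) \<le> C"
  define \<epsilon> where "\<epsilon> = (cmod (f z) - C) / 2"
  have \<epsilon>: "\<epsilon> > 0" "C + \<epsilon> < cmod (f z)" using \<open>\<not> cmod (f z) \<le> C\<close> by (auto simp: \<epsilon>_def field_simps)
  obtain Y where Y: "\<And>z. Im z > 0 \<Longrightarrow> Im z \<ge> Y \<Longrightarrow> cmod (f z) \<le> C + \<epsilon>" using cusp[OF \<epsilon>(1)] by blast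
  \<comment> \<open>Points where |f| exceeds C + eps reduce into this compact rectangle: below
    \<open>Y\<close> by the bound at the cusp, above sqrt 3 / 2 by the shape of the fundamental
    domain.\<close>
  define K where "K = {z. Im z \<ge> sqrt 3 / 2 \<and> Im z \<le> Y \<and> \<bar>Re z\<bar> \<le> 1 / 2}"
  have red: "\<exists>w\<in>K. cmod (f w) = cmod (f u)" if u: "Im u > 0" "cmod (f u) > C + \<epsilon>" for u
  proof -
    obtain w where w: "w \<in> fundamental_domain" "cmod (f w) = cmod (f u)"
      using modular_reduction_fun[of u "\<lambda>z. cmod (f z)"] T S u by blast
    have "Im w \<le> Y" using Y[of w] w u by (force simp: fundamental_domain_def)
    thus ?thesis using w Im_fundamental_domain[OF w(1)] by (auto simp: K_def fundamental_domain_def)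
  qed
  have Kpos: "Im w > 0" if "w \<in> K" for w
  proof -
    have "0 < sqrt 3 / (2 :: real)" by simp
    also have "\<dots> \<le> Im w" using that by (simp add: K_def)
    finally show ?thesis .
  qed
  have K: "compact K"
  proof -
    have "K = {z. Im z \<ge> sqrt 3 / 2} \<inter> {z. Im z \<le> Y} \<inter> {z. Re z \<le> 1 / 2} \<inter> {z. Re z \<ge> - 1 / 2}"
      by (auto simp: K_def)
    moreover have "closed \<dots>"
      by (intro closed_Int closed_halfspace_Im_ge closed_halfspace_Im_le
          closed_halfspace_Re_ge closed_halfspace_Re_le)
    ultimately have "closed K" by simp
    moreover have "bounded K"
    proof (rule boundedI)
      fix w assume "w \<in> K"
      hence "\<bar>Re w\<bar> \<le> 1 / 2" "\<bar>Im w\<bar> \<le> \<bar>Y\<bar>" using Kpos[of w] by (auto simp: K_def)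
      thus "norm w \<le> 1 / 2 + \<bar>Y\<bar>" using cmod_le[of w] by linarith
    qed
    ultimately show ?thesis by (simp add: compact_eq_bounded_closed)
  qed
  obtain w0 where w0: "w0 \<in> K" "cmod (f w0) = cmod (f z)" using red[OF z \<epsilon>(2)] by blast
  have "continuous_on K (\<lambda>w. cmod (f w))"
    using Kpos by (intro continuous_intros holomorphic_on_imp_continuous_on holomorphic_on_subset[OF hol]) auto
  then obtain m where m: "m \<in> K" "\<And>w. w \<in> K \<Longrightarrow> cmod (f w) \<le> cmod (f m)"
    using continuous_attains_sup[OF K] w0 by blast
  have big: "cmod (f m) > C + \<epsilon>" using m(2)[OF w0(1)] w0(2) \<epsilon>(2) by simp
  have max: "cmod (f u) \<le> cmod (f m)" if "Im u > 0" for u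
    using red[OF that] m(2) big by (metis linorder_not_le order.trans less_imp_le)
  \<comment> \<open>The maximum over the rectangle is a maximum over the whole half-plane, so
    \<open>f\<close> is constant; a point above \<open>Y\<close> then contradicts the bound
    there.\<close>
  have "f constant_on {z. Im z > 0}"
    by (rule maximum_modulus_principle[OF hol upper_half_plane_open_connected upper_half_plane_open_connected(1)])
       (use Kpos[OF m(1)] max in auto)
  then obtain c where c: "\<And>u. Im u > 0 \<Longrightarrow> f u = c" by (auto simp: constant_on_def)
  define u where "u = Complex 0 (max Y 1)"
  have "cmod (f u) \<le> C + \<epsilon>" by (intro Y) (auto simp: u_def)
  moreover have "f u = f m" using c[of u] c[OF Kpos[OF m(1)]] by (simp add: u_def)
  ultimately show False using big by simp
qed

section \<open>Basic properties of the modular invariant\<close>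

text \<open>The numerical lower bound on the fundamental domain is positive because the nome never
  vanishes; weight 12 carries this to the whole half-plane.\<close>

lemma Delta_nonzero:
  assumes "Im z > 0"
  shows "Delta z \<noteq> 0"
proof -
  obtain a b c d :: int where *: "a * d - b * c = 1"
    "moebius a b c d z \<in> fundamental_domain"
    by (rule modular_reduction[OF assms, of "\<lambda>_. True"]) auto
  from norm_Delta_q_bounds(1)[OF norm_nome_fundamental_domain[OF *(2)]]
  have "Delta (moebius a b c d z) \<noteq> 0"
    by (auto simp: Delta_def nome_def)
  thus ?thesis using modular_transform(2)[OF assms *(1)] by auto
qed

lemma nome_holomorphic: "nome holomorphic_on A"
  unfolding nome_def[abs_def] by (intro holomorphic_intros)

lemma Delta_holomorphic: "Delta holomorphic_on {z. Im z > 0}"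
  and E4_holomorphic: "E4 holomorphic_on {z. Im z > 0}"
  unfolding Delta_def[abs_def] E4_def[abs_def]
  by (intro holomorphic_on_compose_gen[OF nome_holomorphic, unfolded o_def, where t = "ball 0 1"]
        Delta_q_holomorphic E4_q_holomorphic; use norm_nome_less_1 in auto)+

lemma modular_j_holomorphic: "modular_j holomorphic_on {z. Im z > 0}"
proof (rule holomorphic_transform)
  show "(\<lambda>z. E4 z ^ 3 / Delta z) holomorphic_on {z. Im z > 0}"
    by (intro holomorphic_intros E4_holomorphic Delta_holomorphic) (use Delta_nonzero in auto)
qed (simp add: modular_j_eq)

lemma Im_moebius_pos:
  fixes a b c d :: int
  assumes z: "Im z > 0" and det: "a * d - b * c = 1"
  shows "Im (moebius a b c d z) > 0"
proof -
  have "(c, d) \<noteq> (0, 0)" using det by auto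
  thus ?thesis unfolding modular_transform(3)[OF assms] using denominator_nonzero[OF z] z by simp
qed

lemma modular_j_moebius:
  fixes a b c d :: int
  assumes z: "Im z > 0" and det: "a * d - b * c = 1"
  shows "modular_j (moebius a b c d z) = modular_j z"
proof -
  have "(c, d) \<noteq> (0, 0)" using det by auto
  hence w: "of_int c * z + of_int d \<noteq> 0" using denominator_nonzero[OF z] by blast
  have "((of_int c * z + of_int d) ^ 4) ^ 3 = (of_int c * z + of_int d) ^ 12" by (simp flip: power_mult)
  thus ?thesis
    unfolding modular_j_eq[OF z] modular_j_eq[OF Im_moebius_pos[OF assms]] modular_transform(1,2)[OF assms]
    using w by (simp add: power_mult_distrib)
qed

lemma modular_j_S: "Im z > 0 \<Longrightarrow> modular_j (- 1 / z) = modular_j z"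
  and modular_j_T: "Im z > 0 \<Longrightarrow> modular_j (z + of_int n) = modular_j z"
  using modular_j_moebius[of z 0 0 "-1" 1] modular_j_moebius[of z 1 1 n 0] by auto

text \<open>Quantitative form of j = 1/q + O(1). For |q| <= 1/229 one has |E4| <= 2.2, hence |E4^3 -
  1| <= 2030 |q|. Adding 36 for the error of Delta and dividing by 193/229 stays below 2500.\<close>

lemma modular_j_cusp:
  assumes z: "Im z > 0" and q: "norm (nome z) \<le> 1 / 229"
  shows "cmod (modular_j z * nome z - 1) \<le> 2500 * norm (nome z)"
proof -
  define q r where "q = nome z" and "r = norm q"
  have r: "r > 0" "r \<le> 1 / 229" using q by (auto simp: r_def q_def nome_def)
  have e: "norm (E4 z - 1) \<le> 252 * r" using E4_q_minus_1_bound[OF q] by (simp add: E4_def q_def r_def)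
  have e': "norm (E4 z) \<le> 22 / 10" using norm_triangle_mono[of 1 1 "E4 z - 1", OF _ e] r by simp
  have "norm (E4 z ^ 2) \<le> (22 / 10) ^ 2" using e' by (simp only: norm_power) (intro power_mono, auto)
  hence "norm (1 + E4 z + E4 z ^ 2) \<le> 1 + 22 / 10 + (22 / 10) ^ 2" using e' by (intro norm_triangle_mono) auto
  hence "norm (E4 z - 1) * norm (1 + E4 z + E4 z ^ 2) \<le> 252 * r * (1 + 22 / 10 + (22 / 10) ^ 2)"
    using e by (intro mult_mono) (use r in auto)
  also have "(E4 z - 1) * (1 + E4 z + E4 z ^ 2) = E4 z ^ 3 - 1" by (simp add: eval_nat_numeral algebra_simps)
  hence "norm (E4 z - 1) * norm (1 + E4 z + E4 z ^ 2) = norm (E4 z ^ 3 - 1)" by (metis norm_mult)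
  finally have e3: "norm (E4 z ^ 3 - 1) \<le> 2030 * r" using r by (simp add: power2_eq_square)
  have d: "norm (q - Delta z) \<le> 36 * r ^ 2"
    using Delta_q_bound[OF q] by (simp add: Delta_def q_def r_def norm_minus_commute)
  have D: "norm (Delta z) \<ge> 193 / 229 * r"
    using norm_Delta_q_bounds(1)[OF q] by (simp add: Delta_def q_def r_def)
  have "modular_j z * q - 1 = (q * (E4 z ^ 3 - 1) + (q - Delta z)) / Delta z"
    unfolding modular_j_eq[OF z] using Delta_nonzero[OF z] by (simp add: field_simps)
  also have "norm \<dots> \<le> (r * (2030 * r) + 36 * r ^ 2) / (193 / 229 * r)"
    unfolding norm_divide using D d e3 r
    by (intro frac_le norm_triangle_mono) (auto simp: norm_mult r_def[symmetric] intro: mult_left_mono)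
  also have "\<dots> = (2066 * 229 / 193) * r" using r by (simp add: power2_eq_square field_simps)
  also have "\<dots> \<le> 2500 * r" using r by simp
  finally show ?thesis by (simp add: q_def r_def)
qed

lemma nome_cusp:
  assumes "\<epsilon> > 0"
  shows "\<exists>Y>0. \<forall>z. Im z \<ge> Y \<longrightarrow> norm (nome z) \<le> \<epsilon>"
proof -
  define Y where "Y = max 1 (- ln \<epsilon> / (2 * pi))"
  have "norm (nome z) \<le> \<epsilon>" if "Im z \<ge> Y" for z
  proof -
    have "- ln \<epsilon> / (2 * pi) \<le> Im z" using that by (simp add: Y_def)
    hence "- ln \<epsilon> / (2 * pi) * (2 * pi) \<le> Im z * (2 * pi)" by (intro mult_right_mono) auto
    hence "- 2 * pi * Im z \<le> ln \<epsilon>" by (simp add: mult_ac)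
    thus ?thesis using assms by (simp add: norm_nome ln_ge_iff)
  qed
  thus ?thesis by (intro exI[of _ Y]) (auto simp: Y_def)
qed

lemma modular_j_at_cusp: "\<exists>Y>0. \<forall>z. Im z \<ge> Y \<longrightarrow> cmod (modular_j z) \<ge> B"
proof -
  \<comment> \<open>Chosen so that 2500 eps <= 1/2 and 1 / (2 eps) >= B.\<close>
  define \<epsilon> where "\<epsilon> = 1 / (5000 + 2 * \<bar>B\<bar>)"
  obtain Y where Y: "Y > 0" "\<And>z. Im z \<ge> Y \<Longrightarrow> norm (nome z) \<le> \<epsilon>"
    using nome_cusp[of \<epsilon>] by (auto simp: \<epsilon>_def add_pos_nonneg)
  have "cmod (modular_j z) \<ge> B" if "Im z \<ge> Y" for z
  proof -
    have q: "norm (nome z) \<le> \<epsilon>" "norm (nome z) > 0" using Y(2)[OF that] by (auto simp: nome_def)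
    have "\<epsilon> \<le> 1 / 5000" by (simp add: \<epsilon>_def frac_le)
    hence "cmod (modular_j z * nome z - 1) \<le> 1 / 2"
      using modular_j_cusp[of z] that Y(1) q by simp
    hence "1 / 2 \<le> cmod (modular_j z * nome z)"
      using norm_triangle_ineq2[of 1 "1 - modular_j z * nome z"] by (simp add: norm_minus_commute)
    also have "\<dots> \<le> cmod (modular_j z) * \<epsilon>" unfolding norm_mult using q by (intro mult_left_mono) auto
    also have "\<dots> = cmod (modular_j z) / (5000 + 2 * \<bar>B\<bar>)" by (simp add: \<epsilon>_def)
    finally have "1 / 2 * (5000 + 2 * \<bar>B\<bar>) \<le> cmod (modular_j z)"
      by (subst (asm) pos_le_divide_eq) auto
    thus "cmod (modular_j z) \<ge> B" by (simp add: abs_if split: if_splits)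
  qed
  thus ?thesis using Y(1) by blast
qed

text \<open>If y were omitted, 1 / (j - y) would be a holomorphic modular function tending to 0 at
  the cusp, hence 0 by the maximum principle.\<close>

lemma modular_j_surj: "\<exists>z\<in>fundamental_domain. modular_j z = y"
proof -
  have "\<exists>z. Im z > 0 \<and> modular_j z = y"
  proof (rule ccontr)
    assume *: "\<not> ?thesis"
    define f where "f = (\<lambda>z. 1 / (modular_j z - y))"
    have hol: "f holomorphic_on {z. Im z > 0}"
      unfolding f_def using * by (intro holomorphic_intros modular_j_holomorphic) auto
    have "cmod (f \<i>) \<le> 0"
    proof (rule modular_max_modulus[OF hol])
      fix \<epsilon> :: real assume \<epsilon>: "\<epsilon> > 0"
      obtain Y where Y: "Y > 0" "\<And>z. Im z \<ge> Y \<Longrightarrow> cmod (modular_j z) \<ge> cmod y + 1 / \<epsilon>"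
        using modular_j_at_cusp by metis
      have "cmod (f z) \<le> \<epsilon>" if "Im z \<ge> Y" for z
      proof -
        have "1 / \<epsilon> \<le> cmod (modular_j z - y)"
          using Y(2)[OF that] norm_triangle_ineq2[of "modular_j z" y] by linarith
        hence "1 / cmod (modular_j z - y) \<le> 1 / (1 / \<epsilon>)" using \<epsilon>
          by (intro divide_left_mono mult_pos_pos) (auto intro: less_le_trans[of 0 "1 / \<epsilon>"])
        thus ?thesis by (simp add: f_def norm_divide)
      qed
      thus "\<exists>Y. \<forall>z. Im z > 0 \<and> Im z \<ge> Y \<longrightarrow> cmod (f z) \<le> 0 + \<epsilon>" by auto
    qed (use modular_j_S modular_j_T[of _ 1] in \<open>auto simp: f_def\<close>)
    thus False using *  by (auto simp: f_def)
  qed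
  then obtain z where z: "Im z > 0" "modular_j z = y" by blast
  show ?thesis
    using modular_reduction_fun[of z modular_j] z modular_j_S modular_j_T[of _ 1] by (metis of_int_1)
qed

section \<open>The index-\<open>l\<close> sublattices\<close>

text \<open>Representatives of the integer matrices of determinant \<open>l\<close> modulo \<open>SL\<^sub>2(\<int>)\<close>: the indices
  \<open>b < l\<close> stand for \<open>(z + b) / l\<close> and the index \<open>l\<close> stands for \<open>l z\<close>.\<close>

definition hecke_point :: "nat \<Rightarrow> nat \<Rightarrow> complex \<Rightarrow> complex" where
  "hecke_point l b z = (if b < l then (z + of_nat b) / of_nat l else of_nat l * z)"

lemma Im_hecke_point:
  "Im (hecke_point l b z) = (if b < l then Im z / real l else real l * Im z)"
  by (simp add: hecke_point_def)

lemma Im_hecke_point_pos: "Im z > 0 \<Longrightarrow> l > 0 \<Longrightarrow> Im (hecke_point l b z) > 0"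
  by (simp add: Im_hecke_point)

lemma hecke_point_high:
  assumes l: "l > 0" and Y: "Y > 0" and z: "Im z \<ge> Y * real l"
  shows "Im z \<ge> Y" "Im (hecke_point l b z) \<ge> Y"
proof -
  have "Y * 1 \<le> Y * real l" using l Y by (intro mult_left_mono) auto
  thus zY: "Im z \<ge> Y" using z by simp
  have "1 * Im z \<le> real l * Im z" using l zY Y by (intro mult_right_mono) auto
  thus "Im (hecke_point l b z) \<ge> Y" using z zY l by (auto simp: Im_hecke_point pos_le_divide_eq)
qed

lemma sum_Im_hecke_point:
  assumes "l > 0"
  shows "(\<Sum>b\<le>l. Im (hecke_point l b z)) = real (l + 1) * Im z"
proof -
  have "(\<Sum>b\<le>l. Im (hecke_point l b z)) = (\<Sum>b<l. Im z / real l) + real l * Im z"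
    by (simp add: lessThan_Suc_atMost [symmetric] Im_hecke_point)
  thus ?thesis using assms by (simp add: algebra_simps)
qed

text \<open>The imaginary parts of the l + 1 points add up to (l + 1) Im z. Both the comparison of
  the Delta product with \<open>Delta z ^ (l + 1)\<close> at the cusp and the pole order of the
  coefficients of \<open>hecke_poly\<close> rest on this.\<close>

lemma prod_norm_nome_hecke_point:
  assumes "l > 0"
  shows "(\<Prod>b\<le>l. norm (nome (hecke_point l b z))) = norm (nome z) ^ (l + 1)"
proof -
  have "(\<Prod>b\<le>l. norm (nome (hecke_point l b z))) = exp (\<Sum>b\<le>l. - 2 * pi * Im (hecke_point l b z))"
    by (simp add: exp_sum norm_nome)
  also have "(\<Sum>b\<le>l. - 2 * pi * Im (hecke_point l b z)) = real (l + 1) * (- 2 * pi * Im z)"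
    unfolding sum_distrib_left [symmetric] sum_Im_hecke_point[OF assms] by (simp only: mult_ac)
  also have "exp \<dots> = norm (nome z) ^ (l + 1)" unfolding norm_nome by (rule exp_of_nat_mult)
  finally show ?thesis .
qed

text \<open>Translation cycles the indices below \<open>l\<close>, the wrap-around costing a shift
  by 1, and fixes the index \<open>l\<close> at the cost of a shift by \<open>l\<close>. A general
  translation-invariant \<open>h\<close> serves both \<open>Delta_invariant\<close> and
  \<open>modular_j\<close>.\<close>

lemma hecke_point_T:
  fixes h :: "complex \<Rightarrow> 'a"
  assumes l: "l > 0" and z: "Im z > 0"
    and h: "\<And>w n. Im w > 0 \<Longrightarrow> h (w + of_int n) = h w"
  obtains \<sigma> where "bij_betw \<sigma> {..l} {..l}"
    "\<And>b. b \<le> l \<Longrightarrow> h (hecke_point l b (z + 1)) = h (hecke_point l (\<sigma> b) z)"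
proof
  define \<sigma> where "\<sigma> = (\<lambda>b. if b < l then if b + 1 = l then 0 else b + 1 else b)"
  define \<tau> where "\<tau> = (\<lambda>b. if b < l then if b = 0 then l - 1 else b - 1 else b)"
  show "bij_betw \<sigma> {..l} {..l}"
    by (rule bij_betw_byWitness[where f' = \<tau>]) (use l in \<open>auto simp: \<sigma>_def \<tau>_def\<close>)
  fix b assume b: "b \<le> l"
  consider "b + 1 < l" | "b + 1 = l" | "b = l" using b by linarith
  thus "h (hecke_point l b (z + 1)) = h (hecke_point l (\<sigma> b) z)"
  proof cases
    case 1
    thus ?thesis by (simp add: hecke_point_def \<sigma>_def add_ac)
  next
    case 2
    have "hecke_point l b (z + 1) = (z + of_nat l) / of_nat l" using 2 by (auto simp: hecke_point_def)
    also have "\<dots> = hecke_point l 0 z + of_int 1" using l by (simp add: hecke_point_def add_divide_distrib)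
    finally show ?thesis using 2 h[OF Im_hecke_point_pos[OF z l], of 0 1] by (auto simp: \<sigma>_def)
  next
    case 3
    have "hecke_point l b (z + 1) = hecke_point l l z + of_int (int l)"
      using 3 by (simp add: hecke_point_def algebra_simps)
    thus ?thesis using 3 h[OF Im_hecke_point_pos[OF z l], of l "int l"] by (simp add: \<sigma>_def)
  qed
qed

lemma prime_neg_inverse:
  assumes l: "prime l" and b: "0 < b" "b < l"
  shows "\<exists>!b'. 0 < b' \<and> b' < l \<and> int l dvd int b * int b' + 1"
proof (rule ex_ex1I)
  have "coprime b l" using prime_imp_coprime[OF l, of b] b nat_dvd_not_less by (auto simp: coprime_commute)
  hence cop: "coprime (int b) (int l)" by simp
  obtain u v where uv: "u * int b + v * int l = 1" using bezout_int[of "int b" "int l"] cop by auto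
  define x where "x = (- u) mod int l"
  have x: "0 \<le> x" "x < int l" using b by (auto simp: x_def)
  have "int b * x + 1 = int b * (- u) + 1 - int l * (int b * ((- u) div int l))"
    by (simp add: x_def minus_div_mult_eq_mod [symmetric] algebra_simps)
  also have "int b * (- u) + 1 = int l * v" using uv by (simp add: algebra_simps)
  finally have d: "int l dvd int b * x + 1" by simp
  have "x \<noteq> 0" using d prime_gt_1_nat[OF l] by auto
  thus "\<exists>b'. 0 < b' \<and> b' < l \<and> int l dvd int b * int b' + 1"
    using x d by (intro exI[of _ "nat x"]) auto
  fix x y assume xy: "0 < x \<and> x < l \<and> int l dvd int b * int x + 1" "0 < y \<and> y < l \<and> int l dvd int b * int y + 1"
  hence "int l dvd (int b * int x + 1) - (int b * int y + 1)" by (intro dvd_diff) auto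
  hence "int l dvd int b * (int x - int y)" by (simp add: algebra_simps)
  hence "int l dvd int x - int y" using cop by (meson coprime_commute coprime_dvd_mult_right_iff)
  moreover have "\<bar>int x - int y\<bar> < int l" using xy by auto
  ultimately show "x = y" using zdvd_not_zless[of "\<bar>int x - int y\<bar>" "int l"] by (cases "x = y") auto
qed

text \<open>Inversion swaps the indices 0 and l and sends 0 < b < l to the c with b c = -1 modulo l.
  With b c + 1 = l k, the matrix with rows (b, -k) and (l, -c) has determinant 1 and maps (z + c) /
  l to (-1 / z + b) / l.\<close>

lemma hecke_point_S:
  fixes h :: "complex \<Rightarrow> 'a"
  assumes l: "prime l" and z: "Im z > 0"
    and h: "\<And>w a b c d. Im w > 0 \<Longrightarrow> a * d - b * c = 1 \<Longrightarrow>
               h (moebius a b c d w) = h w"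
  obtains \<sigma> where "bij_betw \<sigma> {..l} {..l}"
    "\<And>b. b \<le> l \<Longrightarrow> h (hecke_point l b (- 1 / z)) = h (hecke_point l (\<sigma> b) z)"
proof
  have l0: "l > 0" using l prime_gt_0_nat by blast
  have z0: "z \<noteq> 0" using z by auto
  define inv where "inv = (\<lambda>b. THE b'. 0 < b' \<and> b' < l \<and> int l dvd int b * int b' + 1)"
  have inv: "0 < inv b \<and> inv b < l \<and> int l dvd int b * int (inv b) + 1" if "0 < b" "b < l" for b
    unfolding inv_def by (rule theI'[OF prime_neg_inverse[OF l that]])
  have invinv: "inv (inv b) = b" if "0 < b" "b < l" for b
    using prime_neg_inverse[OF l, of "inv b"] inv[OF that] inv[of "inv b"] that
    by (auto simp: mult.commute)
  define \<sigma> where "\<sigma> = (\<lambda>b. if b = 0 then l else if b = l then 0 else inv b)"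
  have \<sigma>\<sigma>: "\<sigma> (\<sigma> b) = b" "\<sigma> b \<le> l" if "b \<le> l" for b
    using that l0 inv[of b] invinv[of b] by (auto simp: \<sigma>_def)
  show "bij_betw \<sigma> {..l} {..l}"
    by (rule bij_betw_byWitness[where f' = \<sigma>]) (use \<sigma>\<sigma> in auto)
  have S: "h (- 1 / w) = h w" if "Im w > 0" for w using h[OF that, of 0 0 "-1" 1] by simp
  fix b assume b: "b \<le> l"
  consider "b = 0" | "b = l" | "0 < b" "b < l" using b by linarith
  thus "h (hecke_point l b (- 1 / z)) = h (hecke_point l (\<sigma> b) z)"
  proof cases
    case 1
    have "hecke_point l b (- 1 / z) = - 1 / hecke_point l l z" using 1 l0 by (simp add: hecke_point_def)
    thus ?thesis using 1 S[OF Im_hecke_point_pos[OF z l0], of l] by (simp add: \<sigma>_def)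
  next
    case 2
    have "hecke_point l b (- 1 / z) = - 1 / hecke_point l 0 z" using 2 l0 by (simp add: hecke_point_def)
    thus ?thesis using 2 l0 S[OF Im_hecke_point_pos[OF z l0], of 0] by (simp add: \<sigma>_def)
  next
    case 3
    define c where "c = inv b"
    obtain k where k: "int b * int c + 1 = int l * k" using inv[OF 3] by (auto simp: c_def)
    define w where "w = hecke_point l c z"
    have w: "w = (z + of_nat c) / of_nat l" using inv[OF 3] by (simp add: w_def hecke_point_def c_def)
    have kc: "of_nat b * of_nat c + 1 = of_nat l * (of_int k :: complex)"
      using arg_cong[OF k, of "of_int :: int \<Rightarrow> complex"] by simp
    have "of_int (int l) * w + of_int (- int c) = z" using l0 by (simp add: w)
    moreover have "of_int (int b) * w + of_int (- k) = (of_nat b * z - 1) / of_nat l"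
    proof -
      have "of_int (int b) * w + of_int (- k) = (of_nat b * (z + of_nat c) - of_nat l * of_int k) / of_nat l"
        using l0 by (simp add: w diff_divide_distrib)
      also have "of_nat b * (z + of_nat c) - of_nat l * of_int k = of_nat b * z - 1"
        unfolding kc [symmetric] by (simp add: algebra_simps)
      finally show ?thesis .
    qed
    moreover have "hecke_point l b (- 1 / z) = (of_nat b * z - 1) / of_nat l / z"
      using 3 z0 l0 by (simp add: hecke_point_def field_simps)
    ultimately have "hecke_point l b (- 1 / z)
       = (of_int (int b) * w + of_int (- k)) / (of_int (int l) * w + of_int (- int c))" by simp
    also have "h \<dots> = h w"
    proof (rule h)
      show "Im w > 0" unfolding w_def by (rule Im_hecke_point_pos[OF z l0])
      show "int b * (- int c) - (- k) * int l = 1" using k by (simp add: algebra_simps)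
    qed
    finally show ?thesis using 3 by (simp add: w_def \<sigma>_def c_def)
  qed
qed

section \<open>Invariant absolute values and the product over the index-l points\<close>

definition Delta_invariant :: "complex \<Rightarrow> real" where
  "Delta_invariant z = Im z ^ 6 * cmod (Delta z)"

definition E4_Delta_invariant :: "complex \<Rightarrow> real" where
  "E4_Delta_invariant z = Im z ^ 6 * (cmod (E4 z) ^ 3 + cmod (Delta z))"

lemma Delta_invariant_moebius:
  fixes a b c d :: int
  assumes z: "Im z > 0" and det: "a * d - b * c = 1"
  shows "Delta_invariant (moebius a b c d z) = Delta_invariant z"
    and "E4_Delta_invariant (moebius a b c d z) = E4_Delta_invariant z"
proof -
  define v where "v = cmod (of_int c * z + of_int d)"
  have "(c, d) \<noteq> (0, 0)" using det by auto
  hence v: "v \<noteq> 0" using denominator_nonzero[OF z] by (simp add: v_def)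
  have e: "(Im z / v ^ 2) ^ 6 * (v ^ 12 * x) = Im z ^ 6 * x" for x
    using v by (simp add: power_divide flip: power_mult)
  show "Delta_invariant (moebius a b c d z) = Delta_invariant z"
    unfolding Delta_invariant_def modular_transform[OF assms] norm_mult norm_power v_def[symmetric] by (rule e)
  have "(v ^ 4 * x) ^ 3 + v ^ 12 * y = v ^ 12 * (x ^ 3 + y)" for x y
    by (simp add: power_mult_distrib algebra_simps flip: power_mult)
  thus "E4_Delta_invariant (moebius a b c d z) = E4_Delta_invariant z"
    unfolding E4_Delta_invariant_def modular_transform[OF assms] norm_mult norm_power v_def[symmetric] by (simp add: e)
qed

lemma Delta_invariant_pos: "Im z > 0 \<Longrightarrow> Delta_invariant z > 0"
  using Delta_nonzero by (simp add: Delta_invariant_def)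

lemma one_plus_norm_modular_j:
  assumes "Im z > 0"
  shows "1 + cmod (modular_j z) = E4_Delta_invariant z / Delta_invariant z"
proof -
  have "1 + cmod (modular_j z) = (cmod (E4 z) ^ 3 + cmod (Delta z)) / cmod (Delta z)"
    using Delta_nonzero[OF assms] by (simp add: modular_j_eq[OF assms] norm_divide norm_power field_simps)
  thus ?thesis using assms by (simp add: E4_Delta_invariant_def Delta_invariant_def)
qed

text \<open>Equality holds: the product over \<open>b\<close> of \<open>Delta\<close> at the Hecke points is \<open>\<plusminus>Delta\<^sup>l\<^sup>+\<^sup>1\<close>, being
  a form of the same weight without zeros on the upper half-plane and with the same order at the
  cusp. This is what produces the main term \<open>6 l log l\<close> exactly.\<close>

lemma prod_Delta_hecke_ge:
  assumes l: "prime l" and z: "Im z > 0"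
  shows "(\<Prod>b\<le>l. Delta_invariant (hecke_point l b z)) \<ge> real l ^ 6 / real l ^ (6 * l) * Delta_invariant z ^ (l + 1)"
proof -
  have l0: "l > 0" using l prime_gt_0_nat by blast
  \<comment> \<open>The modulus of \<open>f\<close> is invariant, as \<open>nf\<close> makes
    visible, while \<open>f\<close> itself may change by unit factors. At the cusp |f| exceeds 1 by
    arbitrarily little, so the maximum principle gives |f| <= 1, which is the claim.\<close>
  define f where "f = (\<lambda>z. Delta z ^ (l + 1) / (\<Prod>b\<le>l. Delta (hecke_point l b z)))"
  \<comment> \<open>In the product of the sixth powers of the imaginary parts, the points (z + b) /
    l contribute l^(-6 l) and the point l z contributes l^6.\<close>
  define C where "C = real l ^ 6 / real l ^ (6 * l)"
  have C: "C > 0" using l0 by (simp add: C_def)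
  have prodIm: "(\<Prod>b\<le>l. Im (hecke_point l b z) ^ 6) = C * (Im z ^ 6) ^ (l + 1)" for z
  proof -
    have "(\<Prod>b\<le>l. Im (hecke_point l b z) ^ 6) = ((Im z / real l) ^ 6) ^ l * (real l * Im z) ^ 6"
      by (simp add: lessThan_Suc_atMost [symmetric] Im_hecke_point)
    also have "\<dots> = C * (Im z ^ 6) ^ (l + 1)"
      by (simp add: C_def power_mult_distrib power_divide flip: power_mult)
    finally show ?thesis .
  qed
  have nf: "cmod (f z) = C * Delta_invariant z ^ (l + 1) / (\<Prod>b\<le>l. Delta_invariant (hecke_point l b z))"
    if "Im z > 0" for z
  proof -
    have "(\<Prod>b\<le>l. Delta_invariant (hecke_point l b z))
           = C * (Im z ^ 6) ^ (l + 1) * (\<Prod>b\<le>l. cmod (Delta (hecke_point l b z)))"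
      unfolding Delta_invariant_def prod.distrib prodIm ..
    thus ?thesis using that C
      by (simp add: f_def Delta_invariant_def norm_divide norm_power prod_norm power_mult_distrib norm_mult)
  qed
  have "cmod (f z) \<le> 1"
  proof (rule modular_max_modulus[OF _ _ _ _ z])
    have "(\<lambda>z. Delta (hecke_point l b z)) holomorphic_on {z. Im z > 0}" for b
    proof (rule holomorphic_on_compose_gen[OF _ Delta_holomorphic, unfolded o_def])
      show "hecke_point l b holomorphic_on {z. Im z > 0}"
        using l0 by (cases "b < l") (auto simp: hecke_point_def[abs_def] intro!: holomorphic_intros)
    qed (use Im_hecke_point_pos[OF _ l0] in auto)
    thus "f holomorphic_on {z. 0 < Im z}"
      unfolding f_def using Delta_nonzero Im_hecke_point_pos[OF _ l0]
      by (intro holomorphic_intros Delta_holomorphic) auto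
  next
    fix z assume z: "Im z > 0"
    hence z1: "Im (z + 1) > 0" by simp
    have D: "Delta_invariant (w + of_int n) = Delta_invariant w" if "Im w > 0" for w n
      using Delta_invariant_moebius(1)[OF that, of 1 1 n 0] by simp
    obtain \<sigma> where "bij_betw \<sigma> {..l} {..l}"
      "\<And>b. b \<le> l \<Longrightarrow> Delta_invariant (hecke_point l b (z + 1)) = Delta_invariant (hecke_point l (\<sigma> b) z)"
      by (rule hecke_point_T[OF l0 z, of Delta_invariant]) (use D in auto)
    hence "(\<Prod>b\<le>l. Delta_invariant (hecke_point l b (z + 1))) = (\<Prod>b\<le>l. Delta_invariant (hecke_point l b z))"
      by (subst prod.reindex_bij_betw[of \<sigma>, symmetric]) auto
    thus "cmod (f (z + 1)) = cmod (f z)" using D[OF z, of 1] by (simp add: nf[OF z] nf[OF z1])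
  next
    fix z assume z: "Im z > 0"
    have D: "Delta_invariant (- 1 / w) = Delta_invariant w" if "Im w > 0" for w
      using Delta_invariant_moebius(1)[OF that, of 0 0 "-1" 1] by simp
    have z1: "Im (- 1 / z) > 0" using Im_moebius_pos[OF z, of 0 0 "-1" 1] by simp
    obtain \<sigma> where "bij_betw \<sigma> {..l} {..l}"
      "\<And>b. b \<le> l \<Longrightarrow> Delta_invariant (hecke_point l b (- 1 / z)) = Delta_invariant (hecke_point l (\<sigma> b) z)"
      by (rule hecke_point_S[OF l z, of Delta_invariant]) (use Delta_invariant_moebius(1) in auto)
    hence "(\<Prod>b\<le>l. Delta_invariant (hecke_point l b (- 1 / z))) = (\<Prod>b\<le>l. Delta_invariant (hecke_point l b z))"
      by (subst prod.reindex_bij_betw[of \<sigma>, symmetric]) auto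
    thus "cmod (f (- 1 / z)) = cmod (f z)" unfolding nf[OF z] nf[OF z1] D[OF z] by (simp only:)
  next
    fix \<epsilon> :: real assume \<epsilon>: "\<epsilon> > 0"
    \<comment> \<open>\<open>t\<close> will bound |q| at all points involved. Each Delta then
      differs from q in modulus by a factor between 1 - 36 t and 1 + 36 t, and \<open>t\<close> is
      taken so small that the accumulated factor stays below 1 + eps.\<close>
    have "((\<lambda>t::real. ((1 + 36 * t) / (1 - 36 * t)) ^ (l + 1)) \<longlongrightarrow> ((1 + 36 * 0) / (1 - 36 * 0)) ^ (l + 1)) (at_right 0)"
      by (intro tendsto_intros) auto
    hence "eventually (\<lambda>t::real. ((1 + 36 * t) / (1 - 36 * t)) ^ (l + 1) < 1 + \<epsilon>) (at_right 0)"
      by (rule order_tendstoD) (use \<epsilon> in simp)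
    moreover have "eventually (\<lambda>t::real. t \<in> {0<..<1 / 229}) (at_right 0)"
      by (rule eventually_at_right_real) simp
    ultimately have "eventually (\<lambda>t::real. ((1 + 36 * t) / (1 - 36 * t)) ^ (l + 1) < 1 + \<epsilon> \<and> t \<in> {0<..<1 / 229}) (at_right 0)"
      by (rule eventually_conj)
    then obtain t :: real where t: "((1 + 36 * t) / (1 - 36 * t)) ^ (l + 1) < 1 + \<epsilon>" "0 < t" "t < 1 / 229"
      using eventually_happens'[OF trivial_limit_at_right_real] by auto
    obtain Y where Y: "Y > 0" "\<And>z. Im z \<ge> Y \<Longrightarrow> norm (nome z) \<le> t" using nome_cusp[OF t(2)] by blast
    have D: "cmod (Delta w) \<le> norm (nome w) * (1 + 36 * t)" "cmod (Delta w) \<ge> norm (nome w) * (1 - 36 * t)"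
      if "Im w \<ge> Y" for w
    proof -
      have q: "norm (nome w) \<le> t" using Y(2)[OF that] .
      have "cmod (Delta w - nome w) \<le> 36 * (norm (nome w) * norm (nome w))"
        using Delta_q_bound[of "nome w"] q t by (simp add: Delta_def power2_eq_square)
      also have "\<dots> \<le> 36 * (norm (nome w) * t)" using q by (intro mult_left_mono) auto
      finally have "cmod (Delta w - nome w) \<le> 36 * (norm (nome w) * t)" .
      thus "cmod (Delta w) \<le> norm (nome w) * (1 + 36 * t)" "cmod (Delta w) \<ge> norm (nome w) * (1 - 36 * t)"
        using norm_triangle_ineq2[of "Delta w" "nome w"] norm_triangle_ineq2[of "nome w" "Delta w"]
        by (simp_all add: algebra_simps norm_minus_commute)
    qed
    have "cmod (f z) \<le> 1 + \<epsilon>" if "Im z \<ge> Y * real l" for z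
    proof -
      have zY: "Im z \<ge> Y" and wY: "Im (hecke_point l b z) \<ge> Y" for b
        using hecke_point_high[OF l0 Y(1) that] by auto
      define Q where "Q = norm (nome z) ^ (l + 1)"
      have Q: "(\<Prod>b\<le>l. norm (nome (hecke_point l b z))) = Q"
        unfolding Q_def by (rule prod_norm_nome_hecke_point[OF l0])
      have Qpos: "Q > 0" by (simp add: Q_def nome_def)
      have t1: "1 - 36 * t > 0" using t by simp
      have "cmod (f z) = cmod (Delta z) ^ (l + 1) / (\<Prod>b\<le>l. cmod (Delta (hecke_point l b z)))"
        by (simp add: f_def norm_divide norm_power prod_norm norm_mult)
      also have "\<dots> \<le> (norm (nome z) * (1 + 36 * t)) ^ (l + 1) / (\<Prod>b\<le>l. norm (nome (hecke_point l b z)) * (1 - 36 * t))"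
      proof (rule frac_le)
        show "cmod (Delta z) ^ (l + 1) \<le> (norm (nome z) * (1 + 36 * t)) ^ (l + 1)"
          using D(1)[OF zY] by (intro power_mono) auto
        show "(\<Prod>b\<le>l. norm (nome (hecke_point l b z)) * (1 - 36 * t)) \<le> (\<Prod>b\<le>l. cmod (Delta (hecke_point l b z)))"
          using D(2)[OF wY] t1 by (intro prod_mono) auto
        show "0 < (\<Prod>b\<le>l. norm (nome (hecke_point l b z)) * (1 - 36 * t))"
          using t1 by (intro prod_pos) (auto simp: nome_def)
      qed (use t in auto)
      also have "\<dots> = (Q * (1 + 36 * t) ^ (l + 1)) / (Q * (1 - 36 * t) ^ (l + 1))"
        by (simp only: power_mult_distrib prod.distrib Q prod_constant card_atMost Q_def) simp
      also have "\<dots> = ((1 + 36 * t) / (1 - 36 * t)) ^ (l + 1)" using Qpos by (simp add: power_divide)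
      finally show ?thesis using t(1) by simp
    qed
    thus "\<exists>Y. \<forall>z. Im z > 0 \<and> Im z \<ge> Y \<longrightarrow> cmod (f z) \<le> 1 + \<epsilon>" by auto
  qed
  moreover have "(\<Prod>b\<le>l. Delta_invariant (hecke_point l b z)) > 0"
    using Delta_invariant_pos Im_hecke_point_pos[OF z l0] by (intro prod_pos) auto
  ultimately show ?thesis unfolding nf[OF z] C_def [symmetric] by (subst (asm) pos_divide_le_eq) auto
qed

section \<open>Modular functions are polynomials in the modular invariant\<close>

lemma nome_eq_imp_shift:
  assumes "nome z = nome w"
  obtains n :: int where "z = w + of_int n"
proof -
  obtain n :: int where "2 * of_real pi * \<i> * z = 2 * of_real pi * \<i> * w + (of_int (2 * n) * pi) * \<i>"
    using assms unfolding nome_def exp_eq by blast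
  hence "2 * of_real pi * \<i> * z = 2 * of_real pi * \<i> * (w + of_int n)" by (simp add: algebra_simps)
  hence "z = w + of_int n" by (simp del: distrib_left_numeral)
  thus ?thesis by (rule that)
qed

text \<open>\<open>f\<close> descends to a function \<open>g\<close> of q on a punctured disc.
  Boundedness makes 0 a removable singularity, and differentiability of the extension there gives
  the first-order estimate.\<close>

lemma periodic_cusp_expansion:
  assumes hol: "f holomorphic_on {z. Im z > 0}"
    and T: "\<And>z. Im z > 0 \<Longrightarrow> f (z + 1) = f z"
    and Y: "Y > 0" and bound: "\<And>z. Im z \<ge> Y \<Longrightarrow> cmod (f z) \<le> C"
  obtains c K Y' where "Y' \<ge> Y" "K \<ge> 0" "\<And>z. Im z \<ge> Y' \<Longrightarrow> cmod (f z - c) \<le> K * norm (nome z)"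
proof -
  define \<phi> where "\<phi> = (\<lambda>w. Ln w / (2 * of_real pi * \<i>))"
  define g where "g = (\<lambda>w. f (\<phi> w))"
  define R where "R = exp (- 2 * pi * Y)"
  have R: "0 < R" "R < 1" using Y by (auto simp: R_def)
  have nome\<phi>: "nome (\<phi> w) = w" if "w \<noteq> 0" for w
    using that by (simp add: nome_def \<phi>_def)
  have Im\<phi>: "Im (\<phi> w) \<ge> Y" if "w \<noteq> 0" "norm w \<le> R" for w
  proof -
    have "exp (- 2 * pi * Im (\<phi> w)) \<le> exp (- 2 * pi * Y)"
      using nome\<phi>[OF that(1)] norm_nome[of "\<phi> w"] that(2) by (simp add: R_def)
    thus ?thesis by simp
  qed
  have gnome: "g (nome z) = f z" if "Im z > 0" for z
  proof -
    have "nome (\<phi> (nome z)) = nome z" by (rule nome\<phi>) (simp add: nome_def)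
    then obtain n where n: "\<phi> (nome z) = z + of_int n" using nome_eq_imp_shift by blast
    show ?thesis unfolding g_def n using periodic_of_int[of f, OF T that] .
  qed
  have ghol: "g holomorphic_on (ball (0::complex) R - {0})"
  proof (subst holomorphic_on_open)
    show "\<forall>w0\<in>ball (0::complex) R - {0}. \<exists>f'. (g has_field_derivative f') (at w0)"
    proof
      fix w0 :: complex assume w0: "w0 \<in> ball 0 R - {0}"
      \<comment> \<open>A branch of the logarithm that is holomorphic near \<open>w0\<close>. The
        branch in \<open>\<phi>\<close> jumps on the negative axis, but periodicity of
        \<open>f\<close> gives \<open>g\<close> the same value for either branch.\<close>
      define \<psi> where "\<psi> = (\<lambda>w. (Ln (w / w0) + Ln w0) / (2 * of_real pi * \<i>))"
      define A where "A = {w. w / w0 \<notin> \<real>\<^sub>\<le>\<^sub>0} \<inter> (ball 0 R - {0})"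
      have "open {w. w / w0 \<notin> \<real>\<^sub>\<le>\<^sub>0}"
      proof -
        have "{w. w / w0 \<notin> \<real>\<^sub>\<le>\<^sub>0} = (\<lambda>w. w / w0) -` (- \<real>\<^sub>\<le>\<^sub>0)" by auto
        thus ?thesis using w0 by (auto intro!: open_vimage continuous_intros closed_nonpos_Reals_complex)
      qed
      hence A: "open A" unfolding A_def by (intro open_Int) auto
      have w0A: "w0 \<in> A" using w0 by (simp add: A_def)
      have nome\<psi>: "nome (\<psi> w) = w" if "w \<in> A" for w
        using that w0 by (simp add: nome_def \<psi>_def exp_add A_def)
      have Im\<psi>: "Im (\<psi> w) > 0" if "w \<in> A" for w
      proof -
        have "norm w < 1" using that R by (auto simp: A_def)
        hence "exp (- 2 * pi * Im (\<psi> w)) < 1"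
          by (simp only: nome\<psi>[OF that] flip: norm_nome)
        thus ?thesis by (simp add: zero_less_mult_iff)
      qed
      have "\<psi> holomorphic_on A" unfolding \<psi>_def using w0 by (intro holomorphic_intros) (auto simp: A_def)
      hence "f \<circ> \<psi> holomorphic_on A"
        by (rule holomorphic_on_compose_gen[OF _ hol]) (use Im\<psi> in auto)
      hence "((f \<circ> \<psi>) has_field_derivative deriv (f \<circ> \<psi>) w0) (at w0)" using A w0A by (intro holomorphic_derivI) auto
      moreover have "(f \<circ> \<psi>) w = g w" if "w \<in> A" for w
        using gnome[OF Im\<psi>[OF that]] nome\<psi>[OF that] by simp
      ultimately show "\<exists>f'. (g has_field_derivative f') (at w0)"
        using has_field_derivative_transform_within_open[OF _ A w0A] by blast
    qed
  qed auto
  have "\<exists>B. eventually (\<lambda>w. norm (g w) \<le> B) (at 0)"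
  proof (intro exI[of _ C])
    have "eventually (\<lambda>w. w \<in> ball 0 R - {0}) (at (0::complex))"
      using R by (intro eventually_at_in_open) auto
    thus "eventually (\<lambda>w. norm (g w) \<le> C) (at 0)"
      by eventually_elim (use Im\<phi> bound in \<open>auto simp: g_def\<close>)
  qed
  hence "\<exists>G. G holomorphic_on ball 0 R \<and> (\<forall>w\<in>ball 0 R - {0}. G w = g w)"
    by (subst holomorphic_on_extend_bounded[OF ghol]) (use R in \<open>auto simp: interior_open\<close>)
  then obtain G where G: "G holomorphic_on ball 0 R" "\<And>w. w \<in> ball 0 R - {0} \<Longrightarrow> G w = g w" by blast
  have "(G has_field_derivative deriv G 0) (at 0)" using G(1) R by (intro holomorphic_derivI) auto
  hence "((\<lambda>w. (G w - G 0) / w) \<longlongrightarrow> deriv G 0) (at 0)" by (simp add: has_field_derivative_iff)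
  hence "((\<lambda>w. norm ((G w - G 0) / w)) \<longlongrightarrow> norm (deriv G 0)) (at 0)" by (rule tendsto_norm)
  hence "eventually (\<lambda>w. norm ((G w - G 0) / w) < norm (deriv G 0) + 1) (at 0)"
    by (rule order_tendstoD) simp
  then obtain r where r: "r > 0" "\<And>w. w \<noteq> 0 \<Longrightarrow> norm w < r \<Longrightarrow> norm ((G w - G 0) / w) < norm (deriv G 0) + 1"
    unfolding eventually_at by (auto simp: dist_norm)
  obtain Y' where Y': "Y' > 0" "\<And>z. Im z \<ge> Y' \<Longrightarrow> norm (nome z) \<le> min r R / 2"
    using nome_cusp[of "min r R / 2"] r R by auto
  show ?thesis
  proof (rule that[of "max Y Y'" "norm (deriv G 0) + 1" "G 0"])
    fix z assume z: "Im z \<ge> max Y Y'"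
    have q: "nome z \<noteq> 0" "norm (nome z) < r" "norm (nome z) < R" using Y'(2)[of z] z r R by (auto simp: nome_def)
    have "G (nome z) = f z" using G(2)[of "nome z"] gnome[of z] q z Y by simp
    moreover have "norm (G (nome z) - G 0) \<le> (norm (deriv G 0) + 1) * norm (nome z)"
      using r(2)[OF q(1,2)] q(1) by (simp add: norm_divide pos_divide_less_eq)
    ultimately show "cmod (f z - G 0) \<le> (norm (deriv G 0) + 1) * norm (nome z)" by simp
  qed auto
qed

text \<open>From u^(n+1) - 1 = u (u^n - 1) + (u - 1). Applied to u = j q, it shows that (j q)^n - 1
  is O(q) at the cusp.\<close>

lemma norm_power_minus_1_le:
  fixes u :: complex
  assumes "norm u \<le> 2"
  shows "norm (u ^ n - 1) \<le> (2 ^ n - 1) * norm (u - 1)"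
proof (induction n)
  case (Suc n)
  have "u ^ Suc n - 1 = u * (u ^ n - 1) + (u - 1)" by (simp add: algebra_simps)
  also have "norm \<dots> \<le> 2 * (norm (u ^ n - 1)) + norm (u - 1)"
    using assms by (intro norm_triangle_mono) (auto simp: norm_mult intro: mult_right_mono)
  also have "\<dots> \<le> 2 * ((2 ^ n - 1) * norm (u - 1)) + norm (u - 1)" using Suc.IH by simp
  also have "\<dots> = (2 ^ Suc n - 1) * norm (u - 1)" by (simp add: algebra_simps)
  finally show ?case .
qed auto

lemma modular_function_polynomial:
  assumes hol: "f holomorphic_on {z. Im z > 0}"
    and T: "\<And>z. Im z > 0 \<Longrightarrow> f (z + 1) = f z" and S: "\<And>z. Im z > 0 \<Longrightarrow> f (- 1 / z) = f z"
    and bound: "Y > 0" "\<And>z. Im z \<ge> Y \<Longrightarrow> cmod (f z) * norm (nome z) ^ N \<le> C"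
  shows "\<exists>p. \<forall>z. Im z > 0 \<longrightarrow> f z = poly p (modular_j z)"
  using assms
proof (induction N arbitrary: f Y C)
  case (0 f Y C)
  have fC: "cmod (f z) \<le> C" if "Im z \<ge> Y" for z using 0 that by simp
  obtain c K Y' where cK: "Y' \<ge> Y" "K \<ge> 0" "\<And>z. Im z \<ge> Y' \<Longrightarrow> cmod (f z - c) \<le> K * norm (nome z)"
    by (rule periodic_cusp_expansion[OF 0(1,2,4) fC]) (assumption, assumption, blast intro: that)
  have "cmod (f z - c) \<le> 0" if "Im z > 0" for z
  proof (rule modular_max_modulus[OF _ _ _ _ that])
    fix \<epsilon> :: real assume \<epsilon>: "\<epsilon> > 0"
    obtain Y'' where Y'': "\<And>z. Im z \<ge> Y'' \<Longrightarrow> norm (nome z) \<le> \<epsilon> / (K + 1)"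
      using nome_cusp[of "\<epsilon> / (K + 1)"] \<epsilon> cK(2) by auto
    have "cmod (f z - c) \<le> \<epsilon>" if "Im z \<ge> max Y' Y''" for z
    proof -
      have "cmod (f z - c) \<le> K * norm (nome z)" using cK(3) that by simp
      also have "\<dots> \<le> K * (\<epsilon> / (K + 1))" using Y''[of z] that cK(2) by (intro mult_left_mono) auto
      also have "\<dots> \<le> (K + 1) * (\<epsilon> / (K + 1))" using \<epsilon> cK(2) by (intro mult_right_mono) auto
      also have "\<dots> = \<epsilon>" using cK(2) by simp
      finally show ?thesis .
    qed
    thus "\<exists>Y. \<forall>z. Im z > 0 \<and> Im z \<ge> Y \<longrightarrow> cmod (f z - c) \<le> 0 + \<epsilon>"
      by (intro exI[of _ "max Y' Y''"]) auto
  qed (use 0 in \<open>auto intro!: holomorphic_intros\<close>)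
  hence "\<forall>z. Im z > 0 \<longrightarrow> f z = poly [:c:] (modular_j z)" by simp
  thus ?case by blast
next
  case (Suc N f Y C)
  have nT: "nome (z + 1) = nome z" for z by (simp add: nome_def distrib_left exp_add)
  have hol1: "(\<lambda>z. f z * nome z ^ Suc N) holomorphic_on {z. Im z > 0}"
    by (intro holomorphic_intros nome_holomorphic Suc.prems)
  obtain c K Y' where cK: "Y' \<ge> Y" "K \<ge> 0"
      "\<And>z. Im z \<ge> Y' \<Longrightarrow> cmod (f z * nome z ^ Suc N - c) \<le> K * norm (nome z)"
    using periodic_cusp_expansion[OF hol1 _ Suc.prems(4), of C] Suc.prems(2,5) nT
    by (metis norm_mult norm_power)
  obtain Y2 where Y2: "Y2 > 0" "\<And>z. Im z \<ge> Y2 \<Longrightarrow> norm (nome z) \<le> 1 / 2500"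
    using nome_cusp[of "1 / 2500"] by auto
  \<comment> \<open>\<open>c\<close> is the limit of f q^(N+1) at the cusp. Both f q^(N+1) - c and
    (j q)^(N+1) - 1 are O(q), so subtracting c j^(N+1) lowers the pole order by one.\<close>
  define g where "g = (\<lambda>z. f z - c * modular_j z ^ Suc N)"
  have "\<exists>p. \<forall>z. Im z > 0 \<longrightarrow> g z = poly p (modular_j z)"
  proof (rule Suc.IH)
    show "g holomorphic_on {z. Im z > 0}"
      unfolding g_def by (intro holomorphic_intros Suc.prems modular_j_holomorphic)
    show "max Y' Y2 > 0" using Y2 by simp
    fix z assume z: "Im z \<ge> max Y' Y2"
    hence Imz: "Im z > 0" using Y2 by simp
    define q where "q = nome z"
    have q: "norm q > 0" "norm q \<le> 1 / 2500" using Y2(2)[of z] z by (auto simp: q_def nome_def)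
    have u1: "cmod (modular_j z * q - 1) \<le> 2500 * norm q"
      using modular_j_cusp[OF Imz] q by (simp add: q_def)
    hence "norm (modular_j z * q) \<le> 2"
      using norm_triangle_ineq2[of "modular_j z * q" 1] q by simp
    hence "norm ((modular_j z * q) ^ Suc N - 1) \<le> (2 ^ Suc N - 1) * norm (modular_j z * q - 1)"
      by (rule norm_power_minus_1_le)
    also have "\<dots> \<le> 2 ^ Suc N * (2500 * norm q)" using u1 by (intro mult_mono) auto
    finally have u: "norm ((modular_j z * q) ^ Suc N - 1) \<le> 2 ^ Suc N * (2500 * norm q)" .
    have "g z * q ^ Suc N = (f z * q ^ Suc N - c) + - c * ((modular_j z * q) ^ Suc N - 1)"
      by (simp add: g_def power_mult_distrib algebra_simps)
    also have "cmod \<dots> \<le> K * norm q + cmod c * (2 ^ Suc N * (2500 * norm q))"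
      using cK(3)[of z] z u by (intro norm_triangle_mono) (auto simp: norm_mult q_def intro: mult_left_mono)
    also have "\<dots> = (K + cmod c * 2 ^ Suc N * 2500) * norm q" by (simp add: algebra_simps)
    finally have "(cmod (g z) * norm q ^ N) * norm q \<le> (K + cmod c * 2 ^ Suc N * 2500) * norm q"
      by (simp add: norm_mult norm_power mult_ac)
    thus "cmod (g z) * norm (nome z) ^ N \<le> K + cmod c * 2 ^ Suc N * 2500"
      using q(1) by (simp add: q_def)
  qed (use Suc.prems modular_j_S modular_j_T[of _ 1] in \<open>auto simp: g_def\<close>)
  then obtain p where "\<And>z. Im z > 0 \<Longrightarrow> g z = poly p (modular_j z)" by blast
  hence "\<forall>z. Im z > 0 \<longrightarrow> f z = poly (p + monom c (Suc N)) (modular_j z)"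
    by (auto simp: g_def poly_monom algebra_simps)
  thus ?case by blast
qed

section \<open>The modular polynomial\<close>

definition hecke_poly :: "nat \<Rightarrow> complex \<Rightarrow> complex poly" where
  "hecke_poly l z = (\<Prod>b\<le>l. [:- modular_j (hecke_point l b z), 1:])"

text \<open>The right side is the value at 1 of the product of the X + |a_b|, whose coefficients
  dominate those on the left.\<close>

lemma norm_coeff_prod_linear_le:
  fixes a :: "'i \<Rightarrow> complex"
  assumes "finite A"
  shows "norm (coeff (\<Prod>b\<in>A. [:- a b, 1:]) i) \<le> (\<Prod>b\<in>A. 1 + norm (a b))"
  using assms
proof (induction A arbitrary: i rule: finite_induct)
  case empty
  thus ?case by (simp add: coeff_pCons split: nat.splits)
next
  case (insert x A)
  define P where "P = (\<Prod>b\<in>A. [:- a b, 1:])"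
  have "coeff ([:- a x, 1:] * P) i = - a x * coeff P i + (case i of 0 \<Rightarrow> 0 | Suc k \<Rightarrow> coeff P k)"
    by (simp add: coeff_pCons split: nat.splits)
  also have "norm \<dots> \<le> norm (a x) * (\<Prod>b\<in>A. 1 + norm (a b)) + (\<Prod>b\<in>A. 1 + norm (a b))"
    using insert.IH by (intro norm_triangle_mono)
      (auto simp: norm_mult P_def intro!: mult_left_mono prod_nonneg split: nat.splits)
  also have "\<dots> = (\<Prod>b\<in>insert x A. 1 + norm (a b))" using insert by (simp add: algebra_simps)
  finally show ?case using insert by (simp add: P_def)
qed

lemma coeff_prod_linear_holomorphic:
  assumes "finite A" "\<And>b. b \<in> A \<Longrightarrow> h b holomorphic_on U"
  shows "(\<lambda>z. coeff (\<Prod>b\<in>A. [:- h b z, 1:]) i) holomorphic_on U"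
  using assms
proof (induction A arbitrary: i rule: finite_induct)
  case (insert x A)
  have "(\<lambda>z. coeff (\<Prod>b\<in>insert x A. [:- h b z, 1:]) i) =
     (\<lambda>z. - h x z * coeff (\<Prod>b\<in>A. [:- h b z, 1:]) i + (case i of 0 \<Rightarrow> 0 | Suc k \<Rightarrow> coeff (\<Prod>b\<in>A. [:- h b z, 1:]) k))"
    using insert.hyps by (intro ext) (simp add: coeff_pCons split: nat.splits)
  moreover have "(\<lambda>z. case i of 0 \<Rightarrow> 0 | Suc k \<Rightarrow> coeff (\<Prod>b\<in>A. [:- h b z, 1:]) k) holomorphic_on U"
    using insert by (cases i) auto
  ultimately show ?case using insert by (auto intro!: holomorphic_intros)
qed auto

lemma hecke_point_holomorphic: "l > 0 \<Longrightarrow> hecke_point l b holomorphic_on A"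
  by (cases "b < l") (auto simp: hecke_point_def[abs_def] intro!: holomorphic_intros)

lemma modular_j_hecke_holomorphic:
  assumes "l > 0"
  shows "(\<lambda>z. modular_j (hecke_point l b z)) holomorphic_on {z. Im z > 0}"
  by (rule holomorphic_on_compose_gen[OF hecke_point_holomorphic modular_j_holomorphic, unfolded o_def])
     (use Im_hecke_point_pos assms in auto)

lemma hecke_poly_invariant:
  assumes l: "prime l" and z: "Im z > 0"
  shows "hecke_poly l (z + 1) = hecke_poly l z" "hecke_poly l (- 1 / z) = hecke_poly l z"
proof -
  have l0: "l > 0" using l prime_gt_0_nat by blast
  obtain \<sigma> where "bij_betw \<sigma> {..l} {..l}"
    "\<And>b. b \<le> l \<Longrightarrow> modular_j (hecke_point l b (z + 1)) = modular_j (hecke_point l (\<sigma> b) z)"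
    by (rule hecke_point_T[OF l0 z, of modular_j]) (use modular_j_T in auto)
  thus "hecke_poly l (z + 1) = hecke_poly l z"
    unfolding hecke_poly_def by (subst prod.reindex_bij_betw[of \<sigma>, symmetric]) auto
  obtain \<sigma> where "bij_betw \<sigma> {..l} {..l}"
    "\<And>b. b \<le> l \<Longrightarrow> modular_j (hecke_point l b (- 1 / z)) = modular_j (hecke_point l (\<sigma> b) z)"
    by (rule hecke_point_S[OF l z, of modular_j]) (use modular_j_moebius in auto)
  thus "hecke_poly l (- 1 / z) = hecke_poly l z"
    unfolding hecke_poly_def by (subst prod.reindex_bij_betw[of \<sigma>, symmetric]) auto
qed

text \<open>Each factor 1 + |j(w)| is at most 3 / |q(w)| high up in the half-plane, and the |q(w)|
  multiply to |q|^(l+1). So each coefficient has a pole of order at most l + 1 at the cusp.\<close>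

lemma hecke_poly_coeff_polynomial:
  assumes l: "prime l"
  shows "\<exists>p. \<forall>z. Im z > 0 \<longrightarrow> coeff (hecke_poly l z) i = poly p (modular_j z)"
proof -
  have l0: "l > 0" using l prime_gt_0_nat by blast
  obtain Y where Y: "Y > 0" "\<And>z. Im z \<ge> Y \<Longrightarrow> norm (nome z) \<le> 1 / 2500"
    using nome_cusp[of "1 / 2500"] by auto
  show ?thesis
  proof (rule modular_function_polynomial)
    show "(\<lambda>z. coeff (hecke_poly l z) i) holomorphic_on {z. Im z > 0}"
      unfolding hecke_poly_def by (intro coeff_prod_linear_holomorphic modular_j_hecke_holomorphic l0) auto
    show "Y * real l > 0" using Y l0 by simp
    fix z assume z: "Im z \<ge> Y * real l"
    have wY: "Im (hecke_point l b z) \<ge> Y" for b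
      using hecke_point_high[OF l0 Y(1) z] by auto
    have b: "(1 + cmod (modular_j (hecke_point l b z))) * norm (nome (hecke_point l b z)) \<le> 3" for b
    proof -
      define w where "w = hecke_point l b z"
      have w: "Im w > 0" "norm (nome w) \<le> 1 / 2500" using wY[of b] Y by (auto simp: w_def)
      have "cmod (modular_j w * nome w - 1) \<le> 1" using modular_j_cusp[OF w(1)] w(2) by simp
      hence "cmod (modular_j w * nome w) \<le> 2" using norm_triangle_ineq2[of "modular_j w * nome w" 1] by simp
      thus ?thesis using w(2) by (simp add: w_def norm_mult algebra_simps)
    qed
    have Q: "(\<Prod>b\<le>l. norm (nome (hecke_point l b z))) = norm (nome z) ^ (l + 1)"
      by (rule prod_norm_nome_hecke_point[OF l0])
    have "cmod (coeff (hecke_poly l z) i) * norm (nome z) ^ (l + 1)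
        \<le> (\<Prod>b\<le>l. 1 + cmod (modular_j (hecke_point l b z))) * norm (nome z) ^ (l + 1)"
      unfolding hecke_poly_def by (intro mult_right_mono norm_coeff_prod_linear_le) auto
    also have "\<dots> = (\<Prod>b\<le>l. (1 + cmod (modular_j (hecke_point l b z))) * norm (nome (hecke_point l b z)))"
      unfolding prod.distrib Q ..
    also have "\<dots> \<le> (\<Prod>b\<le>l. 3)" using b by (intro prod_mono) auto
    finally show "cmod (coeff (hecke_poly l z) i) * norm (nome z) ^ (l + 1) \<le> (\<Prod>b\<le>l. 3)" .
  qed (use hecke_poly_invariant[OF l] in auto)
qed

lemma degree_hecke_poly: "degree (hecke_poly l z) = l + 1" "lead_coeff (hecke_poly l z) = 1"
proof -
  show "degree (hecke_poly l z) = l + 1"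
    unfolding hecke_poly_def by (subst degree_prod_eq_sum_degree) auto
  show "lead_coeff (hecke_poly l z) = 1" by (simp add: hecke_poly_def lead_coeff_prod)
qed

lemma poly_eq_if_eq_at_modular_j:
  assumes "\<And>z. Im z > 0 \<Longrightarrow> poly p (modular_j z) = poly p' (modular_j z)"
  shows "p = p'"
proof -
  have "poly p y = poly p' y" for y
    using modular_j_surj[of y] assms by (auto simp: fundamental_domain_def)
  thus ?thesis by (metis poly_eq_poly_eq_iff ext)
qed

lemma ex_modular_polynomial:
  assumes l: "prime l"
  obtains P where "degree P = l + 1" "lead_coeff P = 1"
    "\<And>z i. Im z > 0 \<Longrightarrow> poly (coeff P i) (modular_j z) = coeff (hecke_poly l z) i"
proof -
  obtain c where c: "\<And>i z. Im z > 0 \<Longrightarrow> coeff (hecke_poly l z) i = poly (c i) (modular_j z)"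
    using hecke_poly_coeff_polynomial[OF l] by metis
  define P where "P = (\<Sum>i\<le>l+1. monom (c i) i)"
  have P: "coeff P i = (if i \<le> l + 1 then c i else 0)" for i
    by (simp add: P_def coeff_sum)
  \<comment> \<open>As j is onto, a polynomial is determined by its values at j; the top coefficient
    is therefore the constant polynomial 1.\<close>
  have "c (l + 1) = 1"
    by (rule poly_eq_if_eq_at_modular_j) (use degree_hecke_poly c[symmetric] in simp)
  moreover from this have "degree P = l + 1"
    by (intro antisym degree_le le_degree) (auto simp: P)
  moreover have "poly (coeff P i) (modular_j z) = coeff (hecke_poly l z) i" if "Im z > 0" for z i
    using c[OF that, of i, symmetric] degree_hecke_poly(1)[of l z] by (cases "i \<le> l + 1") (auto simp: P coeff_eq_0)
  ultimately show ?thesis using that[of P] P by simp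
qed

section \<open>Minimality over the field of rational functions in j\<close>

lemma quot_of_fract_to_fract: "quot_of_fract (to_fract p) = (p, 1 :: complex poly)"
  using quot_of_fract_quot_to_fract'[of "(p, 1)"]
  by (simp add: quot_to_fract_def normalized_fracts_def to_fract_def)

lemma ratfun_at_j_to_fract: "ratfun_at_j (to_fract p) z = poly p (modular_j z)"
  by (simp add: ratfun_at_j_def quot_of_fract_to_fract)

lemma degree_map_poly_to_fract: "degree (map_poly to_fract P) = degree P"
  for P :: "complex poly poly"
  by (rule degree_map_poly) simp

lemma poly_poly_const: "poly (poly P [:x:]) y = (\<Sum>i\<le>degree P. poly (coeff P i) y * x ^ i)"
  for P :: "complex poly poly"
  by (simp add: poly_altdef[of P] poly_sum poly_power)

lemma annihilates_over_Cj_map_poly: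
  "annihilates_over_Cj f (map_poly to_fract P) \<longleftrightarrow>
     (\<forall>\<^sub>\<approx>z\<in>upper_half_plane. poly (poly P [:f z:]) (modular_j z) = 0)"
  unfolding annihilates_over_Cj_def poly_poly_const degree_map_poly_to_fract
  by (simp add: coeff_map_poly ratfun_at_j_to_fract)

text \<open>Denominators are cleared by E^2 instead of E. The spare factor makes the new relation
  hold trivially at zeros of E as well, where \<open>ratfun_at_j\<close> may take its junk
  value.\<close>

lemma annihilates_over_Cj_polynomial:
  assumes R: "R \<noteq> 0" "annihilates_over_Cj f R"
  obtains S :: "complex poly poly" where "S \<noteq> 0" "degree S = degree R"
    "\<forall>\<^sub>\<approx>z\<in>upper_half_plane. poly (poly S [:f z:]) (modular_j z) = 0"
proof -
  define n where "n = degree R"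
  define num where "num = (\<lambda>i. fst (quot_of_fract (coeff R i)))"
  define den where "den = (\<lambda>i. snd (quot_of_fract (coeff R i)))"
  define E where "E = (\<Prod>i\<le>n. den i)"
  define E' where "E' = (\<lambda>i. \<Prod>k\<in>{..n}-{i}. den k)"
  have den: "den i \<noteq> 0" for i by (simp add: den_def)
  have E0: "E \<noteq> 0" "E' i \<noteq> 0" for i using den by (auto simp: E_def E'_def)
  have EE': "E = den i * E' i" if "i \<le> n" for i
    unfolding E_def E'_def by (subst prod.remove[of _ i]) (use that in auto)
  define S where "S = (\<Sum>i\<le>n. monom (E * E' i * num i) i)"
  have S: "coeff S i = (if i \<le> n then E * E' i * num i else 0)" for i
    by (simp add: S_def coeff_sum)
  have "num n \<noteq> 0" using R(1) by (simp add: num_def n_def)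
  hence Sn: "coeff S n \<noteq> 0" using E0 by (simp add: S)
  have deg: "degree S = n"
    using Sn by (intro antisym degree_le le_degree) (auto simp: S)
  have ev: "poly (poly S [:f z:]) (modular_j z) = 0"
    if z: "(\<Sum>i\<le>degree R. ratfun_at_j (coeff R i) z * f z ^ i) = 0" for z
  proof (cases "poly E (modular_j z) = 0")
    case True
    thus ?thesis unfolding poly_poly_const deg by (simp add: S)
  next
    case False
    have "poly (coeff S i) (modular_j z) = poly E (modular_j z) ^ 2 * ratfun_at_j (coeff R i) z" if "i \<le> n" for i
    proof -
      have E: "poly E (modular_j z) = poly (den i) (modular_j z) * poly (E' i) (modular_j z)"
        using EE'[OF that] by simp
      have "poly (den i) (modular_j z) \<noteq> 0" using E False by auto
      moreover have "ratfun_at_j (coeff R i) z = poly (num i) (modular_j z) / poly (den i) (modular_j z)"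
        by (simp add: ratfun_at_j_def num_def den_def)
      ultimately show ?thesis using that E by (simp add: S power2_eq_square)
    qed
    hence "poly (poly S [:f z:]) (modular_j z) = (\<Sum>i\<le>n. poly E (modular_j z) ^ 2 * (ratfun_at_j (coeff R i) z * f z ^ i))"
      unfolding poly_poly_const deg by (intro sum.cong) auto
    also have "\<dots> = 0" using z by (simp add: n_def flip: sum_distrib_left)
    finally show ?thesis .
  qed
  show ?thesis
  proof (rule that[of S])
    show "S \<noteq> 0" using Sn by auto
    show "degree S = degree R" using deg n_def by simp
    show "\<forall>\<^sub>\<approx>z\<in>upper_half_plane. poly (poly S [:f z:]) (modular_j z) = 0"
      using R(2) unfolding annihilates_over_Cj_def by eventually_elim (rule ev)
  qed
qed

text \<open>Annihilation is demanded outside a discrete set only, while conjugate points must be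
  inserted into the relation at will; continuity closes the gap.\<close>

lemma cosparse_zero_imp_zero:
  fixes U :: "complex \<Rightarrow> complex"
  assumes A: "open A" and cont: "continuous_on A U" and ev: "\<forall>\<^sub>\<approx>z\<in>A. U z = 0" and z: "z \<in> A"
  shows "U z = 0"
proof -
  have "eventually (\<lambda>z. U z = 0) (at z)" using ev A z by (simp add: eventually_cosparse_open_eq)
  hence "(U \<longlongrightarrow> 0) (at z)" by (rule tendsto_eventually)
  moreover have "(U \<longlongrightarrow> U z) (at z)" using cont A z by (simp add: continuous_on_eq_continuous_at isCont_def)
  ultimately show ?thesis using LIM_unique by blast
qed

lemma modular_j_nome_tendsto:
  fixes w :: "real \<Rightarrow> complex"
  assumes "filterlim (\<lambda>y. Im (w y)) at_top at_top"
  shows "((\<lambda>y. modular_j (w y) * nome (w y)) \<longlongrightarrow> 1) at_top"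
proof (rule tendstoI)
  fix e :: real assume e: "e > 0"
  obtain Y where Y: "Y > 0" "\<And>z. Im z \<ge> Y \<Longrightarrow> norm (nome z) \<le> min (1 / 229) (e / 5000)"
    using nome_cusp[of "min (1 / 229) (e / 5000)"] e by auto
  have "eventually (\<lambda>y. Im (w y) \<ge> Y) at_top" using assms by (simp add: filterlim_at_top)
  thus "eventually (\<lambda>y. dist (modular_j (w y) * nome (w y)) 1 < e) at_top"
  proof eventually_elim
    case (elim y)
    have "cmod (modular_j (w y) * nome (w y) - 1) \<le> 2500 * norm (nome (w y))"
      using Y(1) Y(2)[OF elim] elim by (intro modular_j_cusp) auto
    also have "\<dots> < e" using Y(2)[OF elim] e by simp
    finally show ?case by (simp add: dist_norm)
  qed
qed

lemma filterlim_mult_pos_at_top: "(c::real) > 0 \<Longrightarrow> filterlim (\<lambda>y. c * y) at_top at_top"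
  by (rule filterlim_tendsto_pos_mult_at_top[OF tendsto_const _ filterlim_ident])

text \<open>Along the imaginary axis j(w) is asymptotic to 1 / q(w). If two values agreed
  arbitrarily high up, q(w') / q(w) would have 1 as a limit value. But it tends to a root of unity
  different from 1 when both indices are below \<open>l\<close>, and to 0 when the larger one equals
  \<open>l\<close>.\<close>

lemma hecke_points_distinct_eventually:
  assumes l: "l \<ge> 2" and b: "b \<le> l" "b' \<le> l" "b \<noteq> b'"
  shows "eventually (\<lambda>y. modular_j (hecke_point l b (Complex 0 y)) \<noteq> modular_j (hecke_point l b' (Complex 0 y))) at_top"
  using b
proof (induction b b' rule: linorder_wlog)
  case (sym b b')
  thus ?case by (auto elim: eventually_mono)
next
  case (le b b')
  hence bl: "b < l" by auto
  define w where "w = (\<lambda>b y. hecke_point l b (Complex 0 y))"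
  have lim: "((\<lambda>y. modular_j (w b y) * nome (w b y)) \<longlongrightarrow> 1) at_top" for b
  proof (rule modular_j_nome_tendsto)
    have "filterlim (\<lambda>y. y / real l) at_top at_top" "filterlim (\<lambda>y. real l * y) at_top at_top"
      using filterlim_mult_pos_at_top[of "1 / real l"] filterlim_mult_pos_at_top[of "real l"] l by simp_all
    thus "filterlim (\<lambda>y. Im (w b y)) at_top at_top" by (cases "b < l") (simp_all add: w_def Im_hecke_point)
  qed
  have "((\<lambda>y. nome (w b' y) / nome (w b y)) \<longlongrightarrow> (if b' < l then exp (2 * of_real pi * \<i> * ((of_nat b' - of_nat b) / of_nat l)) else 0)) at_top"
    (is "(_ \<longlongrightarrow> ?L) _")
  proof (cases "b' < l")
    case True
    have "nome (w b' y) / nome (w b y) = exp (2 * of_real pi * \<i> * ((of_nat b' - of_nat b) / of_nat l))" for y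
      using True bl l by (simp add: w_def nome_def hecke_point_def diff_divide_distrib add_divide_distrib algebra_simps flip: exp_diff)
    thus ?thesis using True by simp
  next
    case False
    have "norm (nome (w b' y) / nome (w b y)) = exp (- 2 * pi * (real l - 1 / real l) * y)" for y
      using False bl by (simp add: norm_divide norm_nome w_def Im_hecke_point algebra_simps flip: exp_diff)
    moreover have "((\<lambda>y. exp (- 2 * pi * (real l - 1 / real l) * y)) \<longlongrightarrow> 0) at_top"
    proof -
      have "1 / real l < real l" using l by (simp add: divide_less_eq less_1_mult)
      hence "filterlim (\<lambda>y. 2 * pi * (real l - 1 / real l) * y) at_top at_top"
        by (intro filterlim_mult_pos_at_top mult_pos_pos) auto
      hence "filterlim (\<lambda>y. - (2 * pi * (real l - 1 / real l) * y)) at_bot at_top"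
        by (simp only: filterlim_uminus_at_top)
      from filterlim_compose[OF exp_at_bot this] show ?thesis by simp
    qed
    ultimately have "((\<lambda>y. norm (nome (w b' y) / nome (w b y))) \<longlongrightarrow> 0) at_top" by (simp only:)
    thus ?thesis using False by (simp only: if_False tendsto_norm_zero_cancel)
  qed
  moreover have "?L \<noteq> 1"
  proof (cases "b' < l")
    case True
    show ?thesis
    proof
      assume "?L = 1"
      hence "exp (2 * of_real pi * \<i> * ((of_nat b' - of_nat b) / of_nat l)) = (1 :: complex)" using True by simp
      then obtain n :: int where "2 * pi * (real b' - real b) / real l = 2 * real_of_int n * pi"
        unfolding exp_eq_1 by auto
      hence "2 * pi * ((real b' - real b) / real l) = 2 * pi * real_of_int n" by (simp add: mult_ac)
      hence "(real b' - real b) / real l = real_of_int n" by (subst (asm) mult_left_cancel) auto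
      hence "real b' - real b = real_of_int n * real l" using l by (simp add: field_simps)
      hence "real_of_int (int b' - int b) = real_of_int (n * int l)" by simp
      hence e: "int b' - int b = n * int l" by (simp only: of_int_eq_iff)
      have "0 < int b' - int b" "int b' - int b < int l" using le True by auto
      hence nl: "0 < n * int l" "n * int l < int l" unfolding e .
      hence "n > 0" using l by (simp add: zero_less_mult_iff)
      hence "1 * int l \<le> n * int l" by (intro mult_right_mono) auto
      thus False using nl by linarith
    qed
  qed auto
  ultimately have "((\<lambda>y. (modular_j (w b y) * nome (w b y)) * (nome (w b' y) / nome (w b y)) - modular_j (w b' y) * nome (w b' y)) \<longlongrightarrow> 1 * ?L - 1) at_top"
    by (intro tendsto_intros lim)
  hence "eventually (\<lambda>y. (modular_j (w b y) * nome (w b y)) * (nome (w b' y) / nome (w b y)) - modular_j (w b' y) * nome (w b' y) \<noteq> 0) at_top"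
    by (rule tendsto_imp_eventually_ne) (use \<open>?L \<noteq> 1\<close> in simp)
  thus ?case
  proof eventually_elim
    case (elim y)
    have "nome (w b y) \<noteq> 0" by (simp add: nome_def)
    thus ?case using elim unfolding w_def by auto
  qed
qed

text \<open>Replacing z by -1 / (z + b) fixes j(z) and turns j(l z) into j((z + b) / l), so a
  relation for j(l z) has all l + 1 values as roots. At a point where they are distinct and the
  leading coefficient is nonzero, counting roots gives the degree.\<close>

lemma degree_annihilator_ge:
  assumes l: "prime l" and R: "R \<noteq> 0" "annihilates_over_Cj (\<lambda>z. modular_j (of_nat l * z)) R"
  shows "l + 1 \<le> degree R"
proof -
  have l2: "l \<ge> 2" and l0: "l > 0" using l prime_ge_2_nat prime_gt_0_nat by blast+
  obtain S where S: "S \<noteq> 0" "degree S = degree R"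
    "\<forall>\<^sub>\<approx>z\<in>upper_half_plane. poly (poly S [:modular_j (of_nat l * z):]) (modular_j z) = 0"
    using annihilates_over_Cj_polynomial[OF R] by blast
  define U where "U = (\<lambda>z. poly (poly S [:modular_j (of_nat l * z):]) (modular_j z))"
  have "continuous_on {z. Im z > 0} (\<lambda>z. modular_j (hecke_point l l z))"
    by (intro holomorphic_on_imp_continuous_on modular_j_hecke_holomorphic l0)
  hence "continuous_on {z. Im z > 0} (\<lambda>z. modular_j (of_nat l * z))" by (simp add: hecke_point_def)
  moreover have "continuous_on {z. Im z > 0} modular_j"
    by (intro holomorphic_on_imp_continuous_on modular_j_holomorphic)
  ultimately have "continuous_on upper_half_plane U"
    unfolding U_def poly_poly_const upper_half_plane_def by (intro continuous_intros)
  moreover have "open upper_half_plane" unfolding upper_half_plane_def by (rule open_halfspace_Im_gt)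
  ultimately have U0: "U z = 0" if "Im z > 0" for z
    using cosparse_zero_imp_zero[of upper_half_plane U z] S(3) that
    by (simp add: U_def upper_half_plane_def)
  have root: "poly (poly S [:modular_j (hecke_point l b z):]) (modular_j z) = 0" if z: "Im z > 0" and b: "b \<le> l" for z b
  proof (cases "b < l")
    case False
    thus ?thesis using U0[OF z] b by (simp add: U_def hecke_point_def)
  next
    case True
    define z' where "z' = - 1 / (z + of_nat b)"
    have zb: "Im (z + of_nat b) > 0" using z by simp
    have z': "Im z' > 0" unfolding z'_def using Im_moebius_pos[OF zb, of 0 0 "-1" 1] by simp
    have j1: "modular_j z' = modular_j z"
      unfolding z'_def using modular_j_S[OF zb] modular_j_T[OF z, of "int b"] by simp
    have "of_nat l * z' = - 1 / hecke_point l b z" using True l0 by (simp add: z'_def hecke_point_def)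
    hence j2: "modular_j (of_nat l * z') = modular_j (hecke_point l b z)"
      using modular_j_S[OF Im_hecke_point_pos[OF z l0, of b]] by simp
    show ?thesis using U0[OF z'] by (simp add: U_def j1 j2)
  qed
  define c where "c = lead_coeff S"
  have "c \<noteq> 0" using S(1) by (simp add: c_def)
  have "eventually (\<lambda>y. \<forall>p\<in>{(b, b'). b \<le> l \<and> b' \<le> l \<and> b \<noteq> b'}.
      modular_j (hecke_point l (fst p) (Complex 0 y)) \<noteq> modular_j (hecke_point l (snd p) (Complex 0 y))) at_top"
  proof (rule eventually_ball_finite)
    show "finite {(b, b'). b \<le> l \<and> b' \<le> l \<and> b \<noteq> b'}"
      by (rule finite_subset[of _ "{..l} \<times> {..l}"]) auto
  qed (use hecke_points_distinct_eventually[OF l2] in auto)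
  \<comment> \<open>High up, |j| exceeds the modulus of every root of \<open>c\<close>.\<close>
  moreover have "eventually (\<lambda>y. poly c (modular_j (Complex 0 y)) \<noteq> 0) at_top"
  proof -
    have "finite {x. poly c x = 0}" using \<open>c \<noteq> 0\<close> by (rule poly_roots_finite)
    hence "finite (cmod ` {x. poly c x = 0})" by simp
    then obtain B where B: "\<And>x. poly c x = 0 \<Longrightarrow> cmod x < B"
      by (metis (mono_tags, lifting) bdd_above_finite bdd_above.unfold finite_imageD imageI mem_Collect_eq gt_ex order_le_less_trans)
    obtain Y where Y: "\<And>z. Im z \<ge> Y \<Longrightarrow> cmod (modular_j z) \<ge> B" using modular_j_at_cusp[of B] by blast
    hence "poly c (modular_j (Complex 0 y)) \<noteq> 0" if "y \<ge> Y" for y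
    proof -
      have "B \<le> cmod (modular_j (Complex 0 y))" by (rule Y) (use that in simp)
      thus ?thesis using B not_le by blast
    qed
    thus ?thesis by (auto simp: eventually_at_top_linorder)
  qed
  moreover have "eventually (\<lambda>y::real. y > 0) at_top" by (rule eventually_gt_at_top)
  ultimately have "eventually (\<lambda>y. (\<forall>p\<in>{(b, b'). b \<le> l \<and> b' \<le> l \<and> b \<noteq> b'}.
      modular_j (hecke_point l (fst p) (Complex 0 y)) \<noteq> modular_j (hecke_point l (snd p) (Complex 0 y)))
      \<and> poly c (modular_j (Complex 0 y)) \<noteq> 0 \<and> y > 0) at_top"
    by (intro eventually_conj)
  then obtain y where y: "y > 0" "poly c (modular_j (Complex 0 y)) \<noteq> 0"
    "\<And>b b'. b \<le> l \<Longrightarrow> b' \<le> l \<Longrightarrow> b \<noteq> b' \<Longrightarrow>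
        modular_j (hecke_point l b (Complex 0 y)) \<noteq> modular_j (hecke_point l b' (Complex 0 y))"
    by (auto dest!: eventually_happens' [OF trivial_limit_at_top_linorder])
  define z where "z = Complex 0 y"
  have z: "Im z > 0" using y by (simp add: z_def)
  define Q where "Q = map_poly (\<lambda>p. poly p (modular_j z)) S"
  have cQ: "coeff Q i = poly (coeff S i) (modular_j z)" for i by (simp add: Q_def coeff_map_poly)
  have degQ: "degree Q = degree S"
    by (intro antisym degree_le le_degree) (use y(2) in \<open>auto simp: cQ z_def c_def coeff_eq_0\<close>)
  have pQ: "poly Q x = poly (poly S [:x:]) (modular_j z)" for x
    unfolding poly_poly_const poly_altdef[of Q] degQ cQ ..
  have Q0: "Q \<noteq> 0" using y(2) cQ[of "degree S"] by (auto simp: z_def c_def)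
  have inj: "inj_on (\<lambda>b. modular_j (hecke_point l b z)) {..l}"
    using y(3) unfolding inj_on_def z_def by blast
  have "l + 1 = card ((\<lambda>b. modular_j (hecke_point l b z)) ` {..l})" by (simp add: card_image[OF inj])
  also have "\<dots> \<le> card {x. poly Q x = 0}"
    using root[OF z] by (intro card_mono poly_roots_finite Q0) (auto simp: pQ)
  also have "\<dots> \<le> degree Q" by (rule card_poly_roots_bound[OF Q0])
  finally show ?thesis using degQ S(2) by simp
qed

text \<open>The definite description calls for uniqueness: the difference of two monic candidates
  annihilates j(l z) and has degree below l + 1, hence vanishes by
  \<open>degree_annihilator_ge\<close>.\<close>

theorem modular_polynomial_hecke:
  assumes l: "prime l"
  shows "\<And>z i. Im z > 0 \<Longrightarrow> poly (coeff (modular_polynomial l) i) (modular_j z) = coeff (hecke_poly l z) i"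
    and "lead_coeff (modular_polynomial l) = 1"
proof -
  let ?f = "\<lambda>z. modular_j (of_nat l * z)"
  obtain P where P: "degree P = l + 1" "lead_coeff P = 1"
    "\<And>z i. Im z > 0 \<Longrightarrow> poly (coeff P i) (modular_j z) = coeff (hecke_poly l z) i"
    using ex_modular_polynomial[OF l] by blast
  have "poly (poly P [:?f z:]) (modular_j z) = 0" if "Im z > 0" for z
  proof -
    have "poly (poly P [:?f z:]) (modular_j z) = poly (hecke_poly l z) (?f z)"
      unfolding poly_poly_const poly_altdef[of "hecke_poly l z"] degree_hecke_poly P(1) using P(3)[OF that] by simp
    also have "\<dots> = 0" by (auto simp: hecke_poly_def poly_prod hecke_point_def)
    finally show ?thesis .
  qed
  moreover have "eventually (\<lambda>z. z \<in> {z. Im z > 0}) (cosparse upper_half_plane)"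
    by (intro eventually_in_cosparse) (auto simp: upper_half_plane_def open_halfspace_Im_gt)
  ultimately have ann: "annihilates_over_Cj ?f (map_poly to_fract P)"
    unfolding annihilates_over_Cj_map_poly by (auto elim: eventually_mono)
  have lc: "lead_coeff (map_poly to_fract P) = 1"
    using P(2) by (simp only: degree_map_poly_to_fract) (simp add: coeff_map_poly)
  have min: "minimal_poly_over_Cj ?f (map_poly to_fract P)"
    unfolding minimal_poly_over_Cj_def
    using ann lc degree_annihilator_ge[OF l] by (auto simp: degree_map_poly_to_fract P(1))
  have "modular_polynomial l = P"
    unfolding modular_polynomial_def
  proof (rule the_equality[where a = P])
    show "minimal_poly_over_Cj ?f (map_poly to_fract P)" by (rule min)
  next
    fix P' :: "complex poly poly" assume P': "minimal_poly_over_Cj ?f (map_poly to_fract P')"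
    have nz: "map_poly to_fract P \<noteq> 0" "map_poly to_fract P' \<noteq> 0"
      using lc P' by (auto simp: minimal_poly_over_Cj_def)
    hence deg: "degree P' = degree P"
      using P' min unfolding minimal_poly_over_Cj_def degree_map_poly_to_fract[symmetric] by (meson antisym)
    have lc': "lead_coeff P' = 1"
      using P' unfolding minimal_poly_over_Cj_def degree_map_poly_to_fract by (simp add: coeff_map_poly flip: to_fract_1)
    have ann': "annihilates_over_Cj ?f (map_poly to_fract P')" using P' by (simp add: minimal_poly_over_Cj_def)
    have "annihilates_over_Cj ?f (map_poly to_fract (P' - P))"
      using eventually_conj[OF ann[unfolded annihilates_over_Cj_map_poly] ann'[unfolded annihilates_over_Cj_map_poly]]
      unfolding annihilates_over_Cj_map_poly by (auto elim: eventually_mono)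
    hence "map_poly to_fract (P' - P) = 0 \<or> l + 1 \<le> degree (P' - P)"
      using degree_annihilator_ge[OF l] by (metis degree_map_poly_to_fract)
    moreover have "degree (P' - P) < l + 1 \<or> P' - P = 0"
    proof -
      have "coeff (P' - P) (l + 1) = 0" using deg lc' P(1,2) by simp
      moreover have "degree (P' - P) \<le> l + 1" using deg P(1) by (metis degree_diff_le_max max.idem)
      ultimately show ?thesis by (metis leading_coeff_0_iff le_neq_implies_less)
    qed
    ultimately show "P' = P" by (auto simp: poly_eq_iff coeff_map_poly)
  qed
  thus "\<And>z i. Im z > 0 \<Longrightarrow> poly (coeff (modular_polynomial l) i) (modular_j z) = coeff (hecke_poly l z) i"
    "lead_coeff (modular_polynomial l) = 1"
    using P by auto
qed

section \<open>From values on the unit circle to coefficients\<close>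

lemma norm_coeff_le_unit_circle:
  fixes p :: "complex poly"
  assumes "\<And>x. norm x = 1 \<Longrightarrow> norm (poly p x) \<le> B"
  shows "norm (coeff p k) \<le> B"
proof -
  have "(deriv ^^ k) (poly p) 0 = fact k * coeff p k"
  proof -
    have "(deriv ^^ k) (poly p) = poly ((pderiv ^^ k) p)"
    proof (induction k)
      case (Suc k)
      have "deriv (poly p') = poly (pderiv p')" for p' :: "complex poly"
        by (intro ext DERIV_imp_deriv poly_DERIV)
      thus ?case using Suc by simp
    qed simp
    thus ?thesis by (simp add: poly_0_coeff_0 coeff_higher_pderiv pochhammer_fact)
  qed
  moreover have "norm ((deriv ^^ k) (poly p) 0) \<le> fact k * B / 1 ^ k"
    by (rule Cauchy_inequality) (use assms in \<open>auto intro!: holomorphic_intros continuous_intros\<close>)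
  ultimately show ?thesis by (simp add: norm_mult)
qed

lemma norm_coeff_modular_polynomial_le:
  assumes l: "prime l"
    and B: "\<And>z. z \<in> fundamental_domain \<Longrightarrow> cmod (modular_j z) = 1 \<Longrightarrow>
                (\<Prod>b\<le>l. 1 + cmod (modular_j (hecke_point l b z))) \<le> B"
  shows "cmod (coeff (coeff (modular_polynomial l) i) k) \<le> B"
proof (rule norm_coeff_le_unit_circle)
  fix x :: complex assume x: "norm x = 1"
  obtain z where z: "z \<in> fundamental_domain" "modular_j z = x" using modular_j_surj by blast
  hence "Im z > 0" by (simp add: fundamental_domain_def)
  hence "poly (coeff (modular_polynomial l) i) x = coeff (hecke_poly l z) i"
    using modular_polynomial_hecke(1)[OF l] z by blast
  also have "norm \<dots> \<le> (\<Prod>b\<le>l. 1 + cmod (modular_j (hecke_point l b z)))"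
    unfolding hecke_poly_def by (rule norm_coeff_prod_linear_le) simp
  also have "\<dots> \<le> B" using B[OF z(1)] z(2) x by simp
  finally show "norm (poly (coeff (modular_polynomial l) i) x) \<le> B" .
qed

text \<open>\<open>Max\<close> is meaningful on finite sets only, and the range is finite since all
  but finitely many coefficients vanish. A nonzero coefficient makes the maximum positive, which the
  monotonicity of the logarithm requires.\<close>

lemma poly2_height_le:
  fixes P :: "complex poly poly"
  assumes "\<And>i k. cmod (coeff (coeff P i) k) \<le> exp B" "P \<noteq> 0"
  shows "poly2_height P \<le> B"
proof -
  define c where "c = (\<lambda>(i, k). cmod (coeff (coeff P i) k))"
  have "range c \<subseteq> insert 0 (c ` (SIGMA i:{..degree P}. {..degree (coeff P i)}))"
  proof safe
    fix i k assume *: "c (i, k) \<notin> c ` (SIGMA i:{..degree P}. {..degree (coeff P i)})"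
    have "i > degree P \<or> k > degree (coeff P i)" using * by force
    thus "c (i, k) = 0" by (auto simp: c_def coeff_eq_0)
  qed
  hence fin: "finite (range c)" by (rule finite_subset) auto
  obtain i where i: "coeff P i \<noteq> 0" using assms(2) by (metis leading_coeff_neq_0)
  then obtain k where "coeff (coeff P i) k \<noteq> 0" by (metis leading_coeff_neq_0)
  hence "0 < c (i, k)" by (simp add: c_def)
  also have "c (i, k) \<le> Max (range c)" using fin by (intro Max_ge) auto
  finally have pos: "0 < Max (range c)" .
  have "Max (range c) \<le> exp B" using fin assms(1) by (auto simp: c_def)
  thus ?thesis unfolding poly2_height_def c_def[symmetric] using pos by (metis exp_gt_zero ln_exp ln_le_cancel_iff)
qed

section \<open>A logarithmic lattice point sum\<close>

text \<open>\<open>\<Phi>\<close> is the integral of the decreasing function \<open>g\<close>,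
  constant beyond \<open>S\<close>. The derivative is asked for in the open interval only, which
  matters for \<open>arccos\<close> and \<open>sqrt\<close> at the end point 1 of
  \<open>row_integral\<close>.\<close>

lemma clipped_antiderivative:
  fixes g G :: "real \<Rightarrow> real"
  assumes S: "S > 0"
    and anti: "\<And>s t. 0 \<le> s \<Longrightarrow> s \<le> t \<Longrightarrow> t < S \<Longrightarrow> g t \<le> g s"
    and nonneg: "\<And>t. 0 \<le> t \<Longrightarrow> t < S \<Longrightarrow> 0 \<le> g t"
    and cont: "continuous_on {0..S} G"
    and deriv: "\<And>t. 0 < t \<Longrightarrow> t < S \<Longrightarrow> (G has_real_derivative g t) (at t)"
    and G0: "G 0 = 0"
  obtains \<Phi> where "\<And>s t. 0 \<le> s \<Longrightarrow> s \<le> t \<Longrightarrow> (t - s) * (if t < S then g t else 0) \<le> \<Phi> t - \<Phi> s"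
    "\<Phi> 0 = 0" "\<And>t. t \<ge> 0 \<Longrightarrow> \<Phi> t \<le> G S"
proof -
  have key: "(t - s) * c \<le> G t - G s"
    if st: "0 \<le> s" "s \<le> t" "t \<le> S" and c: "\<And>\<xi>. s < \<xi> \<Longrightarrow> \<xi> < t \<Longrightarrow> c \<le> g \<xi>" for s t c
  proof (cases "s = t")
    case False
    hence "s < t" using st by simp
    moreover have "continuous_on {s..t} G" using st by (intro continuous_on_subset[OF cont]) auto
    moreover have "G differentiable (at x)" if "s < x" "x < t" for x
      using deriv[of x] that st by (auto simp: real_differentiable_def)
    ultimately obtain l \<xi> where \<xi>: "s < \<xi>" "\<xi> < t" "DERIV G \<xi> :> l" "G t - G s = (t - s) * l"
      using MVT[of s t G] by blast
    have "l = g \<xi>" using DERIV_unique[OF \<xi>(3) deriv[of \<xi>]] \<xi> st by simp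
    thus ?thesis using c[OF \<xi>(1,2)] \<xi>(4) \<open>s < t\<close> by (simp add: mult_left_mono)
  qed simp
  define \<Phi> where "\<Phi> = (\<lambda>t. G (min t S))"
  show ?thesis
  proof (rule that[of \<Phi>])
    fix s t :: real assume st: "0 \<le> s" "s \<le> t"
    show "(t - s) * (if t < S then g t else 0) \<le> \<Phi> t - \<Phi> s"
    proof (cases "t < S")
      case True
      have "(t - s) * g t \<le> G t - G s" using st True anti by (intro key) auto
      thus ?thesis using True st by (simp add: \<Phi>_def)
    next
      case False
      have "(S - min s S) * 0 \<le> G S - G (min s S)" using st S nonneg by (intro key) auto
      thus ?thesis using False by (simp add: \<Phi>_def)
    qed
  next
    show "\<Phi> 0 = 0" using S G0 by (simp add: \<Phi>_def)
    fix t :: real assume t: "t \<ge> 0"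
    have "(S - min t S) * 0 \<le> G S - G (min t S)" using t S nonneg by (intro key) auto
    thus "\<Phi> t \<le> G S" by (simp add: \<Phi>_def)
  qed
qed

lemma sum_shifted_le_antiderivative:
  fixes \<phi> \<Phi> :: "real \<Rightarrow> real"
  assumes "\<And>s t. 0 \<le> s \<Longrightarrow> s \<le> t \<Longrightarrow> (t - s) * \<phi> t \<le> \<Phi> t - \<Phi> s" "0 \<le> s" "0 \<le> h"
  shows "(\<Sum>k=1..K. h * \<phi> (s + real k * h)) \<le> \<Phi> (s + real K * h) - \<Phi> s"
proof (induction K)
  case (Suc K)
  have "h * \<phi> (s + real (Suc K) * h) \<le> \<Phi> (s + real (Suc K) * h) - \<Phi> (s + real K * h)"
    using assms(1)[of "s + real K * h" "s + real (Suc K) * h"] assms(2,3) by (simp add: algebra_simps)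
  thus ?case using Suc by simp
qed simp

text \<open>The shifted integers split into two progressions of absolute values, starting at s and 1
  - s in [0, 1]. The bound is one peak value plus the integral over both sides, where treating each
  side alone would cost two peaks.\<close>

lemma sum_shifted_ints_le:
  fixes \<phi> \<Phi> :: "real \<Rightarrow> real"
  assumes dom: "\<And>s t. 0 \<le> s \<Longrightarrow> s \<le> t \<Longrightarrow> (t - s) * \<phi> t \<le> \<Phi> t - \<Phi> s"
    and \<Phi>0: "\<Phi> 0 = 0" and B: "\<And>t. t \<ge> 0 \<Longrightarrow> \<Phi> t \<le> B"
    and \<phi>: "\<And>s t. 0 \<le> s \<Longrightarrow> s \<le> t \<Longrightarrow> \<phi> t \<le> \<phi> s" "\<And>t. t \<ge> 0 \<Longrightarrow> 0 \<le> \<phi> t"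
    and A: "finite A"
  shows "(\<Sum>m\<in>A. \<phi> \<bar>of_int m + \<alpha>\<bar>) \<le> \<phi> 0 + 2 * B"
proof -
  define n where "n = \<lceil>- \<alpha>\<rceil>"
  define s where "s = of_int n + \<alpha>"
  have s: "0 \<le> s" "s < 1" unfolding s_def n_def by linarith+
  obtain N where N: "\<And>m. m \<in> A \<Longrightarrow> \<bar>m\<bar> \<le> N"
  proof
    show "\<bar>m\<bar> \<le> Max (insert 0 (abs ` A))" if "m \<in> A" for m using A that by (intro Max_ge) auto
  qed
  define K where "K = nat (\<bar>N\<bar> + \<bar>n\<bar>)"
  define I1 where "I1 = (\<lambda>k. n + int k) ` {..K}"
  define I2 where "I2 = (\<lambda>k. n - 1 - int k) ` {..K}"
  have "A \<subseteq> I1 \<union> I2"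
  proof
    fix m assume "m \<in> A"
    hence m: "\<bar>m\<bar> \<le> \<bar>N\<bar>" using N[of m] by simp
    show "m \<in> I1 \<union> I2"
    proof (cases "m \<ge> n")
      case True
      hence "m = n + int (nat (m - n))" "nat (m - n) \<le> K" using m by (auto simp: K_def)
      thus ?thesis unfolding I1_def by blast
    next
      case False
      hence "m = n - 1 - int (nat (n - 1 - m))" "nat (n - 1 - m) \<le> K" using m by (auto simp: K_def)
      thus ?thesis unfolding I2_def by blast
    qed
  qed
  hence "(\<Sum>m\<in>A. \<phi> \<bar>of_int m + \<alpha>\<bar>) \<le> (\<Sum>m\<in>I1 \<union> I2. \<phi> \<bar>of_int m + \<alpha>\<bar>)"
    by (intro sum_mono2) (auto simp: I1_def I2_def intro: \<phi>(2))
  also have "\<dots> = (\<Sum>m\<in>I1. \<phi> \<bar>of_int m + \<alpha>\<bar>) + (\<Sum>m\<in>I2. \<phi> \<bar>of_int m + \<alpha>\<bar>)"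
    by (intro sum.union_disjoint) (auto simp: I1_def I2_def)
  also have "(\<Sum>m\<in>I1. \<phi> \<bar>of_int m + \<alpha>\<bar>) = (\<Sum>k\<le>K. \<phi> (s + real k * 1))"
    unfolding I1_def using s by (subst sum.reindex) (auto simp: inj_on_def s_def algebra_simps intro!: sum.cong)
  also have "\<dots> = \<phi> s + (\<Sum>k=1..K. 1 * \<phi> (s + real k * 1))"
    by (simp add: atMost_atLeast0 sum.atLeast_Suc_atMost)
  also have "(\<Sum>m\<in>I2. \<phi> \<bar>of_int m + \<alpha>\<bar>) = (\<Sum>k\<le>K. \<phi> ((1 - s) + real k * 1))"
    unfolding I2_def using s by (subst sum.reindex) (auto simp: inj_on_def s_def algebra_simps intro!: sum.cong arg_cong[of _ _ \<phi>])
  also have "\<dots> = \<phi> (1 - s) + (\<Sum>k=1..K. 1 * \<phi> ((1 - s) + real k * 1))"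
    by (simp add: atMost_atLeast0 sum.atLeast_Suc_atMost)
  finally have 1: "(\<Sum>m\<in>A. \<phi> \<bar>of_int m + \<alpha>\<bar>) \<le>
      \<phi> s + (\<Sum>k=1..K. 1 * \<phi> (s + real k * 1)) + (\<phi> (1 - s) + (\<Sum>k=1..K. 1 * \<phi> ((1 - s) + real k * 1)))" .
  have "(\<Sum>k=1..K. 1 * \<phi> (s + real k * 1)) \<le> B - \<Phi> s"
    using sum_shifted_le_antiderivative[of \<phi> \<Phi> s 1 K, OF dom s(1)] B[of "s + real K * 1"] s by simp
  moreover have "(\<Sum>k=1..K. 1 * \<phi> ((1 - s) + real k * 1)) \<le> B - \<Phi> (1 - s)"
    using sum_shifted_le_antiderivative[of \<phi> \<Phi> "1 - s" 1 K, OF dom] B[of "1 - s + real K * 1"] s by simp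
  \<comment> \<open>The shares s phi(s) and (1 - s) phi(1 - s) of the two first terms are paid by
    the integrals over [0, s] and [0, 1 - s]; what remains is a convex combination of values at most
    \<open>\<phi> 0\<close>.\<close>
  moreover have "s * \<phi> s \<le> \<Phi> s" "(1 - s) * \<phi> (1 - s) \<le> \<Phi> (1 - s)"
    using dom[of 0 s] dom[of 0 "1 - s"] s \<Phi>0 by auto
  moreover have "(1 - s) * \<phi> s \<le> (1 - s) * \<phi> 0" "s * \<phi> (1 - s) \<le> s * \<phi> 0"
    using \<phi>(1) s by (auto intro!: mult_left_mono)
  ultimately show ?thesis using 1 by (simp add: algebra_simps)
qed

text \<open>The induction is the inequality n! >= (n / e)^n in logarithmic form; log x <= x - 1 at x
  = u / N does the rest.\<close>

lemma sum_ln_quotient_le: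
  assumes "real N \<le> u" "u > 0"
  shows "(\<Sum>c=1..N. ln (u / real c)) \<le> u"
proof (cases "N = 0")
  case False
  have "(\<Sum>c=1..n. ln (u / real c)) \<le> real n * ln (u / real n) + real n" for n
  proof (induction n)
    case (Suc n)
    show ?case
    proof (cases "n = 0")
      case False
      have "ln (real (Suc n) / real n) \<le> 1 / real n"
      proof -
        have "real (Suc n) / real n = 1 + 1 / real n" using False by (simp add: field_simps)
        thus ?thesis using ln_add_one_self_le_self[of "1 / real n"] by simp
      qed
      hence "real n * ln (real (Suc n) / real n) \<le> real n * (1 / real n)" by (intro mult_left_mono) auto
      hence "real n * (ln (u / real n) - ln (u / real (Suc n))) \<le> 1"
        using False assms(2) by (simp add: ln_div)
      thus ?thesis using Suc by (simp add: algebra_simps)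
    qed simp
  qed simp
  also have "real N * ln (u / real N) + real N \<le> real N * (u / real N - 1) + real N"
    using assms False by (intro add_right_mono mult_left_mono ln_le_minus_one) auto
  also have "\<dots> = u" using False by (simp add: algebra_simps)
  finally show ?thesis .
qed (use assms in simp)

text \<open>\<open>R * row_integral (a / R)\<close> is the integral in \<open>t\<close> of \<open>log\<^sup>+ (R\<^sup>2 / (t\<^sup>2 + a\<^sup>2))\<close> over the line.\<close>

definition row_integral :: "real \<Rightarrow> real" where
  "row_integral t = 4 * sqrt (1 - t ^ 2) - 4 * t * arccos t"

lemma arctan_eq_arccos:
  assumes "0 < t" "t < 1"
  shows "arctan (sqrt (1 - t ^ 2) / t) = arccos t"
proof -
  have a: "0 < arccos t" "arccos t < pi / 2"
    using arccos_lt_bounded[of t] arccos_less_arccos[of 0 t] assms by auto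
  have "tan (arccos t) = sqrt (1 - t ^ 2) / t" using assms by (simp add: tan_def sin_arccos)
  hence "arctan (tan (arccos t)) = arctan (sqrt (1 - t ^ 2) / t)" by simp
  thus ?thesis using a by (simp add: arctan_tan)
qed

text \<open>One lattice row at height \<open>a\<close>: the peak of the clipped logarithm plus its
  integral. \<open>G\<close> is the antiderivative found by parts, and \<open>S\<close> is where the
  logarithm reaches 0.\<close>

lemma row_sum_le:
  fixes a M \<alpha> :: real
  assumes a: "a > 0" "a ^ 2 < M" and A: "finite A" "\<And>m. m \<in> A \<Longrightarrow> (of_int m + \<alpha>) ^ 2 + a ^ 2 < M"
  shows "(\<Sum>m\<in>A. ln (M / ((of_int m + \<alpha>) ^ 2 + a ^ 2))) \<le> ln (M / a ^ 2) + sqrt M * row_integral (a / sqrt M)"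
proof -
  define S where "S = sqrt (M - a ^ 2)"
  define g where "g = (\<lambda>s. ln (M / (s ^ 2 + a ^ 2)))"
  define G where "G = (\<lambda>s. s * (ln M - ln (s ^ 2 + a ^ 2)) + 2 * s - 2 * a * arctan (s / a))"
  define \<phi> where "\<phi> = (\<lambda>t. if t < S then g t else 0)"
  have M: "M > 0" using a by (meson less_trans zero_less_power)
  have S: "S > 0" "S ^ 2 = M - a ^ 2" using a by (auto simp: S_def)
  have pos: "s ^ 2 + a ^ 2 > 0" for s using a by (simp add: add_nonneg_pos)
  have less: "\<bar>s\<bar> < S \<longleftrightarrow> s ^ 2 + a ^ 2 < M" for s
  proof -
    have "\<bar>s\<bar> < S \<longleftrightarrow> \<bar>s\<bar> ^ 2 < S ^ 2" using S by (metis abs_ge_zero less_imp_le power2_less_imp_less power_strict_mono zero_less_numeral)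
    thus ?thesis using S by auto
  qed
  have g: "g t \<le> g s" if "0 \<le> s" "s \<le> t" for s t
    unfolding g_def using that pos M power_mono[OF that(2,1), of 2]
    by (subst ln_le_cancel_iff) (auto intro!: divide_left_mono mult_pos_pos)
  have g0: "0 \<le> g t" if "0 \<le> t" "t < S" for t
    using less[of t] that pos[of t] by (simp add: g_def)
  have \<phi>1: "\<phi> t \<le> \<phi> s" if "0 \<le> s" "s \<le> t" for s t
    using that g[OF that] g0[of s] by (auto simp: \<phi>_def)
  have \<phi>0: "0 \<le> \<phi> t" if "0 \<le> t" for t using that g0[of t] by (auto simp: \<phi>_def)
  have deriv: "(G has_real_derivative g t) (at t)" for t
  proof -
    have "(G has_real_derivative ((ln M - ln (t ^ 2 + a ^ 2)) + t * (- 2 * t / (t ^ 2 + a ^ 2)) + 2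
             - 2 * a * (inverse (1 + (t / a) ^ 2) * (1 / a)))) (at t)"
      unfolding G_def using pos[of t] a
      by (auto intro!: derivative_eq_intros)
    also have "2 * a * (inverse (1 + (t / a) ^ 2) * (1 / a)) = 2 * a ^ 2 / (t ^ 2 + a ^ 2)"
    proof -
      have "1 + (t / a) ^ 2 = (t ^ 2 + a ^ 2) / a ^ 2" using a by (simp add: power_divide add_divide_distrib)
      thus ?thesis using a by (simp add: power2_eq_square)
    qed
    also have "ln M - ln (t ^ 2 + a ^ 2) + t * (- 2 * t / (t ^ 2 + a ^ 2)) + 2 - 2 * a ^ 2 / (t ^ 2 + a ^ 2) = g t"
    proof -
      have "t * (- 2 * t / (t ^ 2 + a ^ 2)) + 2 - 2 * a ^ 2 / (t ^ 2 + a ^ 2) = 0"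
      proof -
        have "2 * t ^ 2 / (t ^ 2 + a ^ 2) + 2 * a ^ 2 / (t ^ 2 + a ^ 2) = (2 * (t ^ 2 + a ^ 2)) / (t ^ 2 + a ^ 2)"
          by (simp only: add_divide_distrib distrib_left)
        also have "\<dots> = 2" using pos[of t] by (subst nonzero_mult_div_cancel_right) auto
        finally show ?thesis by (simp add: power2_eq_square)
      qed
      moreover have "ln M - ln (t ^ 2 + a ^ 2) = g t" using pos[of t] M a by (simp add: g_def ln_div)
      ultimately show ?thesis by linarith
    qed
    finally show ?thesis .
  qed
  have "continuous_on {0..S} G" using deriv by (intro DERIV_continuous_on) (auto intro: has_field_derivative_at_within)
  from clipped_antiderivative[of S g G, OF S(1) g g0 this deriv]
  obtain \<Phi> where \<Phi>: "\<And>s t. 0 \<le> s \<Longrightarrow> s \<le> t \<Longrightarrow> (t - s) * \<phi> t \<le> \<Phi> t - \<Phi> s"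
    "\<Phi> 0 = 0" "\<And>t. t \<ge> 0 \<Longrightarrow> \<Phi> t \<le> G S"
    unfolding \<phi>_def by (auto simp: G_def)
  have "(\<Sum>m\<in>A. ln (M / ((of_int m + \<alpha>) ^ 2 + a ^ 2))) = (\<Sum>m\<in>A. \<phi> \<bar>of_int m + \<alpha>\<bar>)"
    using A(2) less by (intro sum.cong) (auto simp: \<phi>_def g_def)
  also have "\<dots> \<le> \<phi> 0 + 2 * G S"
    by (rule sum_shifted_ints_le[OF \<Phi>(1,2,3) \<phi>1 \<phi>0 A(1)])
  also have "\<phi> 0 = ln (M / a ^ 2)" using S by (simp add: \<phi>_def g_def)
  also have "2 * G S = sqrt M * row_integral (a / sqrt M)"
  proof -
    define t where "t = a / sqrt M"
    have "a < sqrt M" using a by (simp add: real_less_rsqrt)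
    hence t: "0 < t" "t < 1" using a M by (auto simp: t_def)
    have at: "a = sqrt M * t" using M by (simp add: t_def)
    have St: "S = sqrt M * sqrt (1 - t ^ 2)"
    proof -
      have "M - a ^ 2 = M * (1 - t ^ 2)" using M by (simp add: t_def power_divide field_simps)
      thus ?thesis by (simp add: S_def real_sqrt_mult)
    qed
    have "S / a = sqrt (1 - t ^ 2) / t" using M by (simp add: St at)
    hence "2 * G S = 2 * (2 * S - 2 * a * arccos t)"
      using S M arctan_eq_arccos[OF t] by (simp add: G_def)
    also have "\<dots> = sqrt M * row_integral t" by (simp add: row_integral_def St at algebra_simps)
    finally show ?thesis by (simp add: t_def)
  qed
  finally show ?thesis .
qed

text \<open>The derivative is -4 arccos t, and the value at 1 is 0.\<close>

lemma row_integral_nonneg_antimono: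
  shows "0 \<le> s \<Longrightarrow> s \<le> t \<Longrightarrow> t \<le> 1 \<Longrightarrow> row_integral t \<le> row_integral s"
    and "0 \<le> t \<Longrightarrow> t \<le> 1 \<Longrightarrow> 0 \<le> row_integral t"
proof -
  have anti: "row_integral t \<le> row_integral s" if st: "0 \<le> s" "s \<le> t" "t \<le> 1" for s t
  proof (rule DERIV_nonpos_imp_decreasing_open[OF st(2)])
    fix x assume x: "s < x" "x < t"
    have x1: "- 1 < x" "x < 1" "x ^ 2 < 1" "0 < x" using x st by (auto simp: abs_square_less_1)
    have "(row_integral has_real_derivative (4 * (inverse (sqrt (1 - x ^ 2)) / 2 * (- 2 * x)) -
             (4 * arccos x + 4 * x * inverse (- sqrt (1 - x ^ 2))))) (at x)"
      unfolding row_integral_def[abs_def] using x1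
      by (auto intro!: derivative_eq_intros simp: field_simps)
    also have "(4 * (inverse (sqrt (1 - x ^ 2)) / 2 * (- 2 * x)) - (4 * arccos x + 4 * x * inverse (- sqrt (1 - x ^ 2)))) = - 4 * arccos x"
      by (simp add: field_simps)
    finally show "\<exists>y. (row_integral has_real_derivative y) (at x) \<and> y \<le> 0"
      using arccos_lbound[of x] x1 by (intro exI[of _ "- 4 * arccos x"]) auto
  next
    show "continuous_on {s..t} row_integral"
      unfolding row_integral_def[abs_def] using st by (intro continuous_intros) auto
  qed
  show "0 \<le> s \<Longrightarrow> s \<le> t \<Longrightarrow> t \<le> 1 \<Longrightarrow> row_integral t \<le> row_integral s" by (rule anti)
  show "0 \<le> t \<Longrightarrow> t \<le> 1 \<Longrightarrow> 0 \<le> row_integral t"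
    using anti[of t 1] by (simp add: row_integral_def)
qed

text \<open>A right-endpoint Riemann sum of a decreasing function is at most its integral over
  [0, 1]; the antiderivative \<open>G\<close> has G 0 = 0 and G 1 = arcsin 1 = pi / 2.\<close>

lemma sum_row_integral_le:
  assumes h: "h > 0" "real N * h \<le> 1"
  shows "(\<Sum>c=1..N. h * row_integral (real c * h)) \<le> pi / 2"
proof -
  define G where "G = (\<lambda>t. 3 * t * sqrt (1 - t ^ 2) + arcsin t - 2 * t ^ 2 * arccos t)"
  have deriv: "(G has_real_derivative row_integral x) (at x)" if x: "0 < x" "x < 1" for x
  proof -
    define r where "r = sqrt (1 - x ^ 2)"
    have x1: "- 1 < x" "x < 1" "x ^ 2 < 1" using x by (auto simp: abs_square_less_1)
    have r: "r > 0" "r * r = 1 - x ^ 2" using x1 by (auto simp: r_def)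
    have "(G has_real_derivative (3 * r + 3 * x * (inverse r / 2 * (- 2 * x)) + inverse r -
             (4 * x * arccos x + 2 * x ^ 2 * inverse (- r)))) (at x)"
      unfolding G_def r_def using x1
      by (auto intro!: derivative_eq_intros simp: field_simps)
    also have "3 * r + 3 * x * (inverse r / 2 * (- 2 * x)) + inverse r - (4 * x * arccos x + 2 * x ^ 2 * inverse (- r))
        = 3 * r + (1 - x ^ 2) * inverse r - 4 * x * arccos x"
      by (simp add: algebra_simps power2_eq_square)
    also have "(1 - x ^ 2) * inverse r = r" using r by (simp flip: r(2))
    also have "3 * r + r - 4 * x * arccos x = row_integral x" by (simp add: row_integral_def r_def)
    finally show ?thesis .
  qed
  have cont: "continuous_on {0..1} G"
    unfolding G_def by (intro continuous_intros) auto
  obtain \<Phi> where \<Phi>: "\<And>s t. 0 \<le> s \<Longrightarrow> s \<le> t \<Longrightarrow> (t - s) * (if t < 1 then row_integral t else 0) \<le> \<Phi> t - \<Phi> s"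
    "\<Phi> 0 = 0" "\<And>t. t \<ge> 0 \<Longrightarrow> \<Phi> t \<le> G 1"
    by (rule clipped_antiderivative[of 1 row_integral G])
       (use row_integral_nonneg_antimono cont deriv in \<open>auto simp: G_def\<close>)
  have "(\<Sum>c=1..N. h * row_integral (real c * h)) = (\<Sum>c=1..N. h * (if 0 + real c * h < 1 then row_integral (0 + real c * h) else 0))"
  proof (rule sum.cong)
    fix c assume "c \<in> {1..N}"
    hence "real c * h \<le> real N * h" using h by (intro mult_right_mono) auto
    hence "real c * h \<le> 1" using h(2) by linarith
    hence "real c * h < 1 \<or> real c * h = 1" by auto
    thus "h * row_integral (real c * h) = h * (if 0 + real c * h < 1 then row_integral (0 + real c * h) else 0)"
      by (auto simp: row_integral_def)
  qed simp
  also have "\<dots> \<le> \<Phi> (0 + real N * h) - \<Phi> 0"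
    by (rule sum_shifted_le_antiderivative[OF \<Phi>(1)]) (use h in auto)
  also have "\<dots> \<le> pi / 2" using \<Phi>(2) \<Phi>(3)[of "real N * h"] h by (simp add: G_def)
  finally show ?thesis .
qed

text \<open>With u = sqrt M / y, the peaks of the rows add up to at most 2 u and the row integrals
  to at most sqrt M u pi / 2. The latter is the plane integral pi M of log+ (M / |v|^2) over the
  covolume y, halved because only rows with c >= 1 are counted.\<close>

lemma lattice_log_sum_le:
  fixes x y M :: real and W :: "(nat \<times> int) set"
  assumes y: "y > 0" and M: "M > 0" and W: "finite W"
    "\<And>c m. (c, m) \<in> W \<Longrightarrow> c \<ge> 1 \<and> (of_int m + real c * x) ^ 2 + (real c * y) ^ 2 < M"
  shows "(\<Sum>(c, m)\<in>W. ln (M / ((of_int m + real c * x) ^ 2 + (real c * y) ^ 2))) \<le> 2 * sqrt M / y + pi * M / (2 * y)"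
proof -
  define u where "u = sqrt M / y"
  have u: "u > 0" using y M by (simp add: u_def)
  define N where "N = nat \<lfloor>u\<rfloor>"
  have N: "real N \<le> u" using u by (simp add: N_def)
  define C where "C = fst ` W"
  define row where "row = (\<lambda>c. {m. (c, m) \<in> W})"
  have finrow: "finite (row c)" for c
    by (rule finite_subset[of _ "snd ` W"]) (use W(1) in \<open>force simp: row_def\<close>)+
  have C: "C \<subseteq> {1..N}" "\<And>c. c \<in> C \<Longrightarrow> (real c * y) ^ 2 < M"
  proof -
    show *: "(real c * y) ^ 2 < M" if cC: "c \<in> C" for c
    proof -
      obtain m where "(c, m) \<in> W" using cC unfolding C_def by force
      from W(2)[OF this] show ?thesis using zero_le_power2[of "of_int m + real c * x"] by linarith
    qed
    show "C \<subseteq> {1..N}"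
    proof
      fix c assume c: "c \<in> C"
      have "real c * y < sqrt M" using *[OF c] by (rule real_less_rsqrt)
      hence "real c \<le> u" using y by (simp add: u_def field_simps)
      hence "c \<le> N" unfolding N_def by linarith
      thus "c \<in> {1..N}" using W(2) c by (force simp: C_def)
    qed
  qed
  have eq: "W = Sigma C row" by (auto simp: C_def row_def image_iff) (metis fst_conv)
  have finC: "finite C" using W by (simp add: C_def)
  have "(\<Sum>(c, m)\<in>W. ln (M / ((of_int m + real c * x) ^ 2 + (real c * y) ^ 2)))
     = (\<Sum>c\<in>C. \<Sum>m\<in>row c. ln (M / ((of_int m + real c * x) ^ 2 + (real c * y) ^ 2)))"
    by (subst eq, subst sum.Sigma) (use finC finrow in auto)
  also have "\<dots> \<le> (\<Sum>c\<in>C. ln (M / (real c * y) ^ 2) + sqrt M * row_integral (real c * y / sqrt M))"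
  proof (rule sum_mono)
    fix c assume c: "c \<in> C"
    hence "c \<ge> 1" using C by auto
    thus "(\<Sum>m\<in>row c. ln (M / ((of_int m + real c * x) ^ 2 + (real c * y) ^ 2)))
        \<le> ln (M / (real c * y) ^ 2) + sqrt M * row_integral (real c * y / sqrt M)"
      using y C(2)[OF c] W(2) finrow by (intro row_sum_le) (auto simp: row_def)
  qed
  also have "\<dots> \<le> (\<Sum>c=1..N. 2 * ln (u / real c) + sqrt M * row_integral (real c * (1 / u)))"
  proof -
    have e: "ln (M / (real c * y) ^ 2) = 2 * ln (u / real c)" "real c * y / sqrt M = real c * (1 / u)" if "c \<ge> 1" for c
    proof -
      have "M / (real c * y) ^ 2 = (u / real c) ^ 2"
        using M by (simp add: u_def power_divide power_mult_distrib)
      thus "ln (M / (real c * y) ^ 2) = 2 * ln (u / real c)" using u that by (simp add: ln_realpow)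
      show "real c * y / sqrt M = real c * (1 / u)" by (simp add: u_def)
    qed
    have "(\<Sum>c\<in>C. ln (M / (real c * y) ^ 2) + sqrt M * row_integral (real c * y / sqrt M))
        = (\<Sum>c\<in>C. 2 * ln (u / real c) + sqrt M * row_integral (real c * (1 / u)))"
      using C(1) by (intro sum.cong) (auto simp: e)
    also have "\<dots> \<le> (\<Sum>c=1..N. 2 * ln (u / real c) + sqrt M * row_integral (real c * (1 / u)))"
    proof (intro sum_mono2 C(1))
      fix c assume "c \<in> {1..N} - C"
      hence c: "c \<ge> 1" "real c \<le> u" using N by auto
      hence "ln (u / real c) \<ge> 0" "row_integral (real c * (1 / u)) \<ge> 0"
        using u by (auto intro!: row_integral_nonneg_antimono(2) simp: ln_ge_zero)
      thus "0 \<le> 2 * ln (u / real c) + sqrt M * row_integral (real c * (1 / u))" using M by simp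
    qed auto
    finally show ?thesis .
  qed
  also have "\<dots> = 2 * (\<Sum>c=1..N. ln (u / real c)) + sqrt M * u * (\<Sum>c=1..N. 1 / u * row_integral (real c * (1 / u)))"
    using u by (simp add: sum.distrib sum_distrib_left)
  also have "\<dots> \<le> 2 * u + sqrt M * u * (pi / 2)"
    using u N M by (intro add_mono mult_left_mono sum_ln_quotient_le sum_row_integral_le) (auto simp: field_simps)
  also have "\<dots> = 2 * sqrt M / y + pi * M / (2 * y)"
    using M by (simp add: u_def mult_ac)
  finally show ?thesis .
qed

section \<open>The height bound\<close>

text \<open>Up to height 1.3 the factor Im^6 is so far below 2^6 that the crude |q| <= 1/229 is good
  enough. Above it |q| <= 1/3400, and (1 + 252/3400)^3 plus the Delta term is just below 1.24, the
  origin of the constant.\<close>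

lemma E4_Delta_invariant_fundamental_domain:
  assumes z: "z \<in> fundamental_domain"
  shows "E4_Delta_invariant z \<le> 124 / 100 * max 2 (Im z) ^ 6"
proof -
  have Im: "Im z > 866 / 1000" using Im_fundamental_domain(2)[OF z] .
  have q: "norm (nome z) \<le> 1 / 229" using norm_nome_fundamental_domain[OF z] .
  have E: "cmod (E4 z) \<le> 1 + 252 * norm (nome z)"
    using norm_triangle_mono[of 1 1 "E4 z - 1", OF _ E4_q_minus_1_bound[OF q, folded E4_def]] by simp
  have D: "cmod (Delta z) \<le> 265 / 229 * norm (nome z)"
    using norm_Delta_q_bounds(2)[OF q] by (simp add: Delta_def)
  have *: "cmod (E4 z) ^ 3 + cmod (Delta z) \<le> (1 + 252 * r) ^ 3 + 265 / 229 * r" if "norm (nome z) \<le> r" for r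
    using E D that by (intro add_mono power_mono) auto
  show ?thesis
  proof (cases "Im z \<le> 13 / 10")
    case True
    have "E4_Delta_invariant z \<le> (13 / 10) ^ 6 * ((1 + 252 * (1 / 229)) ^ 3 + 265 / 229 * (1 / 229))"
      unfolding E4_Delta_invariant_def using Im True *[OF q] by (intro mult_mono power_mono) auto
    also have "\<dots> \<le> 124 / 100 * 2 ^ 6" by (simp add: power_divide)
    also have "\<dots> \<le> 124 / 100 * max 2 (Im z) ^ 6" by (intro mult_left_mono power_mono) auto
    finally show ?thesis .
  next
    case False
    have "2 * (31415 / 10000) * (13 / 10) \<le> 2 * pi * Im z"
      using False pi_approx(1) by (intro mult_mono) auto
    hence "exp (- 2 * pi * Im z) \<le> exp (- (816 / 100))" by simp
    from order_trans[OF this exp_bounds(2)] have q': "norm (nome z) \<le> 1 / 3400" by (simp only: norm_nome)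
    have "E4_Delta_invariant z \<le> max 2 (Im z) ^ 6 * ((1 + 252 * (1 / 3400)) ^ 3 + 265 / 229 * (1 / 3400))"
      unfolding E4_Delta_invariant_def using Im *[OF q'] by (intro mult_mono power_mono) auto
    also have "\<dots> \<le> max 2 (Im z) ^ 6 * (124 / 100)" by (intro mult_left_mono) (auto simp: power_divide)
    finally show ?thesis by (simp only: mult.commute)
  qed
qed

text \<open>|j| = 1 means |E4|^3 = |Delta|, impossible above height 0.95, where |E4| >= 0.28 and
  Delta is much smaller. Since 0.95 < 3 / pi, the function y^6 exp(-2 pi y) increases on the range
  that is left and is least at y = sqrt 3 / 2. With log(193/229) >= -0.2 this gives -1 - 5.445 - 0.2
  > -6.65.\<close>

lemma unit_modular_j_bounds:
  assumes z: "z \<in> fundamental_domain" and j: "cmod (modular_j z) = 1"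
  shows "Im z \<le> 95 / 100" "ln (Delta_invariant z) \<ge> - (665 / 100)"
proof -
  have Im: "Im z > 866 / 1000" "Im z \<ge> sqrt 3 / 2" "Im z > 0" using Im_fundamental_domain[OF z] by auto
  have q: "norm (nome z) \<le> 1 / 229" using norm_nome_fundamental_domain[OF z] .
  show Im': "Im z \<le> 95 / 100"
  proof (rule ccontr)
    assume "\<not> Im z \<le> 95 / 100"
    hence "2 * (31415 / 10000) * (95 / 100) \<le> 2 * pi * Im z"
      using pi_approx(1) by (intro mult_mono) auto
    hence "exp (- 2 * pi * Im z) \<le> exp (- (596 / 100))" by simp
    from order_trans[OF this exp_bounds(3)] have q': "norm (nome z) \<le> 1 / 350" by (simp only: norm_nome)
    have "norm (E4 z - 1) \<le> 252 * (1 / 350)"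
      using E4_q_minus_1_bound[OF q, folded E4_def] q' by linarith
    hence "cmod (E4 z) \<ge> 28 / 100" using norm_triangle_ineq2[of 1 "1 - E4 z"] by (simp add: norm_minus_commute)
    hence "cmod (E4 z) ^ 3 \<ge> (28 / 100) ^ 3" by (intro power_mono) auto
    moreover have "cmod (Delta z) \<le> 265 / 229 * (1 / 350)"
      using norm_Delta_q_bounds(2)[OF q] q' by (simp add: Delta_def)
    moreover have "cmod (E4 z) ^ 3 = cmod (Delta z)"
      using j Delta_nonzero[OF Im(3)] by (simp add: modular_j_eq[OF Im(3)] norm_divide norm_power)
    ultimately show False by (simp add: power_divide)
  qed
  define y0 where "y0 = sqrt 3 / (2 :: real)"
  have y0: "y0 > 0" "y0 \<le> Im z" using Im by (auto simp: y0_def)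
  have "2 * pi * (Im z - y0) \<le> 6 * (ln (Im z) - ln y0)"
  proof -
    have "2 * pi * Im z \<le> 2 * (31416 / 10000) * (95 / 100)"
      using Im Im' pi_approx(2) by (intro mult_mono) auto
    hence "2 * pi \<le> 6 / Im z" using Im by (simp add: pos_le_divide_eq)
    hence "2 * pi * (Im z - y0) \<le> 6 / Im z * (Im z - y0)" using y0 by (intro mult_right_mono) auto
    also have "\<dots> = 6 * (1 - y0 / Im z)" using Im by (simp add: field_simps)
    also have "\<dots> \<le> 6 * (- ln (y0 / Im z))"
      using ln_le_minus_one[of "y0 / Im z"] y0 Im by simp
    also have "\<dots> = 6 * (ln (Im z) - ln y0)" using y0 Im by (simp add: ln_div)
    finally show ?thesis .
  qed
  moreover have "6 * ln y0 \<ge> - 1"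
  proof -
    have "ln (4 / 3 :: real) \<le> 4 / 3 - 1" by (rule ln_le_minus_one) simp
    moreover have "ln (y0 ^ 2) = - ln (4 / 3)"
      by (simp add: y0_def power_divide ln_div)
    hence "2 * ln y0 = - ln (4 / 3)" using y0 by (simp add: ln_realpow)
    ultimately show ?thesis by simp
  qed
  moreover have "2 * pi * y0 \<le> 5445 / 1000"
  proof -
    have "sqrt 3 \<le> (1733 / 1000 :: real)" by (rule real_le_lsqrt) (auto simp: power2_eq_square)
    hence "pi * sqrt 3 \<le> (31416 / 10000) * (1733 / 1000)" using pi_approx(2) by (intro mult_mono) auto
    thus ?thesis by (simp add: y0_def)
  qed
  moreover have "ln (193 / 229 :: real) \<ge> - (20 / 100)"
  proof -
    have "ln (229 / 193 :: real) \<le> 229 / 193 - 1" by (rule ln_le_minus_one) simp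
    moreover have "ln (193 / 229 :: real) = - ln (229 / 193)" by (simp add: ln_div)
    ultimately show ?thesis by simp
  qed
  moreover have "ln (Delta_invariant z) \<ge> 6 * ln (Im z) + (ln (193 / 229) - 2 * pi * Im z)"
  proof -
    have "193 / 229 * exp (- 2 * pi * Im z) \<le> cmod (Delta z)"
      using norm_Delta_q_bounds(1)[OF q] by (simp only: Delta_def norm_nome)
    hence "ln (193 / 229 * exp (- 2 * pi * Im z)) \<le> ln (cmod (Delta z))"
      using Delta_nonzero[OF Im(3)] by (subst ln_le_cancel_iff) auto
    also have "ln (193 / 229 * exp (- 2 * pi * Im z)) = ln (193 / 229) - 2 * pi * Im z"
      by (subst ln_mult) auto
    finally show ?thesis
      using Im(3) Delta_nonzero[OF Im(3)] by (simp add: Delta_invariant_def ln_mult ln_realpow)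
  qed
  ultimately show "ln (Delta_invariant z) \<ge> - (665 / 100)" by (simp add: algebra_simps)
qed

text \<open>The bottom row of the reducing matrix is exposed because it carries the short vector;
  for c = 0 the determinant forces d to be 1 or -1.\<close>

lemma E4_Delta_invariant_le:
  assumes w: "Im w > 0"
  obtains c d :: int where "c = 0 \<Longrightarrow> \<bar>d\<bar> = 1" "(c, d) \<noteq> (0, 0)"
    "E4_Delta_invariant w \<le> 124 / 100 * max 2 (Im w / cmod (of_int c * w + of_int d) ^ 2) ^ 6"
proof -
  obtain a b c d :: int where det: "a * d - b * c = 1"
    and f: "moebius a b c d w \<in> fundamental_domain"
    by (rule modular_reduction[OF w, of "\<lambda>_. True"]) auto
  have "\<bar>d\<bar> = 1" if "c = 0"
    using det that by (metis abs_zmult_eq_1 abs_one diff_zero mult.commute mult_zero_right)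
  moreover have "(c, d) \<noteq> (0, 0)" using det by auto
  moreover have "E4_Delta_invariant w \<le> 124 / 100 * max 2 (Im w / cmod (of_int c * w + of_int d) ^ 2) ^ 6"
    using E4_Delta_invariant_fundamental_domain[OF f]
    unfolding Delta_invariant_moebius(2)[OF w det] modular_transform(3)[OF w det] .
  ultimately show ?thesis using that by blast
qed

text \<open>A point \<open>(z + b) / l\<close> whose reduction is high up in the cusp yields a short vector of the
  lattice spanned by \<open>z\<close> and \<open>1\<close>, lying in only one of the sublattices of index \<open>l\<close>.\<close>

lemma hecke_short_vectors:
  fixes c d :: "nat \<Rightarrow> int"
  assumes l: "prime l" and y: "Im z > 866 / 1000" "Im z \<le> 95 / 100"
    and cd: "\<And>b. b < l \<Longrightarrow> c b = 0 \<Longrightarrow> \<bar>d b\<bar> = 1"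
  defines "h \<equiv> \<lambda>b. Im (hecke_point l b z) / cmod (of_int (c b) * hecke_point l b z + of_int (d b)) ^ 2"
  defines "M \<equiv> real l * Im z / 2"
  defines "N \<equiv> \<lambda>(k, m). (of_int m + real k * Re z) ^ 2 + (real k * Im z) ^ 2"
  obtains W :: "(nat \<times> int) set" where "finite W" "\<And>k m. (k, m) \<in> W \<Longrightarrow> k \<ge> 1 \<and> N (k, m) < M"
    "(\<Sum>b<l. ln (max 2 (h b) / 2)) = (\<Sum>p\<in>W. ln (M / N p))"
proof -
  have l0: "l > 0" using l prime_gt_0_nat by blast
  have l1: "l \<ge> 2" using l prime_ge_2_nat by blast
  have M: "M > 0" using l0 y by (simp add: M_def)
  define B where "B = {b. b < l \<and> h b > 2}"
  \<comment> \<open>For w = (z + b) / l, the number l (c w + d) = c z + (c b + d l) is a vector of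
    the lattice spanned by z and 1. The sign of c is normalised, so that v and -v count
    once.\<close>
  define p where "p = (\<lambda>b. (nat \<bar>c b\<bar>, sgn (c b) * (c b * int b + d b * int l)))"
  have h: "h b = 2 * M / ((of_int (c b * int b + d b * int l) + of_int (c b) * Re z) ^ 2 + (of_int (c b) * Im z) ^ 2)"
    if b: "b < l" for b
  proof -
    define v where "v = of_int (c b) * z + of_int (c b * int b + d b * int l)"
    have "of_int (c b) * hecke_point l b z + of_int (d b) = v / of_nat l"
      using b l0 by (simp add: hecke_point_def v_def add_divide_distrib distrib_left)
    hence "h b = (Im z / real l) / (cmod v ^ 2 / real l ^ 2)"
      using b by (simp add: h_def Im_hecke_point norm_divide power_divide)
    also have "\<dots> = real l * Im z / cmod v ^ 2" using l0 by (simp add: power2_eq_square)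
    also have "cmod v ^ 2 = (of_int (c b * int b + d b * int l) + of_int (c b) * Re z) ^ 2 + (of_int (c b) * Im z) ^ 2"
      by (simp add: cmod_power2 v_def add_ac)
    finally show ?thesis by (simp add: M_def)
  qed
  \<comment> \<open>For c = 0 the reduced height is Im z / l, too low for membership in
    \<open>B\<close>.\<close>
  have c0: "c b \<noteq> 0" if "b \<in> B" for b
  proof
    assume c: "c b = 0"
    have b: "b < l" "h b > 2" using that by (auto simp: B_def)
    have "d b ^ 2 = 1" using cd[OF b(1) c] by (metis one_power2 power2_abs)
    hence "h b = 2 * M / real l ^ 2" using h[OF b(1)] c
      by (simp add: power_mult_distrib flip: of_int_power)
    also have "\<dots> = Im z / real l" using l0 by (simp add: M_def power2_eq_square)
    also have "\<dots> \<le> 2" using l1 y by (simp add: divide_le_eq)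
    finally show False using b by simp
  qed
  have Np: "N (p b) = (of_int (c b * int b + d b * int l) + of_int (c b) * Re z) ^ 2 + (of_int (c b) * Im z) ^ 2"
    if "b \<in> B" for b
  proof -
    define s where "s = real_of_int (sgn (c b))"
    have s: "s ^ 2 = 1" using c0[OF that] by (simp add: s_def sgn_if)
    have k: "real (nat \<bar>c b\<bar>) = s * of_int (c b)" by (simp add: s_def sgn_if)
    have "N (p b) = (s * (of_int (c b * int b + d b * int l) + of_int (c b) * Re z)) ^ 2 + (s * (of_int (c b) * Im z)) ^ 2"
      by (simp add: N_def p_def k) (simp add: s_def algebra_simps)
    thus ?thesis by (simp only: power_mult_distrib s mult_1)
  qed
  have hN: "h b = 2 * M / N (p b)" if "b \<in> B" for b
    using h[of b] Np[OF that] that by (simp add: B_def)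
  have Npos: "N (p b) > 0" if "b \<in> B" for b
    using c0[OF that] y unfolding Np[OF that] by (intro add_nonneg_pos) auto
  have NM: "N (p b) < M" if "b \<in> B" for b
    using hN[OF that] Npos[OF that] that by (simp add: B_def pos_less_divide_eq)
  \<comment> \<open>With k = |c|, k^2 y^2 < l y / 2 and y > 1/2 give k^2 < l, hence k < l.\<close>
  have ck: "\<bar>c b\<bar> < int l" if "b \<in> B" for b
  proof -
    define k where "k = real_of_int \<bar>c b\<bar>"
    have "(k * Im z) ^ 2 < real l * Im z / 2"
      using NM[OF that] unfolding Np[OF that] M_def by (simp add: k_def power_mult_distrib) (smt (verit) zero_le_power2)
    hence "(k ^ 2 * Im z) * Im z < (real l / 2) * Im z" by (simp add: power2_eq_square mult_ac)
    hence k2: "k ^ 2 * Im z < real l / 2" using y by simp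
    have "k ^ 2 * (1 / 2) \<le> k ^ 2 * Im z" using y by (intro mult_left_mono) auto
    hence "k ^ 2 < real l" using k2 by simp
    hence "k ^ 2 < real l ^ 2" using l0 by (smt (verit) of_nat_0_less_iff of_nat_1 of_nat_le_iff power2_eq_square mult_le_cancel_right1 Suc_leI One_nat_def)
    hence "k < real l" by (rule power2_less_imp_less) simp
    thus ?thesis by (simp add: k_def)
  qed
  \<comment> \<open>Equal vectors force l to divide c (b - b'); as l is prime and 0 < |c| < l, it
    divides b - b', so b = b'.\<close>
  have inj: "inj_on p B"
  proof (rule inj_onI)
    fix b b' assume b: "b \<in> B" "b' \<in> B" "p b = p b'"
    define s s' where "s = sgn (c b)" and "s' = sgn (c b')"
    have "\<bar>c b\<bar> = \<bar>c b'\<bar>" using b(3) by (auto simp: p_def eq_nat_nat_iff)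
    moreover have "sgn x * x = \<bar>x\<bar>" for x :: int by (simp add: sgn_if)
    ultimately have c': "s * c b = s' * c b'" by (simp add: s_def s'_def)
    have "s * (c b * int b + d b * int l) = s' * (c b' * int b' + d b' * int l)"
      using b(3) by (simp add: p_def s_def s'_def)
    hence "(s * c b) * int b + s * d b * int l = (s' * c b') * int b' + s' * d b' * int l"
      by (simp add: algebra_simps)
    hence "(s * c b) * (int b - int b') = int l * (s' * d b' - s * d b)"
      unfolding c' [symmetric] by (simp add: algebra_simps)
    hence "int l dvd (s * c b) * (int b - int b')" by simp
    hence "int l dvd s * c b \<or> int l dvd int b - int b'"
      using l by (simp add: prime_dvd_mult_iff)
    moreover have "\<not> int l dvd s * c b"
    proof
      assume "int l dvd s * c b"
      moreover have "s * c b = \<bar>c b\<bar>" by (simp add: s_def sgn_if)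
      ultimately have "int l \<le> \<bar>c b\<bar>" using c0[OF b(1)] by (intro zdvd_imp_le) auto
      thus False using ck[OF b(1)] by simp
    qed
    ultimately have "int l dvd \<bar>int b - int b'\<bar>" by simp
    moreover have "\<bar>int b - int b'\<bar> < int l" using b by (auto simp: B_def)
    ultimately show "b = b'" using zdvd_imp_le[of "int l" "\<bar>int b - int b'\<bar>"] by (cases "b = b'") auto
  qed
  have finB: "finite B" by (rule finite_subset[of _ "{..<l}"]) (auto simp: B_def)
  show ?thesis
  proof (rule that[of "p ` B"])
    show "finite (p ` B)" using finB by simp
    show "k \<ge> 1 \<and> N (k, m) < M" if km: "(k, m) \<in> p ` B" for k m
    proof -
      obtain b where b: "b \<in> B" "(k, m) = p b" using km by blast
      have "k = nat \<bar>c b\<bar>" using b(2) by (simp add: p_def)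
      thus ?thesis using c0[OF b(1)] NM[OF b(1)] b(2) by simp
    qed
    have "(\<Sum>b<l. ln (max 2 (h b) / 2)) = (\<Sum>b\<in>B. ln (max 2 (h b) / 2))"
      by (intro sum.mono_neutral_right) (auto simp: B_def max_def)
    also have "\<dots> = (\<Sum>b\<in>B. ln (M / N (p b)))"
    proof (rule sum.cong)
      fix b assume b: "b \<in> B"
      have "max 2 (h b) / 2 = M / N (p b)" using hN[OF b] b by (simp add: B_def max_def)
      thus "ln (max 2 (h b) / 2) = ln (M / N (p b))" by simp
    qed simp
    also have "\<dots> = (\<Sum>p\<in>p ` B. ln (M / N p))" by (simp add: sum.reindex[OF inj])
    finally show "(\<Sum>b<l. ln (max 2 (h b) / 2)) = (\<Sum>p\<in>p ` B. ln (M / N p))" .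
  qed
qed

text \<open>For k >= 2 the imaginary part alone exceeds 1; for k = 1, |m + x| >= |x| because |x| <=
  1/2, and |z| >= 1. This serves the case l = 2, where M < 1 leaves no short vectors.\<close>

lemma norm_sq_ge_1_fundamental_domain:
  assumes z: "z \<in> fundamental_domain" and k: "k \<ge> 1"
  shows "(of_int m + real k * Re z) ^ 2 + (real k * Im z) ^ 2 \<ge> 1"
proof (cases "k = 1")
  case True
  have x: "\<bar>Re z\<bar> \<le> 1 / 2" "1 \<le> cmod z" using z by (auto simp: fundamental_domain_def)
  have "\<bar>Re z\<bar> \<le> \<bar>of_int m + Re z\<bar>"
  proof (cases "m = 0")
    case False
    hence "1 \<le> \<bar>m\<bar>" by simp
    hence "1 \<le> \<bar>real_of_int m\<bar>" by linarith
    thus ?thesis using x by linarith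
  qed simp
  hence "Re z ^ 2 \<le> (of_int m + Re z) ^ 2" by (simp add: abs_le_square_iff)
  moreover have "1 ^ 2 \<le> cmod z ^ 2" using x by (intro power_mono) auto
  ultimately show ?thesis using True cmod_power2[of z] by simp
next
  case False
  have "2 * (866 / 1000) \<le> real k * Im z"
    using False k Im_fundamental_domain(2)[OF z] by (intro mult_mono) auto
  hence "(2 * (866 / 1000)) ^ 2 \<le> (real k * Im z) ^ 2" by (intro power_mono) auto
  moreover have "(1 :: real) \<le> (2 * (866 / 1000)) ^ 2" by (simp add: power2_eq_square)
  ultimately show ?thesis using zero_le_power2[of "of_int m + real k * Re z"] by linarith
qed

lemma prod_one_plus_modular_j_le:
  assumes l: "prime l" and z: "z \<in> fundamental_domain" and j: "cmod (modular_j z) = 1"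
  shows "(\<Prod>b\<le>l. 1 + cmod (modular_j (hecke_point l b z)))
     \<le> exp (6 * real l * ln (real l) + 16 * real l + 14 * sqrt (real l) * ln (real l))"
proof -
  have l2: "l \<ge> 2" and l0: "l > 0" using l prime_ge_2_nat prime_gt_0_nat by blast+
  define y where "y = Im z"
  have y: "y > 866 / 1000" "y \<le> 95 / 100" "Im z > 0"
    using Im_fundamental_domain[OF z] unit_modular_j_bounds(1)[OF z j] by (auto simp: y_def)
  define w where "w = (\<lambda>b. hecke_point l b z)"
  have w: "Im (w b) > 0" for b unfolding w_def by (rule Im_hecke_point_pos[OF y(3) l0])
  have "\<forall>b. \<exists>c d :: int. (c = 0 \<longrightarrow> \<bar>d\<bar> = 1) \<and> (c, d) \<noteq> (0, 0) \<and>
      E4_Delta_invariant (w b) \<le> 124 / 100 * max 2 (Im (w b) / cmod (of_int c * w b + of_int d) ^ 2) ^ 6"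
    using E4_Delta_invariant_le[OF w] by metis
  then obtain c d :: "nat \<Rightarrow> int" where cd: "\<And>b. c b = 0 \<Longrightarrow> \<bar>d b\<bar> = 1" "\<And>b. (c b, d b) \<noteq> (0, 0)"
     "\<And>b. E4_Delta_invariant (w b) \<le> 124 / 100 * max 2 (Im (w b) / cmod (of_int (c b) * w b + of_int (d b)) ^ 2) ^ 6"
    by metis
  define h where "h = (\<lambda>b. Im (w b) / cmod (of_int (c b) * w b + of_int (d b)) ^ 2)"
  define M where "M = real l * y / 2"
  define N where "N = (\<lambda>(k::nat, m::int). (of_int m + real k * Re z) ^ 2 + (real k * Im z) ^ 2)"
  have M: "M > 0" using l0 y by (simp add: M_def)
  obtain W where W: "finite W" "\<And>k m. (k, m) \<in> W \<Longrightarrow> k \<ge> 1 \<and> N (k, m) < M"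
    "(\<Sum>b<l. ln (max 2 (h b) / 2)) = (\<Sum>p\<in>W. ln (M / N p))"
    by (rule hecke_short_vectors[OF l, of z c d]) (use y cd in \<open>auto simp: y_def M_def N_def h_def w_def\<close>)
  define T where "T = (\<Sum>b\<le>l. ln (max 2 (h b) / 2))"
  \<comment> \<open>The point l z: with c = 0 its reduced height is l y = 2 M, otherwise at most 1 /
    (l y), which is below 2.\<close>
  have hl: "ln (max 2 (h l) / 2) \<le> max 0 (ln M)"
  proof -
    have wl: "w l = of_nat l * z" by (simp add: w_def hecke_point_def)
    have "max 2 (h l) / 2 \<le> max 1 M"
    proof (cases "c l = 0")
      case True
      hence "cmod (of_int (c l) * w l + of_int (d l)) = 1" using cd(1)[of l] by (simp flip: of_int_abs)
      thus ?thesis by (simp add: h_def wl M_def y_def)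
    next
      case False
      have "real l * y * 1 \<le> real l * y * \<bar>of_int (c l)\<bar>" using False y by (intro mult_left_mono) auto
      also have "\<dots> = \<bar>Im (of_int (c l) * w l + of_int (d l))\<bar>" using y by (simp add: wl y_def abs_mult)
      also have "\<dots> \<le> cmod (of_int (c l) * w l + of_int (d l))" by (rule abs_Im_le_cmod)
      finally have "(real l * y) ^ 2 \<le> cmod (of_int (c l) * w l + of_int (d l)) ^ 2"
        using y by (intro power_mono) auto
      hence "h l \<le> real l * y / (real l * y) ^ 2"
        unfolding h_def using y l0 by (intro frac_le) (auto simp: wl y_def)
      also have "\<dots> = 1 / (real l * y)" by (simp add: power2_eq_square)
      also have "\<dots> \<le> 2"
      proof -
        have "2 * (866 / 1000) \<le> real l * y" using l2 y by (intro mult_mono) auto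
        thus ?thesis using l0 y by (simp add: divide_le_eq)
      qed
      finally show ?thesis by simp
    qed
    hence "ln (max 2 (h l) / 2) \<le> ln (max 1 M)" by (subst ln_le_cancel_iff) auto
    also have "\<dots> \<le> max 0 (ln M)" by (auto simp: max_def)
    finally show ?thesis .
  qed
  \<comment> \<open>What the lattice sum may cost once the rest is paid: 6 (l - 1) log l from the
    Delta product and, for each of the l + 1 points, 6.65 for \<open>Delta_invariant z\<close>, 0.24
    for log 1.24 and 6 log 2 for the threshold.\<close>
  have T: "6 * T \<le> 6 * real l * ln (real l) + 16 * real l + 14 * sqrt (real l) * ln (real l)
         - 6 * real (l - 1) * ln (real l) - real (l + 1) * (665 / 100 + 24 / 100 + 6 * ln 2)"
  proof -
    have T_eq: "T = (\<Sum>p\<in>W. ln (M / N p)) + ln (max 2 (h l) / 2)"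
      unfolding T_def by (simp add: lessThan_Suc_atMost [symmetric] W(3))
    have ln2: "ln 2 \<le> 25 / (36 :: real)" by (rule ln2_le_25_over_36)
    have l1: "real (l - 1) = real l - 1" using l0 by (simp add: of_nat_diff)
    show ?thesis
    \<comment> \<open>For l = 2 one has log l < 1, so sqrt l cannot be absorbed into sqrt l log l;
      but M = y < 1 then makes T <= 0.\<close>
    proof (cases "l = 2")
      case True
      have "W = {}"
      proof (rule ccontr)
        assume "W \<noteq> {}"
        then obtain k m where km: "(k, m) \<in> W" by force
        from W(2)[OF km] norm_sq_ge_1_fundamental_domain[OF z, of k m] have "M > 1" by (simp add: N_def)
        thus False using y True by (simp add: M_def)
      qed
      moreover have "ln M \<le> 0" using M y True by (simp add: M_def)
      ultimately have "T \<le> 0" using hl T_eq by simp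
      hence "T * 6 + ln 2 * 12 \<le> 1133 / 100" using ln2 by linarith
      also have "\<dots> \<le> sqrt 2 * (ln 2 * 14) + 1133 / 100" by simp
      finally show ?thesis using True by (simp add: algebra_simps)
    next
      case False
      hence l3: "real l \<ge> 3" using l2 by linarith
      have "3 * (866 / 1000) / 2 \<le> M" unfolding M_def using l3 y by (intro divide_right_mono mult_mono) auto
      hence M1: "M \<ge> 1" by simp
      have WS: "(\<Sum>p\<in>W. ln (M / N p)) \<le> 2 * (sqrt M / y) + pi * M / (2 * y)"
        using lattice_log_sum_le[of y M W "Re z"] y M W(1,2) by (simp add: N_def y_def case_prod_unfold)
      \<comment> \<open>The constant satisfies 0.76^2 >= 1 / (2 * 0.866), an upper bound for 1 / (2
        y).\<close>
      have "sqrt M / y \<le> 76 / 100 * sqrt (real l)"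
      proof -
        have "sqrt M / y = sqrt (M / y ^ 2)" using y by (simp add: real_sqrt_divide)
        also have "M / y ^ 2 = real l * (1 / (2 * y))" using y by (simp add: M_def power2_eq_square)
        also have "sqrt (real l * (1 / (2 * y))) \<le> sqrt (real l * (76 / 100) ^ 2)"
        proof (intro real_sqrt_le_mono mult_left_mono)
          have "1 / (2 * y) \<le> 1 / (2 * (866 / 1000))" using y by (intro divide_left_mono) auto
          thus "1 / (2 * y) \<le> (76 / 100) ^ 2" by (simp add: power2_eq_square)
        qed simp
        finally show ?thesis by (simp add: real_sqrt_mult mult.commute)
      qed
      moreover have "pi * M / (2 * y) = pi * real l / 4" using y by (simp add: M_def)
      moreover have "pi * real l \<le> 31416 / 10000 * real l" using pi_approx(2) by (intro mult_right_mono) auto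
      moreover have "max 0 (ln M) = ln M" using M1 by simp
      moreover have "ln M = ln (real l) + ln (y / 2)"
      proof -
        have "M = real l * (y / 2)" by (simp add: M_def)
        also have "ln \<dots> = ln (real l) + ln (y / 2)" using l0 y by (subst ln_mult) auto
        finally show ?thesis .
      qed
      moreover have "ln (y / 2) \<le> y / 2 - 1" using y by (intro ln_le_minus_one) auto
      ultimately have T1: "T \<le> 2 * (76 / 100 * sqrt (real l)) + 31416 / 10000 * real l / 4 + ln (real l) + (95 / 200 - 1)"
        using WS hl T_eq y(2) by linarith
      have "ln (real l) \<ge> 1"
      proof -
        have "exp 1 \<le> real l" using exp_1_bounds(2) l3 by simp
        thus ?thesis using l0 by (simp add: ln_ge_iff)
      qed
      hence "sqrt (real l) * 1 \<le> sqrt (real l) * ln (real l)" by (intro mult_left_mono) auto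
      hence s1: "sqrt (real l) \<le> sqrt (real l) * ln (real l)" by simp
      \<comment> \<open>The slack (14 - 9.12) sqrt l, with 9.12 = 6 * 2 * 0.76, is then at least 8.4
        and pays for the terms free of l, about 7.9 in all.\<close>
      have "sqrt 3 \<ge> (173 / 100 :: real)" by (rule real_le_rsqrt) (simp add: power2_eq_square)
      moreover have "sqrt (real l) \<ge> sqrt 3" using l3 by simp
      ultimately have s2: "sqrt (real l) \<ge> 173 / 100" by linarith
      have "real l * ln 2 \<le> real l * (25 / 36)" using ln2 by (intro mult_left_mono) auto
      moreover have "real (l + 1) * (665 / 100 + 24 / 100 + 6 * ln 2)
          = 689 / 100 * real l + 689 / 100 + 6 * (real l * ln 2) + 6 * ln 2"
        by (simp add: algebra_simps)
      moreover have "6 * (real l - 1) * ln (real l) = 6 * (real l * ln (real l)) - 6 * ln (real l)"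
        by (simp add: algebra_simps)
      ultimately show ?thesis using T1 s1 s2 l3 ln2 unfolding l1 mult.assoc by linarith
    qed
  qed
  have G: "E4_Delta_invariant (w b) \<le> exp (24 / 100 + 6 * ln 2 + 6 * ln (max 2 (h b) / 2))" for b
  proof -
    \<comment> \<open>This is 1 + x <= exp x at x = 0.24.\<close>
    have "(124 / 100 :: real) \<le> exp (24 / 100)" using exp_ge_add_one_self[of "24 / 100 :: real"] by simp
    moreover have "max 2 (h b) = exp (ln 2 + ln (max 2 (h b) / 2))"
      by (simp add: exp_add)
    hence "max 2 (h b) ^ 6 = exp (6 * ln 2 + 6 * ln (max 2 (h b) / 2))"
      by (metis (no_types) exp_of_nat_mult distrib_left of_nat_numeral)
    ultimately have "124 / 100 * max 2 (h b) ^ 6 \<le> exp (24 / 100) * exp (6 * ln 2 + 6 * ln (max 2 (h b) / 2))"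
      by (intro mult_mono) auto
    thus ?thesis using cd(3)[of b] by (simp add: h_def exp_add mult.assoc)
  qed
  have "(\<Prod>b\<le>l. 1 + cmod (modular_j (w b))) = (\<Prod>b\<le>l. E4_Delta_invariant (w b)) / (\<Prod>b\<le>l. Delta_invariant (w b))"
    using one_plus_norm_modular_j[OF w] by (simp add: prod_dividef)
  also have "\<dots> \<le> (\<Prod>b\<le>l. exp (24 / 100 + 6 * ln 2 + 6 * ln (max 2 (h b) / 2))) /
                     (real l ^ 6 / real l ^ (6 * l) * Delta_invariant z ^ (l + 1))"
  proof (rule frac_le)
    show "(\<Prod>b\<le>l. E4_Delta_invariant (w b)) \<le> (\<Prod>b\<le>l. exp (24 / 100 + 6 * ln 2 + 6 * ln (max 2 (h b) / 2)))"
      using G w by (intro prod_mono) (auto simp: E4_Delta_invariant_def)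
    show "0 < real l ^ 6 / real l ^ (6 * l) * Delta_invariant z ^ (l + 1)"
      using l0 Delta_invariant_pos[OF y(3)] by simp
    show "real l ^ 6 / real l ^ (6 * l) * Delta_invariant z ^ (l + 1) \<le> (\<Prod>b\<le>l. Delta_invariant (w b))"
      unfolding w_def by (rule prod_Delta_hecke_ge[OF l y(3)])
  qed (auto intro: prod_nonneg)
  also have "(\<Prod>b\<le>l. exp (24 / 100 + 6 * ln 2 + 6 * ln (max 2 (h b) / 2))) = exp (real (l + 1) * (24 / 100 + 6 * ln 2) + 6 * T)"
    unfolding T_def exp_sum [OF finite_atMost, symmetric]
    by (simp add: sum.distrib sum_distrib_left algebra_simps)
  also have "real l ^ 6 / real l ^ (6 * l) * Delta_invariant z ^ (l + 1)
      = exp (real (l + 1) * ln (Delta_invariant z) - 6 * real (l - 1) * ln (real l))"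
  proof -
    have "real l ^ n = exp (real n * ln (real l))" for n using l0 by (simp add: exp_of_nat_mult)
    moreover have "Delta_invariant z ^ n = exp (real n * ln (Delta_invariant z))" for n
      using Delta_invariant_pos[OF y(3)] by (simp add: exp_of_nat_mult)
    ultimately have "real l ^ 6 / real l ^ (6 * l) * Delta_invariant z ^ (l + 1)
      = exp ((real 6 * ln (real l) - real (6 * l) * ln (real l)) + real (l + 1) * ln (Delta_invariant z))"
      by (simp only: exp_diff exp_add)
    also have "(real 6 * ln (real l) - real (6 * l) * ln (real l)) + real (l + 1) * ln (Delta_invariant z)
       = real (l + 1) * ln (Delta_invariant z) - 6 * real (l - 1) * ln (real l)"
      using l0 by (simp add: of_nat_diff algebra_simps)
    finally show ?thesis .
  qed
  also have "exp (real (l + 1) * (24 / 100 + 6 * ln 2) + 6 * T) /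
        exp (real (l + 1) * ln (Delta_invariant z) - 6 * real (l - 1) * ln (real l))
     = exp (real (l + 1) * (24 / 100 + 6 * ln 2) + 6 * T - (real (l + 1) * ln (Delta_invariant z) - 6 * real (l - 1) * ln (real l)))"
    by (simp only: exp_diff)
  also have "\<dots> \<le> exp (6 * real l * ln (real l) + 16 * real l + 14 * sqrt (real l) * ln (real l))"
  proof -
    have "real (l + 1) * (- (665 / 100)) \<le> real (l + 1) * ln (Delta_invariant z)"
      using unit_modular_j_bounds(2)[OF z j] by (intro mult_left_mono) auto
    moreover define n where "n = real (l + 1)"
    ultimately show ?thesis using T unfolding exp_le_cancel_iff n_def [symmetric]
      by (simp only: distrib_left)
  qed
  finally show ?thesis by (simp add: w_def)
qed

theorem theorem1:
  fixes l :: nat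
  assumes "prime l"
  shows "poly2_height (modular_polynomial l)
           \<le> 6 * real l * ln (real l) + 16 * real l + 14 * sqrt (real l) * ln (real l)"
proof (rule poly2_height_le)
  show "modular_polynomial l \<noteq> 0" using modular_polynomial_hecke(2)[OF assms] by auto
  show "cmod (coeff (coeff (modular_polynomial l) i) k)
      \<le> exp (6 * real l * ln (real l) + 16 * real l + 14 * sqrt (real l) * ln (real l))" for i k
    by (rule norm_coeff_modular_polynomial_le[OF assms prod_one_plus_modular_j_le[OF assms]])
qed

end
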